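(* Let $k$ be a fixed positive integer. For any integer $1\leq \ell \leq k$, there exists a randomized combinatorial algorithm running in $\tilde{O}\big(mn + n^{k-\ell + \frac{\ell(\ell + 1)}{2(k+1)}+1}\big)$ time that, with high probability, computes a $\left( 2- \frac{1}{2\ell}, 1 - \frac{1}{2\ell}\right)$-approximation to the $k$-center of any unweighted, undirected graph $G$ with $n$ vertices and $m$ edges.
   Context: $G=(V,E)$ is an undirected unweighted graph with $n$ vertices and $m\ge n-1$ edges, $d$ its shortest-path distance. $R_k(G)=\min_{C\subseteq V,|C|=k}\max_{v\in V} d(v,C)$ with $d(v,C)=\min_{c\in C}d(v,c)$ (the $k$-radius). An $(\alpha,\beta)$-approximation to the $k$-center is a value $\tilde R$ (witnessed by $k$ vertices covering all vertices within distance $\tilde R$) with $R_k(G)\le \tilde R\le \alpha R_k(G)+\beta$. "Combinatorial" means the algorithm does not use fast matrix multiplication. $\tilde O$ hides polylogarithmic factors; "with high probability" means with probability at least $1-1/n^{c}$ for a constant $c>0$. *)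

theory Defs
  imports "HOL-Probability.Probability" "HOL-Library.Log_Nat"
begin

section \<open>Graphs, distances and the k-radius\<close>

definition simple_graph :: "'a set \<Rightarrow> 'a set set \<Rightarrow> bool" where
  "simple_graph V E \<longleftrightarrow> finite V \<and> E \<subseteq> {{u, v} | u v. u \<in> V \<and> v \<in> V \<and> u \<noteq> v}"

definition walk_betw :: "'a set \<Rightarrow> 'a set set \<Rightarrow> 'a \<Rightarrow> 'a list \<Rightarrow> 'a \<Rightarrow> bool" where
  "walk_betw V E u p v \<longleftrightarrow>
     p \<noteq> [] \<and> set p \<subseteq> V \<and> hd p = u \<and> last p = v \<and> successively (\<lambda>x y. {x, y} \<in> E) p"

text \<open>Distances take values in \<^typ>\<open>enat\<close>: vertices in different components are at
  distance \<open>\<infinity>\<close> (the infimum of the empty set).\<close>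

definition gdist :: "'a set \<Rightarrow> 'a set set \<Rightarrow> 'a \<Rightarrow> 'a \<Rightarrow> enat" where
  "gdist V E u v = (INF p \<in> {p. walk_betw V E u p v}. enat (length p - 1))"

definition gdist_set :: "'a set \<Rightarrow> 'a set set \<Rightarrow> 'a \<Rightarrow> 'a set \<Rightarrow> enat" where
  "gdist_set V E v C = (INF c \<in> C. gdist V E v c)"

definition k_radius :: "'a set \<Rightarrow> 'a set set \<Rightarrow> nat \<Rightarrow> enat" where
  "k_radius V E k = (INF C \<in> {C. C \<subseteq> V \<and> card C = k}. SUP v \<in> V. gdist_set V E v C)"

definition k_center_approx ::
    "real \<Rightarrow> real \<Rightarrow> 'a set \<Rightarrow> 'a set set \<Rightarrow> nat \<Rightarrow> 'a set \<Rightarrow> enat \<Rightarrow> bool" where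
  "k_center_approx \<alpha> \<beta> V E k C R \<longleftrightarrow>
     C \<subseteq> V \<and> card C = k \<and> (\<forall>v\<in>V. gdist_set V E v C \<le> R) \<and>
     k_radius V E k \<le> R \<and>
     ereal_of_enat R \<le> ereal \<alpha> * ereal_of_enat (k_radius V E k) + ereal \<beta>"


section \<open>A randomized random access machine\<close>

text \<open>
  Algorithms are programs of a structured random access machine with finitely many registers
  and finitely many unbounded arrays of natural numbers, charged by the logarithmic cost
  criterion: handling a number costs its binary length. On numbers polynomial in the input
  size this agrees with the unit-cost word RAM up to a logarithmic factor, and it rules out
  gaining time by packing data into huge numbers. Randomness is an infinite tape of fair coins,
  read one bit at a time.
\<close>

datatype aexp =
    Lit nat
  | Var string
  | Cell string aexp
  | Add aexp aexp
  | Sub aexp aexp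
  | Mul aexp aexp

datatype bexp =
    Less aexp aexp
  | Equal aexp aexp
  | Neg bexp
  | Conj bexp bexp

datatype com =
    Skip
  | Assign string aexp
  | Store string aexp aexp
  | Flip string
  | Seq com com
  | If bexp com com
  | While bexp com

record state =
  reg :: "string \<Rightarrow> nat"
  arr :: "string \<Rightarrow> nat \<Rightarrow> nat"
  tape :: "bool stream"

definition num_len :: "nat \<Rightarrow> nat" where
  "num_len x = max 1 (floorlog 2 x)"

fun aval :: "aexp \<Rightarrow> state \<Rightarrow> nat" where
  "aval (Lit c) s = c"
| "aval (Var x) s = reg s x"
| "aval (Cell a e) s = arr s a (aval e s)"
| "aval (Add e f) s = aval e s + aval f s"
| "aval (Sub e f) s = aval e s - aval f s"
| "aval (Mul e f) s = aval e s * aval f s"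

fun acost :: "aexp \<Rightarrow> state \<Rightarrow> nat" where
  "acost (Lit c) s = num_len c"
| "acost (Var x) s = num_len (reg s x)"
| "acost (Cell a e) s = acost e s + num_len (arr s a (aval e s))"
| "acost (Add e f) s = acost e s + acost f s + num_len (aval e s + aval f s)"
| "acost (Sub e f) s = acost e s + acost f s + num_len (aval e s - aval f s)"
| "acost (Mul e f) s = acost e s + acost f s + num_len (aval e s) * num_len (aval f s)"

fun bval :: "bexp \<Rightarrow> state \<Rightarrow> bool" where
  "bval (Less e f) s \<longleftrightarrow> aval e s < aval f s"
| "bval (Equal e f) s \<longleftrightarrow> aval e s = aval f s"
| "bval (Neg b) s \<longleftrightarrow> \<not> bval b s"
| "bval (Conj b c) s \<longleftrightarrow> bval b s \<and> bval c s"

fun bcost :: "bexp \<Rightarrow> state \<Rightarrow> nat" where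
  "bcost (Less e f) s = acost e s + acost f s"
| "bcost (Equal e f) s = acost e s + acost f s"
| "bcost (Neg b) s = bcost b s"
| "bcost (Conj b c) s = bcost b s + bcost c s"

text \<open>\<open>exec P s t s'\<close>: started in \<open>s\<close>, program \<open>P\<close> halts in \<open>s'\<close> after time \<open>t\<close>.\<close>

inductive exec :: "com \<Rightarrow> state \<Rightarrow> nat \<Rightarrow> state \<Rightarrow> bool" where
  Skip: "exec Skip s 1 s"
| Assign: "exec (Assign x e) s (1 + acost e s) (s\<lparr>reg := (reg s)(x := aval e s)\<rparr>)"
| Store: "exec (Store a e f) s (1 + acost e s + acost f s)
            (s\<lparr>arr := (arr s)(a := (arr s a)(aval e s := aval f s))\<rparr>)"
| Flip: "exec (Flip x) s 1 (s\<lparr>reg := (reg s)(x := of_bool (shd (tape s))), tape := stl (tape s)\<rparr>)"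
| Seq: "exec P s t s' \<Longrightarrow> exec Q s' t' s'' \<Longrightarrow> exec (Seq P Q) s (t + t') s''"
| IfTrue: "bval b s \<Longrightarrow> exec P s t s' \<Longrightarrow> exec (If b P Q) s (1 + bcost b s + t) s'"
| IfFalse: "\<not> bval b s \<Longrightarrow> exec Q s t s' \<Longrightarrow> exec (If b P Q) s (1 + bcost b s + t) s'"
| WhileFalse: "\<not> bval b s \<Longrightarrow> exec (While b P) s (1 + bcost b s) s"
| WhileTrue: "bval b s \<Longrightarrow> exec P s t s' \<Longrightarrow> exec (While b P) s' t' s'' \<Longrightarrow>
    exec (While b P) s (1 + bcost b s + t + t') s''"

inductive_cases exec_SkipE: "exec Skip s t s'"
inductive_cases exec_AssignE: "exec (Assign x e) s t s'"
inductive_cases exec_StoreE: "exec (Store a e f) s t s'"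
inductive_cases exec_FlipE: "exec (Flip x) s t s'"
inductive_cases exec_SeqE: "exec (Seq P Q) s t s'"
inductive_cases exec_IfE: "exec (If b P Q) s t s'"
inductive_cases exec_WhileE: "exec (While b P) s t s'"

lemma exec_deterministic:
  "exec P s t s' \<Longrightarrow> exec P s u s'' \<Longrightarrow> t = u \<and> s' = s''"
proof (induction arbitrary: u s'' rule: exec.induct)
  case (Seq P s t s' Q t' s2)
  from Seq.prems show ?case by (rule exec_SeqE) (metis Seq.IH)
next
  case (IfTrue b s P t s' Q)
  from IfTrue.prems show ?case by (rule exec_IfE) (use IfTrue.hyps(1) in \<open>auto dest!: IfTrue.IH\<close>)+
next
  case (IfFalse b s Q t s' P)
  from IfFalse.prems show ?case by (rule exec_IfE) (use IfFalse.hyps(1) in \<open>auto dest!: IfFalse.IH\<close>)+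
next
  case (WhileTrue b s P t s' t' s2)
  from WhileTrue.prems show ?case by (rule exec_WhileE) (use WhileTrue.hyps(1) in \<open>auto dest!: WhileTrue.IH\<close>)+
next
  case (WhileFalse b s P)
  from WhileFalse.prems show ?case by (rule exec_WhileE) (use WhileFalse.hyps in auto)
next
  case (Skip s)
  then show ?case by (rule exec_SkipE) simp
next
  case (Assign x e s)
  then show ?case by (rule exec_AssignE) simp
next
  case (Store a e f s)
  then show ?case by (rule exec_StoreE) simp
next
  case (Flip x s)
  then show ?case by (rule exec_FlipE) simp
qed

text \<open>
  A combinatorial program does not use fast matrix multiplication. This is rendered as a
  restriction to the comparison-addition fragment of the machine: no ring multiplication, and no
  subtraction, hence none of the cancellation that fast matrix multiplication is built on.
\<close>

fun combinatorial_aexp :: "aexp \<Rightarrow> bool" where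
  "combinatorial_aexp (Lit c) \<longleftrightarrow> True"
| "combinatorial_aexp (Var x) \<longleftrightarrow> True"
| "combinatorial_aexp (Cell a e) \<longleftrightarrow> combinatorial_aexp e"
| "combinatorial_aexp (Add e f) \<longleftrightarrow> combinatorial_aexp e \<and> combinatorial_aexp f"
| "combinatorial_aexp (Sub e f) \<longleftrightarrow> False"
| "combinatorial_aexp (Mul e f) \<longleftrightarrow> False"

fun combinatorial_bexp :: "bexp \<Rightarrow> bool" where
  "combinatorial_bexp (Less e f) \<longleftrightarrow> combinatorial_aexp e \<and> combinatorial_aexp f"
| "combinatorial_bexp (Equal e f) \<longleftrightarrow> combinatorial_aexp e \<and> combinatorial_aexp f"
| "combinatorial_bexp (Neg b) \<longleftrightarrow> combinatorial_bexp b"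
| "combinatorial_bexp (Conj b c) \<longleftrightarrow> combinatorial_bexp b \<and> combinatorial_bexp c"

fun combinatorial :: "com \<Rightarrow> bool" where
  "combinatorial Skip \<longleftrightarrow> True"
| "combinatorial (Assign x e) \<longleftrightarrow> combinatorial_aexp e"
| "combinatorial (Store a e f) \<longleftrightarrow> combinatorial_aexp e \<and> combinatorial_aexp f"
| "combinatorial (Flip x) \<longleftrightarrow> True"
| "combinatorial (Seq P Q) \<longleftrightarrow> combinatorial P \<and> combinatorial Q"
| "combinatorial (If b P Q) \<longleftrightarrow> combinatorial_bexp b \<and> combinatorial P \<and> combinatorial Q"
| "combinatorial (While b P) \<longleftrightarrow> combinatorial_bexp b \<and> combinatorial P"


section \<open>Graph algorithms on the machine\<close>

definition coin_tape :: "bool stream measure" where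
  "coin_tape = stream_space (measure_pmf (bernoulli_pmf (1/2)))"

text \<open>A graph on the vertices \<open>0, \<dots>, n - 1\<close> is presented as a list of its edges, each occurring
  once, in arbitrary order and with arbitrarily ordered endpoints.\<close>

definition edge_list_of :: "(nat \<times> nat) list \<Rightarrow> nat set set \<Rightarrow> bool" where
  "edge_list_of es E \<longleftrightarrow>
     distinct (map (\<lambda>(u, v). {u, v}) es) \<and> set (map (\<lambda>(u, v). {u, v}) es) = E"

text \<open>The last two conjuncts are the standing assumption \<open>m \<ge> n - 1\<close> and the condition that a
  \<open>k\<close>-element set of centers exists. The graph need not be connected.\<close>

definition k_center_instance :: "nat \<Rightarrow> nat \<Rightarrow> nat set set \<Rightarrow> (nat \<times> nat) list \<Rightarrow> bool" where
  "k_center_instance k n E es \<longleftrightarrow>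
     simple_graph {..<n} E \<and> edge_list_of es E \<and> n \<le> card E + 1 \<and> k \<le> n"

definition init_state :: "nat \<Rightarrow> (nat \<times> nat) list \<Rightarrow> bool stream \<Rightarrow> state" where
  "init_state n es \<omega> =
     \<lparr>reg = (\<lambda>_. 0)(''n'' := n, ''m'' := length es),
      arr = (\<lambda>_ _. 0)(''src'' := (\<lambda>i. if i < length es then fst (es ! i) else 0),
                      ''dst'' := (\<lambda>i. if i < length es then snd (es ! i) else 0)),
      tape = \<omega>\<rparr>"

definition output_centers :: "nat \<Rightarrow> state \<Rightarrow> nat set" where
  "output_centers k s = arr s ''C'' ` {..<k}"

text \<open>A nonzero register \<open>inf\<close> signals the value \<open>\<infinity>\<close>, which can only be correct if the
  \<open>k\<close>-radius is infinite.\<close>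

definition output_radius :: "state \<Rightarrow> enat" where
  "output_radius s = (if reg s ''inf'' = 0 then enat (reg s ''R'') else \<infinity>)"

text \<open>Worst-case running time soft-O of \<open>f n m\<close>: the bound holds for every instance and every
  outcome of the coins.\<close>

definition runs_in_soft_O :: "com \<Rightarrow> nat \<Rightarrow> (nat \<Rightarrow> nat \<Rightarrow> real) \<Rightarrow> bool" where
  "runs_in_soft_O P k f \<longleftrightarrow>
     (\<exists>(K::real) (d::nat). \<forall>n E es. k_center_instance k n E es \<longrightarrow>
        (\<forall>\<omega>. \<exists>t s'. exec P (init_state n es \<omega>) t s' \<and>
               real t \<le> K * f n (card E) * (1 + log 2 (real n)) ^ d))"

definition approximates_k_center_whp :: "com \<Rightarrow> nat \<Rightarrow> real \<Rightarrow> real \<Rightarrow> bool" where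
  "approximates_k_center_whp P k \<alpha> \<beta> \<longleftrightarrow>
     (\<exists>c::real. c > 0 \<and> (\<forall>n E es. k_center_instance k n E es \<longrightarrow>
        \<P>(\<omega> in coin_tape. \<exists>t s'. exec P (init_state n es \<omega>) t s' \<and>
             k_center_approx \<alpha> \<beta> {..<n} E k (output_centers k s') (output_radius s'))
        \<ge> 1 - 1 / real n powr c))"

end

theory Submission imports Defs begin

text \<open>
  The algorithm is deterministic. Suppose \<open>k\<close> centers cover all vertices within radius \<open>R\<close>, and let
  \<open>b = R div (2 * l)\<close> and \<open>g r = (2 * r - 1) * b\<close>; the aim is to cover within \<open>2 * R - b\<close>. Centers are
  guessed one after the other. While \<open>r\<close> guesses remain, let \<open>S\<close> be a set hitting every ball of radius
  \<open>g r\<close> that has many vertices. If some vertex \<open>w\<close>, which the centers guessed so far certainly leave to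
  another center, is farther than \<open>g r\<close> from \<open>S\<close>, then its ball of radius \<open>g r\<close> is small and
  contains a vertex within \<open>R - g r\<close> of the center that covers \<open>w\<close>: branch over this ball. Otherwise
  every missing center that is still needed is within \<open>R - b\<close> of \<open>S\<close>, because the thresholds \<open>g\<close>
  shrink by \<open>2 * b\<close> per guess: try all tuples from \<open>S\<close>. The sizes of the hitting sets are chosen such
  that both alternatives cost the same, which gives the exponent of the theorem. The hitting sets are
  computed greedily, so no randomness is needed. Bisection finds an \<open>R\<close> for which the search succeeds
  although it fails for \<open>R - 1\<close>, whence \<open>R\<close> is at most the \<open>k\<close>-radius; this does not require
  the search to be monotone in \<open>R\<close>.
\<close>

section \<open>Running-time triples\<close>

text \<open>Two inequalities fix the thresholds. Suppose \<open>r\<close> guesses remain and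
  \<open>u\<close> is farther than \<open>2 * R - b\<close> from all guesses made; walk
  \<open>y\<close> steps from \<open>u\<close> towards its center. The vertex reached is still left
  over by the guesses if \<open>y + b \<le> g (r + 1)\<close>, and its sample vertex is within
  \<open>R - b\<close> of the center if \<open>g r + b \<le> y\<close>. So \<open>g\<close> must
  grow by \<open>2 * b\<close> per level, from \<open>g 1 = b\<close>. Before the first guess
  \<open>y = 2 * l * b\<close> has to fit into a walk of length \<open>R\<close>; hence
  \<open>b = R div (2 * l)\<close>, and \<open>2 * R - b\<close> saves about
  \<open>1 / (2 * l)\<close> on the factor 2. The machine shapes the rest. Only addition and
  comparison are allowed, so halves, row offsets, quotients and fractional powers of
  \<open>n\<close> come from tables and counters, and tests are rearranged to avoid subtraction. As
  \<open>k\<close> is fixed, the recursion is unfolded into nested loops. All numbers stay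
  polynomial in \<open>n\<close>, so counting commands and multiplying by one logarithmic factor
  gives the time.\<close>

fun asize :: "aexp \<Rightarrow> nat" where
  "asize (Lit c) = 1"
| "asize (Var x) = 1"
| "asize (Cell a e) = asize e + 1"
| "asize (Add e f) = asize e + asize f + 1"
| "asize (Sub e f) = asize e + asize f + 1"
| "asize (Mul e f) = asize e + asize f + 1"

fun alit :: "aexp \<Rightarrow> nat" where
  "alit (Lit c) = c"
| "alit (Var x) = 0"
| "alit (Cell a e) = alit e"
| "alit (Add e f) = alit e + alit f"
| "alit (Sub e f) = alit e + alit f"
| "alit (Mul e f) = alit e + alit f"

fun bsize :: "bexp \<Rightarrow> nat" where
  "bsize (Less e f) = asize e + asize f"
| "bsize (Equal e f) = asize e + asize f"
| "bsize (Neg b) = bsize b"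
| "bsize (Conj b c) = bsize b + bsize c"

fun blit :: "bexp \<Rightarrow> nat" where
  "blit (Less e f) = alit e + alit f"
| "blit (Equal e f) = alit e + alit f"
| "blit (Neg b) = blit b"
| "blit (Conj b c) = blit b + blit c"

fun csize :: "com \<Rightarrow> nat" where
  "csize Skip = 0"
| "csize (Assign x e) = asize e"
| "csize (Store a e f) = asize e + asize f"
| "csize (Flip x) = 0"
| "csize (Seq P Q) = csize P + csize Q"
| "csize (If b P Q) = bsize b + csize P + csize Q"
| "csize (While b P) = bsize b + csize P"

fun clit :: "com \<Rightarrow> nat" where
  "clit Skip = 0"
| "clit (Assign x e) = alit e"
| "clit (Store a e f) = alit e + alit f"
| "clit (Flip x) = 0"
| "clit (Seq P Q) = clit P + clit Q"
| "clit (If b P Q) = blit b + clit P + clit Q"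
| "clit (While b P) = blit b + clit P"

fun mod_regs :: "com \<Rightarrow> string set" where
  "mod_regs Skip = {}"
| "mod_regs (Assign x e) = {x}"
| "mod_regs (Store a e f) = {}"
| "mod_regs (Flip x) = {x}"
| "mod_regs (Seq P Q) = mod_regs P \<union> mod_regs Q"
| "mod_regs (If b P Q) = mod_regs P \<union> mod_regs Q"
| "mod_regs (While b P) = mod_regs P"

fun mod_arrs :: "com \<Rightarrow> string set" where
  "mod_arrs Skip = {}"
| "mod_arrs (Assign x e) = {}"
| "mod_arrs (Store a e f) = {a}"
| "mod_arrs (Flip x) = {}"
| "mod_arrs (Seq P Q) = mod_arrs P \<union> mod_arrs Q"
| "mod_arrs (If b P Q) = mod_arrs P \<union> mod_arrs Q"
| "mod_arrs (While b P) = mod_arrs P"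

section \<open>Frames: the variables that a program may change\<close>

definition agree_off :: "string set \<Rightarrow> string set \<Rightarrow> state \<Rightarrow> state \<Rightarrow> bool" where
  "agree_off X A s s' \<longleftrightarrow> (\<forall>x. x \<notin> X \<longrightarrow> reg s' x = reg s x) \<and> (\<forall>a. a \<notin> A \<longrightarrow> arr s' a = arr s a)"

abbreviation framed :: "com \<Rightarrow> state \<Rightarrow> state \<Rightarrow> bool" where
  "framed P \<equiv> agree_off (mod_regs P) (mod_arrs P)"

lemma agree_off_reg: "agree_off X A s s' \<Longrightarrow> x \<notin> X \<Longrightarrow> reg s' x = reg s x"
  and agree_off_arr: "agree_off X A s s' \<Longrightarrow> a \<notin> A \<Longrightarrow> arr s' a = arr s a"
  by (auto simp: agree_off_def)

lemma agree_off_refl [simp]: "agree_off X A s s"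
  by (simp add: agree_off_def)

lemma agree_off_trans:
  "agree_off X A s s' \<Longrightarrow> agree_off X' A' s' s'' \<Longrightarrow> X \<subseteq> Y \<Longrightarrow> X' \<subseteq> Y \<Longrightarrow> A \<subseteq> C \<Longrightarrow> A' \<subseteq> C \<Longrightarrow>
    agree_off Y C s s''"
  by (fastforce simp: agree_off_def)

lemma agree_off_mono: "agree_off X A s s' \<Longrightarrow> X \<subseteq> Y \<Longrightarrow> A \<subseteq> C \<Longrightarrow> agree_off Y C s s'"
  by (auto simp: agree_off_def)

lemma agree_off_upd_reg: "agree_off X A s s' \<Longrightarrow> x \<in> X \<Longrightarrow> agree_off X A s (s'\<lparr>reg := (reg s')(x := v)\<rparr>)"
  by (auto simp: agree_off_def)

lemma exec_framed: "exec P s t s' \<Longrightarrow> framed P s s'"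
proof (induction rule: exec.induct)
  case (Seq P s t s' Q t' s'')
  then show ?case by (auto intro: agree_off_trans)
next
  case (WhileTrue b s P t s' t' s'')
  then show ?case by (auto intro: agree_off_trans)
qed (auto simp: agree_off_def)

lemma num_len_mono: "x \<le> y \<Longrightarrow> num_len x \<le> num_len y"
  by (auto simp: num_len_def intro: floorlog_mono le_max_iff_disj[THEN iffD2])

lemma num_len_le_log:
  assumes "x \<ge> 1"
  shows "real (num_len x) \<le> 1 + log 2 (real x)"
proof -
  have "log 2 (real x) \<ge> 0" using assms by simp
  moreover have "nat \<lfloor>log 2 (real x)\<rfloor> + 1 = floorlog 2 x"
    using assms by (simp add: floorlog_def)
  ultimately show ?thesis using assms
    by (simp add: num_len_def floorlog_def max_def)
qed

text \<open>\<open>B\<close> bounds every number in a state and \<open>Z\<close> the total size of all expressions of a program,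
  so that a single command costs at most one \<open>tick\<close>.\<close>

locale machine =
  fixes B Z :: nat
  assumes B_pos: "1 \<le> B"
begin

definition tick :: nat where
  "tick = 1 + Z * num_len (Z * B)"

definition bounded :: "state \<Rightarrow> bool" where
  "bounded s \<longleftrightarrow> (\<forall>x. reg s x \<le> B) \<and> (\<forall>a i. arr s a i \<le> B)"

definition admissible :: "com \<Rightarrow> bool" where
  "admissible P \<longleftrightarrow> combinatorial P \<and> csize P \<le> Z \<and> clit P \<le> B"

lemma boundedD: "bounded s \<Longrightarrow> reg s x \<le> B" "bounded s \<Longrightarrow> arr s a i \<le> B"
  by (auto simp: bounded_def)

text \<open>Without \<open>Mul\<close> a value is at most the sum of the leaf and cell values, each
  bounded by \<open>B\<close>. This makes it possible to charge every operation the uniform price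
  \<open>num_len (Z * B)\<close>.\<close>

lemma aval_le_size:
  "bounded s \<Longrightarrow> combinatorial_aexp e \<Longrightarrow> alit e \<le> B \<Longrightarrow> aval e s \<le> asize e * B"
proof (induction e)
  case (Cell a e)
  have "arr s a (aval e s) \<le> B" using Cell by (simp add: bounded_def)
  then show ?case by (simp add: trans_le_add1)
next
  case (Add e f)
  then have "aval e s + aval f s \<le> asize e * B + asize f * B" by (intro add_mono) auto
  then show ?case by (simp add: algebra_simps)
qed (auto simp: bounded_def)

lemma acost_le:
  assumes "bounded s" "combinatorial_aexp e" "alit e \<le> B" "asize e \<le> Z"
  shows "acost e s \<le> asize e * num_len (Z * B)"
  using assms
proof (induction e)
  case (Lit c)
  have "c \<le> Z * B" using Lit by (metis alit.simps(1) asize.simps(1) le_trans mult_1 mult_le_mono1)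
  then show ?case by (simp add: num_len_mono)
next
  case (Var x)
  have "reg s x \<le> Z * B"
    using aval_le_size[OF Var(1,2,3)] Var(4) by (metis aval.simps(2) le_trans mult_le_mono1)
  then show ?case by (simp add: num_len_mono)
next
  case (Cell a e)
  have "arr s a (aval e s) \<le> B" "B \<le> Z * B"
    using Cell by (auto simp: bounded_def)
  then have "num_len (arr s a (aval e s)) \<le> num_len (Z * B)"
    by (meson le_trans num_len_mono)
  with Cell show ?case by simp
next
  case (Add e f)
  have "aval (Add e f) s \<le> Z * B"
    using aval_le_size[OF Add.prems(1-3)] Add.prems(4) by (meson le_trans mult_le_mono1)
  then have "num_len (aval e s + aval f s) \<le> num_len (Z * B)"
    by (simp add: num_len_mono)
  moreover have "acost e s \<le> asize e * num_len (Z * B)" "acost f s \<le> asize f * num_len (Z * B)"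
    using Add by auto
  ultimately show ?case by (simp add: algebra_simps)
qed auto

lemma bcost_le:
  assumes "bounded s" "combinatorial_bexp b" "blit b \<le> B" "bsize b \<le> Z"
  shows "bcost b s \<le> bsize b * num_len (Z * B)"
  using assms
proof (induction b)
  case (Less e f)
  then have "acost e s \<le> asize e * num_len (Z * B)" "acost f s \<le> asize f * num_len (Z * B)"
    by (auto intro!: acost_le)
  then show ?case by (simp add: algebra_simps)
next
  case (Equal e f)
  then have "acost e s \<le> asize e * num_len (Z * B)" "acost f s \<le> asize f * num_len (Z * B)"
    by (auto intro!: acost_le)
  then show ?case by (simp add: algebra_simps)
next
  case (Conj b c)
  then have "bcost b s \<le> bsize b * num_len (Z * B)" "bcost c s \<le> bsize c * num_len (Z * B)"
    by auto
  then show ?case by (simp add: algebra_simps)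
qed auto

lemma bcost_tick:
  assumes "bounded s" "combinatorial_bexp b" "blit b \<le> B" "bsize b \<le> Z"
  shows "1 + bcost b s \<le> tick"
  using bcost_le[OF assms] assms(4) unfolding tick_def
  by (meson add_le_cancel_left le_trans mult_le_mono1)

lemma tick_pos: "1 \<le> tick"
  by (simp add: tick_def)

text \<open>Total correctness from one given start state, with time in units of \<open>tick\<close>.
  The premises \<open>admissible\<close> and \<open>bounded\<close> are part of the definition, so
  no rule has to discharge them: a proof only shows that newly written values are at most
  \<open>B\<close>. The frame comes with every triple.\<close>

definition triple :: "com \<Rightarrow> state \<Rightarrow> nat \<Rightarrow> (state \<Rightarrow> bool) \<Rightarrow> bool" where
  "triple P s T Q \<longleftrightarrow> (admissible P \<longrightarrow> bounded s \<longrightarrow>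
     (\<exists>t s'. exec P s t s' \<and> t \<le> T * tick \<and> bounded s' \<and> framed P s s' \<and> Q s'))"

lemma triple_conseq:
  assumes "triple P s T Q" "T \<le> T'"
    "\<And>s'. framed P s s' \<Longrightarrow> bounded s' \<Longrightarrow> Q s' \<Longrightarrow> Q' s'"
  shows "triple P s T' Q'"
  using assms unfolding triple_def by (meson le_trans mult_le_mono1)

lemma triple_bounded: "(bounded s \<Longrightarrow> triple P s T Q) \<Longrightarrow> triple P s T Q"
  by (auto simp: triple_def)

lemma triple_Skip: "Q s \<Longrightarrow> 1 \<le> T \<Longrightarrow> triple Skip s T Q"
  unfolding triple_def using exec.Skip tick_pos
  by (metis agree_off_refl le_trans mult_le_mono nat_mult_1)

lemma triple_Assign:
  assumes "aval e s \<le> B" "Q (s\<lparr>reg := (reg s)(x := aval e s)\<rparr>)" "1 \<le> T"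
  shows "triple (Assign x e) s T Q"
  unfolding triple_def
proof (intro impI exI conjI)
  assume a: "admissible (Assign x e)" and b: "bounded s"
  show e: "exec (Assign x e) s (1 + acost e s) (s\<lparr>reg := (reg s)(x := aval e s)\<rparr>)"
    by (rule exec.Assign)
  have "acost e s \<le> asize e * num_len (Z * B)"
    using a b by (auto simp: admissible_def intro!: acost_le)
  also have "\<dots> \<le> Z * num_len (Z * B)" using a by (simp add: admissible_def)
  finally have "1 + acost e s \<le> tick" by (simp add: tick_def)
  then show "1 + acost e s \<le> T * tick"
    using assms(3) by (metis le_trans mult_le_mono1 nat_mult_1)
  show "framed (Assign x e) s (s\<lparr>reg := (reg s)(x := aval e s)\<rparr>)"
    by (rule exec_framed[OF e])
qed (use assms in \<open>auto simp: bounded_def\<close>)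

lemma triple_Store:
  assumes "aval f s \<le> B" "Q (s\<lparr>arr := (arr s)(a := (arr s a)(aval e s := aval f s))\<rparr>)" "1 \<le> T"
  shows "triple (Store a e f) s T Q"
  unfolding triple_def
proof (intro impI exI conjI)
  assume a: "admissible (Store a e f)" and b: "bounded s"
  show e: "exec (Store a e f) s (1 + acost e s + acost f s)
      (s\<lparr>arr := (arr s)(a := (arr s a)(aval e s := aval f s))\<rparr>)"
    by (rule exec.Store)
  have "acost e s \<le> asize e * num_len (Z * B)" "acost f s \<le> asize f * num_len (Z * B)"
    using a b by (auto simp: admissible_def intro!: acost_le)
  then have "acost e s + acost f s \<le> (asize e + asize f) * num_len (Z * B)"
    by (simp add: algebra_simps)
  also have "\<dots> \<le> Z * num_len (Z * B)" using a by (simp add: admissible_def)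
  finally have "1 + acost e s + acost f s \<le> tick" by (simp add: tick_def)
  then show "1 + acost e s + acost f s \<le> T * tick"
    using assms(3) by (metis le_trans mult_le_mono1 nat_mult_1)
  show "framed (Store a e f) s (s\<lparr>arr := (arr s)(a := (arr s a)(aval e s := aval f s))\<rparr>)"
    by (rule exec_framed[OF e])
qed (use assms in \<open>auto simp: bounded_def\<close>)

lemma triple_Seq:
  assumes "triple P s T1 (\<lambda>s'. triple P' s' T2 Q)" "T1 + T2 \<le> T"
  shows "triple (Seq P P') s T Q"
  unfolding triple_def
proof (intro impI)
  assume a: "admissible (Seq P P')" and b: "bounded s"
  have ok: "admissible P" "admissible P'" using a by (auto simp: admissible_def)
  from assms(1) ok b obtain t s' where 1: "exec P s t s'" "t \<le> T1 * tick" "bounded s'"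
    "framed P s s'" "triple P' s' T2 Q" by (auto simp: triple_def)
  from 1(5) ok 1(3) obtain t' s'' where 2: "exec P' s' t' s''" "t' \<le> T2 * tick" "bounded s''"
    "Q s''" by (auto simp: triple_def)
  have e: "exec (Seq P P') s (t + t') s''" by (rule exec.Seq[OF 1(1) 2(1)])
  have "t + t' \<le> (T1 + T2) * tick" using 1 2 by (simp add: algebra_simps)
  also have "\<dots> \<le> T * tick" using assms(2) by simp
  finally show "\<exists>t s'. exec (Seq P P') s t s' \<and> t \<le> T * tick \<and> bounded s' \<and>
      framed (Seq P P') s s' \<and> Q s'"
    using e exec_framed[OF e] 2 by blast
qed

lemma triple_If:
  assumes "bval b s \<Longrightarrow> triple P s T Q" "\<not> bval b s \<Longrightarrow> triple P' s T Q" "T + 1 \<le> T'"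
  shows "triple (If b P P') s T' Q"
  unfolding triple_def
proof (intro impI)
  assume a: "admissible (If b P P')" and bd: "bounded s"
  have ok: "admissible P" "admissible P'" using a by (auto simp: admissible_def)
  have c: "1 + bcost b s \<le> tick"
    using a bd by (intro bcost_tick) (auto simp: admissible_def)
  obtain t s' where 1: "exec (If b P P') s (1 + bcost b s + t) s'" "t \<le> T * tick" "bounded s'" "Q s'"
  proof (cases "bval b s")
    case True
    then show ?thesis using assms(1) ok bd that exec.IfTrue[OF True] unfolding triple_def by meson
  next
    case False
    then show ?thesis using assms(2) ok bd that exec.IfFalse[OF False] unfolding triple_def by meson
  qed
  have "1 + bcost b s + t \<le> (T + 1) * tick" using c 1 by (simp add: algebra_simps)
  also have "\<dots> \<le> T' * tick" using assms(3) by (intro mult_le_mono1)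
  finally show "\<exists>t s'. exec (If b P P') s t s' \<and> t \<le> T' * tick \<and> bounded s' \<and>
      framed (If b P P') s s' \<and> Q s'"
    using 1 exec_framed[OF 1(1)] by blast
qed

text \<open>The potential method: the potential pays for the body, whose cost \<open>T\<close> may
  depend on the state, and for one test, so it also proves termination. Work charged to vertices and
  arcs of the graph is bounded in this way without counting rounds.\<close>

lemma triple_While:
  assumes "I s"
    and step: "\<And>s'. I s' \<Longrightarrow> bval b s' \<Longrightarrow> framed P s s' \<Longrightarrow> bounded s' \<Longrightarrow>
      \<exists>T. triple P s' T (\<lambda>s''. I s'' \<and> T + 1 + \<Phi> s'' \<le> \<Phi> s')"
    and fin: "\<And>s'. I s' \<Longrightarrow> \<not> bval b s' \<Longrightarrow> framed P s s' \<Longrightarrow> bounded s' \<Longrightarrow> Q s'"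
    and "\<Phi> s + 1 \<le> T'"
  shows "triple (While b P) s T' Q"
proof -
  have main: "\<exists>t s''. exec (While b P) s' t s'' \<and> t \<le> (\<Phi> s' + 1) * tick \<and> bounded s'' \<and> Q s''"
    if "I s'" "admissible (While b P)" "bounded s'" "framed P s s'" for s'
    using that
  proof (induction "\<Phi> s'" arbitrary: s' rule: less_induct)
    case less
    have ok: "admissible P" using less.prems(2) by (auto simp: admissible_def)
    have c: "1 + bcost b s' \<le> tick"
      using less.prems by (intro bcost_tick) (auto simp: admissible_def)
    show ?case
    proof (cases "bval b s'")
      case False
      have "1 + bcost b s' \<le> (\<Phi> s' + 1) * tick" using c by (simp add: trans_le_add1)
      then show ?thesis
        using exec.WhileFalse[OF False, of P] fin[OF less.prems(1) False less.prems(4,3)] less.prems(3)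
        by blast
    next
      case True
      from step[OF less.prems(1) True less.prems(4,3)] ok less.prems(3)
      obtain T t s1 where 1: "exec P s' t s1" "t \<le> T * tick" "bounded s1" "framed P s' s1" "I s1"
        "T + 1 + \<Phi> s1 \<le> \<Phi> s'" by (auto simp: triple_def)
      have "framed P s s1" using less.prems(4) 1(4) by (rule agree_off_trans) auto
      from less.hyps[OF _ 1(5) less.prems(2) 1(3) this] 1(6)
      obtain t' s2 where 2: "exec (While b P) s1 t' s2" "t' \<le> (\<Phi> s1 + 1) * tick" "bounded s2" "Q s2"
        by auto
      have "1 + bcost b s' + t + t' \<le> tick + T * tick + (\<Phi> s1 + 1) * tick"
        using c 1(2) 2(2) by linarith
      also have "\<dots> = (T + 1 + \<Phi> s1 + 1) * tick" by (simp add: algebra_simps)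
      also have "\<dots> \<le> (\<Phi> s' + 1) * tick" using 1(6) by (intro mult_le_mono1) simp
      finally show ?thesis using exec.WhileTrue[OF True 1(1) 2(1)] 2(3,4) by blast
    qed
  qed
  show ?thesis unfolding triple_def
  proof (intro impI)
    assume a: "admissible (While b P)" and bd: "bounded s"
    from main[OF assms(1) a bd] obtain t s' where
      1: "exec (While b P) s t s'" "t \<le> (\<Phi> s + 1) * tick" "bounded s'" "Q s'" by auto
    have "(\<Phi> s + 1) * tick \<le> T' * tick" using assms(4) by (intro mult_le_mono1)
    with 1 exec_framed[OF 1(1)] show "\<exists>t s'. exec (While b P) s t s' \<and> t \<le> T' * tick \<and> bounded s' \<and>
      framed (While b P) s s' \<and> Q s'" by (meson le_trans)
  qed
qed

end

section \<open>Counted loops and sequencing\<close>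

abbreviation set_reg :: "string \<Rightarrow> nat \<Rightarrow> state \<Rightarrow> state" where
  "set_reg x v s \<equiv> s\<lparr>reg := (reg s)(x := v)\<rparr>"

definition For :: "string \<Rightarrow> string \<Rightarrow> com \<Rightarrow> com" where
  "For x y P = Seq (Assign x (Lit 0))
     (While (Less (Var x) (Var y)) (Seq P (Assign x (Add (Var x) (Lit 1)))))"

lemma mod_For [simp]:
  "mod_regs (For x y P) = insert x (mod_regs P)" "mod_arrs (For x y P) = mod_arrs P"
  by (auto simp: For_def)

context machine begin

text \<open>The invariant at \<open>i\<close> speaks of the state whose counter already holds
  \<open>i\<close>, which is why the step ends in \<open>set_reg x (Suc i)\<close>. Beyond its body
  each round costs a test and an increment; the initial assignment and the last test make up the
  other 2.\<close>

lemma triple_For: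
  assumes N: "reg s y = N" "y \<noteq> x" "x \<notin> mod_regs P" "y \<notin> mod_regs P"
    and init: "I 0 (set_reg x 0 s)"
    and step: "\<And>i s'. i < N \<Longrightarrow> reg s' x = i \<Longrightarrow> framed (For x y P) s s' \<Longrightarrow> bounded s' \<Longrightarrow> I i s' \<Longrightarrow>
      triple P s' (T i) (\<lambda>s''. I (Suc i) (set_reg x (Suc i) s''))"
    and fin: "\<And>s'. framed (For x y P) s s' \<Longrightarrow> bounded s' \<Longrightarrow> I N s' \<Longrightarrow> Q s'"
    and T': "2 + 2 * N + (\<Sum>i<N. T i) \<le> T'"
  shows "triple (For x y P) s T' Q"
proof (rule triple_bounded)
  assume bd: "bounded s"
  have NB: "N \<le> B" using boundedD(1)[OF bd, of y] N(1) by simp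
  define J :: "state \<Rightarrow> bool" where "J = (\<lambda>s'. reg s' x \<le> N \<and> I (reg s' x) s' \<and> framed (For x y P) s s')"
  define \<Phi> :: "state \<Rightarrow> nat" where "\<Phi> = (\<lambda>s'. 2 * (N - reg s' x) + (\<Sum>i\<in>{reg s' x..<N}. T i))"
  let ?s = "set_reg x 0 s"
  let ?P = "Seq P (Assign x (Add (Var x) (Lit 1)))"
  have y: "reg s' y = N" if "framed (For x y P) s s'" for s'
    using that N by (simp add: agree_off_reg)
  have "triple (While (Less (Var x) (Var y)) ?P) ?s (2 * N + (\<Sum>i<N. T i) + 1) Q"
  proof (rule triple_While[where I = J and \<Phi> = \<Phi>])
    show "J ?s" using init by (auto simp: J_def agree_off_def)
    show "\<Phi> ?s + 1 \<le> 2 * N + (\<Sum>i<N. T i) + 1" by (simp add: \<Phi>_def lessThan_atLeast0)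
  next
    fix s' assume J: "J s'" and b: "bval (Less (Var x) (Var y)) s'" and bd': "bounded s'"
    define i where "i = reg s' x"
    have fr: "framed (For x y P) s s'" and I: "I i s'" using J by (auto simp: J_def i_def)
    have i: "i < N" using b y[OF fr] by (simp add: i_def)
    have "triple ?P s' (T i + 1) (\<lambda>s''. J s'' \<and> T i + 1 + 1 + \<Phi> s'' \<le> \<Phi> s')"
    proof (rule triple_Seq)
      show "triple P s' (T i) (\<lambda>s''. triple (Assign x (Add (Var x) (Lit 1))) s'' 1
          (\<lambda>s''. J s'' \<and> T i + 1 + 1 + \<Phi> s'' \<le> \<Phi> s'))"
      proof (rule triple_conseq[OF step[OF i _ fr bd' I]])
        fix s'' assume f: "framed P s' s''" and I': "I (Suc i) (set_reg x (Suc i) s'')"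
        have x: "reg s'' x = i" using f N(3) by (simp add: agree_off_reg i_def)
        have fr2: "framed (For x y P) s s''" using fr f by (rule agree_off_trans) auto
        have "{i..<N} = insert i {Suc i..<N}" using i by auto
        then have *: "(\<Sum>i\<in>{i..<N}. T i) = T i + (\<Sum>i\<in>{Suc i..<N}. T i)" by simp
        show "triple (Assign x (Add (Var x) (Lit 1))) s'' 1
          (\<lambda>s''. J s'' \<and> T i + 1 + 1 + \<Phi> s'' \<le> \<Phi> s')"
          using x i NB I' fr2 *
          by (intro triple_Assign) (auto simp: J_def \<Phi>_def i_def[symmetric] intro: agree_off_upd_reg)
      qed (auto simp: i_def)
    qed auto
    then show "\<exists>T. triple ?P s' T (\<lambda>s''. J s'' \<and> T + 1 + \<Phi> s'' \<le> \<Phi> s')" by blast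
  next
    fix s' assume J: "J s'" and b: "\<not> bval (Less (Var x) (Var y)) s'" and bd': "bounded s'"
    have fr: "framed (For x y P) s s'" and I: "I (reg s' x) s'" "reg s' x \<le> N" using J by (auto simp: J_def)
    have "reg s' x = N" using b y[OF fr] I by simp
    then show "Q s'" using fin[OF fr bd'] I by simp
  qed
  then show "triple (For x y P) s T' Q" unfolding For_def using T'
    by (intro triple_Seq[where ?T1.0 = 1] triple_Assign) auto
qed

lemma triple_Assign_Seq:
  assumes "1 \<le> T" "aval e s \<le> B" "triple P (set_reg x (aval e s) s) (T - 1) Q"
  shows "triple (Seq (Assign x e) P) s T Q"
  by (rule triple_Seq[where ?T1.0 = 1 and ?T2.0 = "T - 1"]) (use assms in \<open>auto intro: triple_Assign\<close>)

lemma triple_Store_Seq: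
  assumes "1 \<le> T" "aval f s \<le> B"
    "triple P (s\<lparr>arr := (arr s)(a := (arr s a)(aval e s := aval f s))\<rparr>) (T - 1) Q"
  shows "triple (Seq (Store a e f) P) s T Q"
  by (rule triple_Seq[where ?T1.0 = 1 and ?T2.0 = "T - 1"]) (use assms in \<open>auto intro: triple_Store\<close>)

text \<open>The postcondition of the first program may be weaker than what the second one needs, since
  everything it does not modify is carried over by the frame.\<close>

lemma triple_Seq_framed:
  assumes "triple P s T1 R" "\<And>s'. framed P s s' \<Longrightarrow> bounded s' \<Longrightarrow> R s' \<Longrightarrow> triple P' s' T2 Q" "T1 + T2 \<le> T"
  shows "triple (Seq P P') s T Q"
  by (rule triple_Seq[where ?T1.0 = T1 and ?T2.0 = T2])
     (use assms in \<open>auto intro: triple_conseq\<close>)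

end

section \<open>Distances\<close>

text \<open>\<open>enat\<close> is well-ordered, so infima are attained. Hence a bound on a distance
  yields a walk, and a bound on the k-radius yields a set of centers.\<close>

lemma Inf_enat_mem: "A \<noteq> {} \<Longrightarrow> Inf A \<in> A" for A :: "enat set"
  unfolding Inf_enat_def by (metis LeastI ex_in_conv)

locale graph =
  fixes n :: nat and E :: "nat set set"
  assumes graph: "simple_graph {..<n} E"
begin

text \<open>The distance arguments use this relation with finite bounds only, so that \<infinity>
  does not enter them.\<close>

definition near :: "nat \<Rightarrow> nat \<Rightarrow> nat \<Rightarrow> bool" where
  "near x u v \<longleftrightarrow> gdist {..<n} E u v \<le> enat x"

lemma near_iff_walk: "near x u v \<longleftrightarrow> (\<exists>p. walk_betw {..<n} E u p v \<and> length p \<le> Suc x)"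
proof
  assume near: "near x u v"
  let ?A = "(\<lambda>p. enat (length p - 1)) ` {p. walk_betw {..<n} E u p v}"
  have "?A \<noteq> {}"
  proof
    assume "?A = {}"
    then have "gdist {..<n} E u v = \<infinity>" unfolding gdist_def by (simp add: Inf_enat_def)
    then show False using near by (simp add: near_def)
  qed
  then have "Inf ?A \<in> ?A" by (rule Inf_enat_mem)
  then show "\<exists>p. walk_betw {..<n} E u p v \<and> length p \<le> Suc x"
    using near by (auto simp: near_def gdist_def)
next
  assume "\<exists>p. walk_betw {..<n} E u p v \<and> length p \<le> Suc x"
  then obtain p where p: "walk_betw {..<n} E u p v" "length p \<le> Suc x" by auto
  have "gdist {..<n} E u v \<le> enat (length p - 1)"
    unfolding gdist_def using p by (auto intro: INF_lower)
  also have "\<dots> \<le> enat x" using p by simp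
  finally show "near x u v" by (simp add: near_def)
qed

lemma near_vertex: "near x u v \<Longrightarrow> u < n \<and> v < n"
  unfolding near_iff_walk walk_betw_def by (metis hd_in_set last_in_set lessThan_iff subsetD)

lemma near_mono: "near x u v \<Longrightarrow> x \<le> y \<Longrightarrow> near y u v"
  by (auto simp: near_def intro: order_trans)

lemma near_refl: "u < n \<Longrightarrow> near x u u"
  by (auto simp: near_iff_walk walk_betw_def intro!: exI[of _ "[u]"])

lemma near_sym: "near x u v \<Longrightarrow> near x v u"
proof -
  assume "near x u v"
  then obtain p where p: "walk_betw {..<n} E u p v" "length p \<le> Suc x" using near_iff_walk by auto
  have "walk_betw {..<n} E v (rev p) u"
    using p by (auto simp: walk_betw_def successively_rev hd_rev last_rev insert_commute)
  then show ?thesis using p(2) near_iff_walk by (metis length_rev)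
qed

lemma near_trans:
  assumes "near x u v" "near y v w"
  shows "near (x + y) u w"
proof -
  obtain p where p: "walk_betw {..<n} E u p v" "length p \<le> Suc x" using assms near_iff_walk by auto
  obtain q where q: "walk_betw {..<n} E v q w" "length q \<le> Suc y" using assms near_iff_walk by auto
  obtain q' where q': "q = v # q'" using q by (cases q) (auto simp: walk_betw_def)
  have "walk_betw {..<n} E u (p @ q') w"
    using p q unfolding q' walk_betw_def
    by (cases q') (auto simp: successively_append_iff successively_Cons)
  moreover have "length (p @ q') \<le> Suc (x + y)" using p q q' by simp
  ultimately show ?thesis using near_iff_walk by blast
qed

lemma near_split:
  assumes "near (x + y) u w"
  shows "\<exists>z. near x u z \<and> near y z w"
proof -
  obtain p where p: "walk_betw {..<n} E u p w" "length p \<le> Suc (x + y)" using assms near_iff_walk by auto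
  show ?thesis
  proof (cases "length p \<le> Suc x")
    case True
    then have "near x u w" using p near_iff_walk by blast
    moreover have "near y w w" using near_vertex[OF assms] near_refl by simp
    ultimately show ?thesis by blast
  next
    case False
    then have x: "x < length p" by simp
    have "successively (\<lambda>x y. {x, y} \<in> E) (take (Suc x) p @ drop (Suc x) p)"
      "successively (\<lambda>x y. {x, y} \<in> E) (take x p @ drop x p)"
      using p by (simp_all add: walk_betw_def)
    then have s: "successively (\<lambda>x y. {x, y} \<in> E) (take (Suc x) p)"
      "successively (\<lambda>x y. {x, y} \<in> E) (drop x p)"
      unfolding successively_append_iff by auto
    \<comment> \<open>The pieces \<open>take (Suc x) p\<close> and \<open>drop x p\<close> share the
      vertex \<open>p ! x\<close>, which is the intermediate vertex.\<close>
    have "last (take (Suc x) p) = p ! x" using x by (simp add: take_Suc_conv_app_nth)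
    then have "walk_betw {..<n} E u (take (Suc x) p) (p ! x)"
      using p(1) s(1) x unfolding walk_betw_def by (auto dest: in_set_takeD)
    moreover have "walk_betw {..<n} E (p ! x) (drop x p) w"
      using p(1) s(2) x unfolding walk_betw_def by (auto simp: hd_drop_conv_nth dest: in_set_dropD)
    moreover have "length (take (Suc x) p) \<le> Suc x" "length (drop x p) \<le> Suc y"
      using p by auto
    ultimately show ?thesis using near_iff_walk by blast
  qed
qed

lemma near_0: "near 0 u v \<longleftrightarrow> u < n \<and> u = v"
proof
  assume "near 0 u v"
  then obtain p where "walk_betw {..<n} E u p v" "length p \<le> 1" using near_iff_walk by auto
  then show "u < n \<and> u = v" by (cases p) (auto simp: walk_betw_def)
qed (auto simp: near_refl)

lemma near_1: "near 1 u v \<longleftrightarrow> u < n \<and> v < n \<and> (u = v \<or> {u, v} \<in> E)"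
proof
  assume near: "near 1 u v"
  then obtain p where p: "walk_betw {..<n} E u p v" "length p \<le> 2" using near_iff_walk by auto
  have "u = v \<or> {u, v} \<in> E"
    using p by (cases p; cases "tl p") (auto simp: walk_betw_def successively_Cons)
  then show "u < n \<and> v < n \<and> (u = v \<or> {u, v} \<in> E)" using near_vertex[OF near] by simp
next
  assume a: "u < n \<and> v < n \<and> (u = v \<or> {u, v} \<in> E)"
  show "near 1 u v"
  proof (cases "u = v")
    case False
    then have "walk_betw {..<n} E u [u, v] v" using a by (auto simp: walk_betw_def)
    then show ?thesis unfolding near_iff_walk by (intro exI[of _ "[u, v]"]) simp
  qed (use a near_refl in auto)
qed

lemma edge_vertices: "{u, v} \<in> E \<Longrightarrow> u < n \<and> v < n \<and> u \<noteq> v"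
  using graph by (fastforce simp: simple_graph_def doubleton_eq_iff)

text \<open>The vertices \<open>f i\<close> along a shortest walk are distinct, because a repetition
  would shorten it; so the distance is less than \<open>n\<close>. A finite k-radius is therefore at
  most \<open>n - 1\<close>, which bounds the radii to be tried.\<close>

lemma near_less_n:
  assumes "near x u v"
  shows "near (n - 1) u v"
proof -
  define m where "m = (LEAST m. near m u v)"
  have m: "near m u v" unfolding m_def using assms by (rule LeastI)
  have least: "m \<le> y" if "near y u v" for y unfolding m_def using that by (rule Least_le)
  have "\<exists>z. near i u z \<and> near (m - i) z v" if "i \<le> m" for i
    using near_split[of i "m - i" u v] m that by simp
  then obtain f where f: "\<And>i. i \<le> m \<Longrightarrow> near i u (f i)" "\<And>i. i \<le> m \<Longrightarrow> near (m - i) (f i) v" by metis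
  have ne: "f i \<noteq> f j" if "i < j" "j \<le> m" for i j
  proof
    assume "f i = f j"
    then have "near i u (f j)" using f(1)[of i] that by simp
    then have "near (i + (m - j)) u v" using near_trans f(2)[OF that(2)] by blast
    then show False using least[of "i + (m - j)"] that by auto
  qed
  have "inj_on f {..m}"
    by (rule inj_onI) (metis ne atMost_iff linorder_neqE_nat)
  moreover have "f ` {..m} \<subseteq> {..<n}" using f(1) near_vertex by auto
  ultimately have "card {..m} \<le> card {..<n}" by (meson card_inj_on_le finite_lessThan)
  then show ?thesis using near_mono[OF m] by simp
qed

section \<open>Coverings and the approximation guarantee\<close>

text \<open>Centers form a sequence that may repeat vertices, because they are guessed independently
  of each other. Completing them to \<open>k\<close> distinct vertices is left to
  \<open>distinct_prog\<close>.\<close>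

definition covers :: "nat \<Rightarrow> nat \<Rightarrow> (nat \<Rightarrow> nat) \<Rightarrow> bool" where
  "covers k x c \<longleftrightarrow> (\<forall>i<k. c i < n) \<and> (\<forall>v<n. \<exists>i<k. near x v (c i))"

text \<open>Both infima in the definition are attained: \<open>1 \<le> k\<close> makes a center set
  non-empty, and an empty family of center sets would give the radius \<infinity>.\<close>

lemma k_radius_le_iff:
  assumes "1 \<le> k"
  shows "k_radius {..<n} E k \<le> enat x \<longleftrightarrow>
    (\<exists>C \<subseteq> {..<n}. card C = k \<and> (\<forall>v<n. \<exists>c\<in>C. near x v c))"
proof -
  have gd: "gdist_set {..<n} E v C \<le> enat x \<longleftrightarrow> (\<exists>c\<in>C. near x v c)" if "card C = k" for v C
  proof
    assume le: "gdist_set {..<n} E v C \<le> enat x"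
    have "C \<noteq> {}" using that assms by auto
    then have "Inf (gdist {..<n} E v ` C) \<in> gdist {..<n} E v ` C"
      by (intro Inf_enat_mem) simp
    then show "\<exists>c\<in>C. near x v c" using le by (auto simp: gdist_set_def near_def)
  next
    assume "\<exists>c\<in>C. near x v c"
    then show "gdist_set {..<n} E v C \<le> enat x"
      by (auto simp: gdist_set_def near_def intro: INF_lower2)
  qed
  let ?S = "{C. C \<subseteq> {..<n} \<and> card C = k}"
  let ?f = "\<lambda>C. SUP v \<in> {..<n}. gdist_set {..<n} E v C"
  have sup: "?f C \<le> enat x \<longleftrightarrow> (\<forall>v<n. \<exists>c\<in>C. near x v c)" if "C \<in> ?S" for C
    using gd[of C] that by (auto simp: SUP_le_iff)
  show ?thesis
  proof
    assume le: "k_radius {..<n} E k \<le> enat x"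
    have "?S \<noteq> {}"
    proof
      assume "?S = {}"
      then have "k_radius {..<n} E k = \<infinity>" unfolding k_radius_def by (simp only: Inf_enat_def) simp
      then show False using le by simp
    qed
    then have "Inf (?f ` ?S) \<in> ?f ` ?S" by (intro Inf_enat_mem) simp
    then obtain C where C: "C \<in> ?S" "k_radius {..<n} E k = ?f C" by (auto simp: k_radius_def)
    then show "\<exists>C \<subseteq> {..<n}. card C = k \<and> (\<forall>v<n. \<exists>c\<in>C. near x v c)" using le sup[of C] by auto
  next
    assume "\<exists>C \<subseteq> {..<n}. card C = k \<and> (\<forall>v<n. \<exists>c\<in>C. near x v c)"
    then obtain C where C: "C \<in> ?S" "\<forall>v<n. \<exists>c\<in>C. near x v c" by auto
    have "k_radius {..<n} E k \<le> ?f C" unfolding k_radius_def using C(1) by (rule INF_lower)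
    also have "\<dots> \<le> enat x" using sup C by blast
    finally show "k_radius {..<n} E k \<le> enat x" .
  qed
qed

lemma covers_of_k_radius_le:
  assumes "1 \<le> k" "k_radius {..<n} E k \<le> enat x"
  shows "\<exists>c. covers k x c"
proof -
  obtain C where C: "C \<subseteq> {..<n}" "card C = k" "\<forall>v<n. \<exists>c\<in>C. near x v c"
    using assms k_radius_le_iff by auto
  have "finite C" using C(1) finite_subset by blast
  then obtain c where "bij_betw c {0..<card C} C" using ex_bij_betw_nat_finite by blast
  then have "C = c ` {..<k}" using C by (simp add: bij_betw_def lessThan_atLeast0)
  then show ?thesis using C unfolding covers_def by (intro exI[of _ c]) auto
qed

lemma k_radius_finite:
  assumes "1 \<le> k" "k_radius {..<n} E k \<noteq> \<infinity>"
  shows "\<exists>c. covers k (n - 1) c"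
proof -
  obtain x where "k_radius {..<n} E k = enat x" using assms by auto
  then obtain c where "covers k x c" using covers_of_k_radius_le[OF assms(1), of x] by auto
  then have "covers k (n - 1) c" unfolding covers_def using near_less_n[of x] by blast
  then show ?thesis by blast
qed

lemma covers_mono: 
  assumes "covers k x c" "x \<le> y" shows "covers k y c"
  using assms(1)   unfolding covers_def using near_mono[OF _ assms(2)] by blast

lemma k_center_approx_finite:
  assumes l: "1 \<le> l" and k: "1 \<le> k" and C: "C \<subseteq> {..<n}" "card C = k"
    and cov: "\<forall>v<n. \<exists>c\<in>C. near (2 * R - R div (2 * l)) v c"
    and low: "R = 0 \<or> \<not> (\<exists>c. covers k (R - 1) c)"
  shows "k_center_approx (2 - 1 / (2 * real l)) (1 - 1 / (2 * real l)) {..<n} E k C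
    (enat (2 * R - R div (2 * l)))"
proof -
  define b where "b = R div (2 * l)"
  define D where "D = 2 * R - b"
  define \<rho> where "\<rho> = k_radius {..<n} E k"
  have rad: "\<rho> \<le> enat D" unfolding \<rho>_def
    using k_radius_le_iff[OF k, of D] C cov unfolding D_def b_def by blast
  have dist: "gdist_set {..<n} E v C \<le> enat D" if v: "v < n" for v
  proof -
    obtain c where "c \<in> C" "near D v c" using cov v unfolding D_def b_def by blast
    then show ?thesis by (auto simp: gdist_set_def near_def intro: INF_lower2)
  qed
  obtain x where x: "\<rho> = enat x" using rad by (cases \<rho>) auto
  \<comment> \<open>\<open>x\<close> is the k-radius. If it were below \<open>R\<close>, an optimal
    solution would cover within \<open>R - 1\<close>, against \<open>low\<close>.\<close>
  have "R \<le> x"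
  proof (rule ccontr)
    assume "\<not> R \<le> x"
    then have "x \<le> R - 1" "R \<noteq> 0" by auto
    moreover obtain c where "covers k x c" using covers_of_k_radius_le[OF k, of x] x \<rho>_def by auto
    ultimately show False using low covers_mono by blast
  qed
  have "b \<le> R" by (simp add: b_def)
  \<comment> \<open>The remainder of the division is at most \<open>2 * l - 1\<close>; this rounding
    loss becomes the additive error \<open>1 - 1 / (2 * l)\<close>.\<close>
  have "2 * l * b + 2 * l \<ge> R + 1"
    unfolding b_def using l dividend_less_times_div[of "2 * l" R] by simp
  then have "real (2 * l * b + 2 * l) \<ge> real (R + 1)" by (rule of_nat_mono)
  then have b: "real b \<ge> (real R + 1) / (2 * real l) - 1" using l by (simp add: field_simps)
  have "real D = 2 * real R - real b" unfolding D_def using \<open>b \<le> R\<close> by (simp add: of_nat_diff)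
  also have "\<dots> \<le> (2 - 1 / (2 * real l)) * real R + (1 - 1 / (2 * real l))"
  proof -
    have "(2 - 1 / (2 * real l)) * real R + (1 - 1 / (2 * real l)) = 2 * real R - ((real R + 1) / (2 * real l) - 1)"
      by (simp add: algebra_simps add_divide_distrib)
    then show ?thesis using b by simp
  qed
  also have "\<dots> \<le> (2 - 1 / (2 * real l)) * real x + (1 - 1 / (2 * real l))"
    using \<open>R \<le> x\<close> l by (intro add_right_mono mult_left_mono) (auto simp: field_simps)
  finally have "ereal (real D) \<le> ereal (2 - 1 / (2 * real l)) * ereal (real x) + ereal (1 - 1 / (2 * real l))"
    by simp
  then show ?thesis
    unfolding k_center_approx_def using C dist rad x unfolding \<rho>_def b_def[symmetric] D_def[symmetric]
    by simp
qed

lemma k_center_approx_infinite: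
  assumes l: "1 \<le> l" and k: "1 \<le> k" and C: "C \<subseteq> {..<n}" "card C = k"
    and inf: "\<not> (\<exists>c. covers k (n - 1) c)"
  shows "k_center_approx (2 - 1 / (2 * real l)) (1 - 1 / (2 * real l)) {..<n} E k C \<infinity>"
proof -
  have "k_radius {..<n} E k = \<infinity>" using k_radius_finite[OF k] inf by blast
  \<comment> \<open>With a positive factor the right-hand side of the guarantee is \<infinity> as
    well.\<close>
  moreover have "2 - 1 / (2 * real l) > 0" using l by (simp add: field_simps)
  ultimately show ?thesis using C by (simp add: k_center_approx_def)
qed

end

section \<open>One level of the search\<close>

text \<open>The candidate center \<open>c i\<close>, chosen \<open>i\<close>-th, lies within \<open>R - g (l - i)\<close> of the center
  \<open>cs i\<close> of an optimal solution. The thresholds decrease by \<open>2 * b\<close> per level; this is the slack that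
  \<open>center_near_sample\<close> consumes.\<close>

locale level_search = graph +
  fixes k l R b :: nat and g :: "nat \<Rightarrow> nat" and S far :: "nat \<Rightarrow> nat \<Rightarrow> bool"
  assumes l: "1 \<le> l" "l \<le> k"
    and b: "b = R div (2 * l)"
    and g: "g = (\<lambda>r. (2 * r - 1) * b)"
    and sampled: "\<And>r v. r \<le> l \<Longrightarrow> v < n \<Longrightarrow> \<not> far r v \<Longrightarrow> \<exists>s<n. S r s \<and> near (g r) v s"
    and not_far_0: "\<And>v. v < n \<Longrightarrow> \<not> far 0 v"
    and S_nonempty: "\<And>r. r \<le> l \<Longrightarrow> \<exists>s<n. S r s"
begin

text \<open>A guess within \<open>R - g (l - i)\<close> of its center covers, at radius
  \<open>2 * R - g (l - i)\<close>, all that this center covers within \<open>R\<close>. A vertex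
  beyond all these radii must be served by a center not yet guessed.\<close>

definition uncovered :: "nat \<Rightarrow> (nat \<Rightarrow> nat) \<Rightarrow> nat \<Rightarrow> bool" where
  "uncovered j c w \<longleftrightarrow> w < n \<and> (\<forall>i<j. \<not> near (2 * R - g (l - i)) w (c i))"

text \<open>The optimal solution \<open>cs\<close> is quantified inside, so that it can be reordered
  at each guess. For \<open>j = 0\<close> this just says that radius \<open>R\<close> is
  feasible.\<close>

definition promising :: "nat \<Rightarrow> (nat \<Rightarrow> nat) \<Rightarrow> bool" where
  "promising j c \<longleftrightarrow> (\<exists>cs. covers k R cs \<and> (\<forall>i<j. near (R - g (l - i)) (c i) (cs i)))"

lemma b_le: "2 * l * b \<le> R"
  unfolding b by simp

lemma g_le: "r \<le> l \<Longrightarrow> g r \<le> R"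
proof -
  assume "r \<le> l"
  then have "(2 * r - 1) * b \<le> (2 * l) * b" by (intro mult_le_mono1) simp
  also have "\<dots> \<le> R" by (rule b_le)
  finally show ?thesis by (simp add: g)
qed

lemma b_le_g: "1 \<le> r \<Longrightarrow> b \<le> g r"
proof -
  assume "1 \<le> r"
  then have "1 * b \<le> (2 * r - 1) * b" by (intro mult_le_mono1) simp
  then show ?thesis using g by simp
qed

lemma promising_covered:
  assumes "near (R - g r) c' c" "near R v c" "r \<le> l"
  shows "near (2 * R - g r) v c'"
proof -
  have "near (R + (R - g r)) v c'" using near_trans[OF assms(2) near_sym[OF assms(1)]] .
  then show ?thesis using g_le[OF assms(3)] by (simp add: mult_2)
qed

text \<open>The case \<open>k = l\<close>, in which all centers are found by branching: each guess
  has a level \<open>l - i \<ge> 1\<close>, hence a threshold of at least \<open>b\<close>.\<close>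

lemma promising_complete:
  assumes "promising k c" "k \<le> l" "\<forall>i<k. c i < n"
  shows "covers k (2 * R - b) c"
proof -
  obtain cs where cs: "covers k R cs" "\<forall>i<k. near (R - g (l - i)) (c i) (cs i)"
    using assms by (auto simp: promising_def)
  have "\<exists>i<k. near (2 * R - b) v (c i)" if v: "v < n" for v
  proof -
    obtain i where i: "i < k" "near R v (cs i)" using cs(1) v by (auto simp: covers_def)
    have "near (2 * R - g (l - i)) v (c i)"
      by (rule promising_covered[OF _ i(2)]) (use cs i in auto)
    moreover have "b \<le> g (l - i)" using i assms by (intro b_le_g) simp
    ultimately show ?thesis using i near_mono diff_le_mono2 by blast
  qed
  then show ?thesis using assms by (simp add: covers_def)
qed

text \<open>The center covering \<open>w\<close> cannot belong to an earlier guess, for that guess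
  would then cover \<open>w\<close>. It is moved to position \<open>j\<close>, and a vertex on a
  walk from \<open>w\<close> to it is the right guess.\<close>

lemma promising_branch:
  assumes j: "j < l" and p: "promising j c" and w: "uncovered j c w"
  shows "\<exists>z<n. near (g (l - j)) w z \<and> promising (Suc j) (c(j := z))"
proof -
  obtain cs where cs: "covers k R cs" "\<forall>i<j. near (R - g (l - i)) (c i) (cs i)"
    using p by (auto simp: promising_def)
  obtain i where i: "i < k" "near R w (cs i)" using cs(1) w by (auto simp: covers_def uncovered_def)
  have ij: "j \<le> i"
  proof (rule ccontr)
    assume "\<not> j \<le> i"
    then have "near (2 * R - g (l - i)) w (c i)"
      by (intro promising_covered[OF _ i(2)]) (use cs in auto)
    then show False using w \<open>\<not> j \<le> i\<close> by (simp add: uncovered_def)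
  qed
  have "near (g (l - j) + (R - g (l - j))) w (cs i)" using i g_le[of "l - j"] by simp
  then obtain z where z: "near (g (l - j)) w z" "near (R - g (l - j)) z (cs i)" using near_split by blast
  \<comment> \<open>Exchanging positions \<open>i\<close> and \<open>j\<close> keeps the earlier
    guesses matched, since \<open>j \<le> i\<close>.\<close>
  let ?cs = "cs(j := cs i, i := cs j)"
  have jk: "j < k" using j l by simp
  have "covers k R ?cs" unfolding covers_def
  proof (intro conjI allI impI)
    fix i' assume "i' < k"
    then show "?cs i' < n" using cs(1) i(1) jk by (auto simp: covers_def)
  next
    fix v assume "v < n"
    then obtain i' where "i' < k" "near R v (cs i')" using cs(1) by (auto simp: covers_def)
    then show "\<exists>i'<k. near R v (?cs i')"
      using i(1) jk by (cases "i' = i"; cases "i' = j") (auto intro: exI[of _ i] exI[of _ j] exI[of _ i'])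
  qed
  moreover have "\<forall>i'<Suc j. near (R - g (l - i')) ((c(j := z)) i') (?cs i')"
    using cs(2) z ij by (auto simp: less_Suc_eq)
  ultimately have "promising (Suc j) (c(j := z))" unfolding promising_def by blast
  then show ?thesis using z near_vertex by blast
qed

text \<open>Walking \<open>2 * r * b\<close> steps from a vertex that is badly covered towards its center stays
  inside the uncovered region, which the sample covers well.\<close>

lemma center_near_sample:
  assumes j: "j \<le> l" and nofar: "\<forall>w. uncovered j c w \<longrightarrow> \<not> far (l - j) w"
    and u: "\<forall>i<j. \<not> near (2 * R - b) u (c i)" and ce: "near R u ce"
  shows "\<exists>s<n. S (l - j) s \<and> near (R - b) ce s"
proof (cases "j = l")
  case True
  have "ce < n" using ce near_vertex by blast
  \<comment> \<open>At level 0 nothing is far, and \<open>g 0 = 0\<close> by truncated subtraction,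
    so \<open>ce\<close> itself belongs to the sample.\<close>
  then obtain s where s: "s < n" "S 0 s" "near (g 0) ce s" using sampled[of 0 ce] not_far_0 by auto
  moreover have "g 0 \<le> R - b" by (simp add: g)
  ultimately show ?thesis using True near_mono by auto
next
  case False
  define r where "r = l - j"
  have r: "1 \<le> r" "r \<le> l" using False j by (auto simp: r_def)
  define y where "y = 2 * r * b"
  have y: "y \<le> R"
  proof -
    have "2 * r * b \<le> 2 * l * b" using r by simp
    also have "\<dots> \<le> R" by (rule b_le)
    finally show ?thesis by (simp add: y_def)
  qed
  \<comment> \<open>From the center it is \<open>R - y\<close> to \<open>z\<close> and
    \<open>g r\<close> on to the sample, together \<open>R - b\<close>.\<close>
  have gr: "g r + b = y" using r(1) by (cases r) (auto simp: g y_def algebra_simps)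
  have "near (y + (R - y)) u ce" using ce y by simp
  then obtain z where z: "near y u z" "near (R - y) z ce" using near_split by blast
  have "uncovered j c z" unfolding uncovered_def
  proof (intro conjI allI impI)
    show "z < n" using z near_vertex by blast
    fix i assume i: "i < j"
    show "\<not> near (2 * R - g (l - i)) z (c i)"
    proof
      assume "near (2 * R - g (l - i)) z (c i)"
      then have 1: "near (y + (2 * R - g (l - i))) u (c i)" using z near_trans by blast
      \<comment> \<open>Earlier guesses have level at least \<open>r + 1\<close>; their thresholds,
        at least \<open>(2 * r + 1) * b\<close>, pay for the \<open>y\<close> steps and for the
        final saving \<open>b\<close>.\<close>
      have "2 * r + 1 \<le> 2 * (l - i) - 1" using i j False by (simp add: r_def)
      then have "(2 * r + 1) * b \<le> (2 * (l - i) - 1) * b" by (rule mult_le_mono1)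
      then have "y + b \<le> g (l - i)" by (simp add: g y_def algebra_simps)
      then have "y + (2 * R - g (l - i)) \<le> 2 * R - b" using g_le[of "l - i"] by simp
      then show False using u i near_mono[OF 1] by blast
    qed
  qed
  then have "\<not> far r z" "z < n" using nofar by (auto simp: r_def uncovered_def)
  then obtain s where s: "s < n" "S r s" "near (g r) z s" using sampled[of r z] r by auto
  have "near (R - y + g r) ce s" using near_trans[OF near_sym[OF z(2)] s(3)] .
  moreover have "R - y + g r = R - b" using gr y by simp
  ultimately show ?thesis using s by (auto simp: r_def)
qed

text \<open>Only a missing center that serves some vertex left uncovered by the guesses needs a
  sample vertex nearby; any other one may be replaced by an arbitrary sample vertex
  \<open>s0\<close>.\<close>

lemma promising_sample:
  assumes j: "j \<le> l" and p: "promising j c" and c: "\<forall>i<j. c i < n"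
    and nofar: "\<forall>w. uncovered j c w \<longrightarrow> \<not> far (l - j) w"
  shows "\<exists>c'. (\<forall>i<j. c' i = c i) \<and> (\<forall>i. j \<le> i \<and> i < k \<longrightarrow> c' i < n \<and> S (l - j) (c' i)) \<and>
    covers k (2 * R - b) c'"
proof -
  obtain cs where cs: "covers k R cs" "\<forall>i<j. near (R - g (l - i)) (c i) (cs i)"
    using p by (auto simp: promising_def)
  obtain s0 where s0: "s0 < n" "S (l - j) s0" using S_nonempty[of "l - j"] by auto
  \<comment> \<open>The sample vertex of a center must serve all its vertices \<open>u\<close> at
    once; this works because the bound from \<open>center_near_sample\<close> does not mention
    \<open>u\<close>.\<close>
  have "\<exists>s. s < n \<and> S (l - j) s \<and>
    ((\<exists>u. (\<forall>i<j. \<not> near (2 * R - b) u (c i)) \<and> near R u (cs i')) \<longrightarrow> near (R - b) (cs i') s)" for i'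
    using center_near_sample[OF j nofar] s0 by metis
  then obtain f where f: "\<And>i'. f i' < n \<and> S (l - j) (f i')"
    "\<And>i' u. (\<forall>i<j. \<not> near (2 * R - b) u (c i)) \<Longrightarrow> near R u (cs i') \<Longrightarrow> near (R - b) (cs i') (f i')"
    by metis
  define c' where "c' = (\<lambda>i. if i < j then c i else f i)"
  have "\<exists>i<k. near (2 * R - b) v (c' i)" if v: "v < n" for v
  proof (cases "\<exists>i<j. near (2 * R - b) v (c i)")
    case True
    then show ?thesis using j l unfolding c'_def by force
  next
    case False
    obtain i where i: "i < k" "near R v (cs i)" using cs(1) v by (auto simp: covers_def)
    have ij: "j \<le> i"
    proof (rule ccontr)
      assume *: "\<not> j \<le> i"
      then have "near (2 * R - g (l - i)) v (c i)"
        by (intro promising_covered[OF _ i(2)]) (use cs in auto)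
      moreover have "b \<le> g (l - i)" using * j by (intro b_le_g) simp
      ultimately have "near (2 * R - b) v (c i)" using near_mono diff_le_mono2 by blast
      then show False using False * by auto
    qed
    have "near (R - b) (cs i) (f i)" using f(2)[of v i] False i by blast
    then have "near (R + (R - b)) v (f i)" using i near_trans by blast
    moreover have "b \<le> R" by (simp add: b)
    ultimately have "near (2 * R - b) v (c' i)" using ij by (simp add: c'_def mult_2)
    then show ?thesis using i by blast
  qed
  then have "covers k (2 * R - b) c'" unfolding covers_def using c f by (auto simp: c'_def)
  then show ?thesis using f(1) by (intro exI[of _ c']) (auto simp: c'_def)
qed

end

section \<open>All-pairs distances by breadth-first search\<close>

text \<open>Halving is not an operation of the machine, so it becomes a table indexed by powers of
  two. The loop ends with \<open>p\<close> the least power of two that is at least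
  \<open>n\<close>.\<close>

definition powers_prog :: com where
  "powers_prog = Seq (Assign ''p'' (Lit 1))
     (While (Less (Var ''p'') (Var ''n''))
       (Seq (Store ''half'' (Add (Var ''p'') (Var ''p'')) (Var ''p''))
         (Assign ''p'' (Add (Var ''p'') (Var ''p'')))))"

text \<open>The offsets \<open>v * n\<close> of the rows of the matrix \<open>D\<close>, standing in
  for multiplication.\<close>

definition rows_prog :: com where
  "rows_prog = Seq (Assign ''x'' (Lit 0)) (For ''v'' ''n''
     (Seq (Store ''O'' (Var ''v'') (Var ''x'')) (Assign ''x'' (Add (Var ''x'') (Var ''n'')))))"

text \<open>Linked adjacency lists: arcs are numbered from 1, \<open>nx\<close> leads to an older
  arc with the same source, and 0 ends a list.\<close>

definition arc_prog :: "string \<Rightarrow> string \<Rightarrow> com" where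
  "arc_prog a b = Seq (Assign ''c'' (Add (Var ''c'') (Lit 1)))
     (Seq (Store ''to'' (Var ''c'') (Cell b (Var ''i'')))
     (Seq (Store ''nx'' (Var ''c'') (Cell ''hd'' (Cell a (Var ''i''))))
     (Store ''hd'' (Cell a (Var ''i'')) (Var ''c''))))"

definition adjacency_prog :: com where
  "adjacency_prog = Seq (Assign ''c'' (Lit 0)) (For ''i'' ''m''
     (Seq (arc_prog ''src'' ''dst'') (arc_prog ''dst'' ''src'')))"

definition scan_prog :: com where
  "scan_prog = While (Less (Lit 0) (Var ''e''))
     (Seq (Assign ''y'' (Cell ''to'' (Var ''e'')))
     (Seq (If (Equal (Cell ''D'' (Add (Var ''o'') (Var ''y''))) (Var ''F''))
        (Seq (Store ''D'' (Add (Var ''o'') (Var ''y'')) (Add (Cell ''D'' (Add (Var ''o'') (Var ''u''))) (Lit 1)))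
        (Seq (Store ''Q'' (Var ''t'') (Var ''y''))
          (Assign ''t'' (Add (Var ''t'') (Lit 1))))) Skip)
      (Assign ''e'' (Cell ''nx'' (Var ''e'')))))"

definition queue_prog :: com where
  "queue_prog = While (Less (Var ''h'') (Var ''t''))
     (Seq (Assign ''u'' (Cell ''Q'' (Var ''h'')))
     (Seq (Assign ''h'' (Add (Var ''h'') (Lit 1)))
     (Seq (Assign ''e'' (Cell ''hd'' (Var ''u''))) scan_prog)))"

definition bfs_prog :: com where
  "bfs_prog = Seq (Assign ''o'' (Cell ''O'' (Var ''s'')))
     (Seq (For ''v'' ''n'' (Store ''D'' (Add (Var ''o'') (Var ''v'')) (Var ''F'')))
     (Seq (Store ''D'' (Add (Var ''o'') (Var ''s'')) (Lit 0))
     (Seq (Store ''Q'' (Lit 0) (Var ''s''))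
     (Seq (Assign ''h'' (Lit 0))
     (Seq (Assign ''t'' (Lit 1)) queue_prog)))))"

definition distances_prog :: com where
  "distances_prog = Seq powers_prog
     (Seq (Assign ''F'' (Add (Add (Add (Var ''p'') (Var ''p'')) (Add (Var ''p'') (Var ''p''))) (Lit 1)))
     (Seq rows_prog (Seq adjacency_prog (For ''s'' ''n'' bfs_prog))))"

text \<open>The arcs of a linked list. Following only links that decrease makes this terminate for
  arbitrary array contents.\<close>

fun chain :: "(nat \<Rightarrow> nat) \<Rightarrow> nat \<Rightarrow> nat list" where
  "chain nx e = (if nx e < e then e # chain nx (nx e) else [])"

declare chain.simps [simp del]

lemma chain_cong: "(\<And>x. x \<le> e \<Longrightarrow> nx x = nx' x) \<Longrightarrow> chain nx e = chain nx' e"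
proof (induction e rule: less_induct)
  case (less e)
  then show ?case by (subst (1 2) chain.simps) (auto intro!: less.IH)
qed

lemma set_chain_le: "x \<in> set (chain nx e) \<Longrightarrow> 0 < x \<and> x \<le> e"
proof (induction e rule: less_induct)
  case (less e)
  have *: "nx e < e" "x = e \<or> x \<in> set (chain nx (nx e))"
    using less.prems by (auto simp: chain.simps[of nx e] split: if_splits)
  then show ?case using less.IH[OF *(1)] by auto
qed

lemma chain_0 [simp]: "chain nx 0 = []"
  by (simp add: chain.simps)

text \<open>For fixed \<open>k\<close> the bound on \<open>B\<close> is quadratic in
  \<open>n\<close>: room for matrix indices, arc numbers and, through the factor
  \<open>(k + 1)\<^sup>2\<close>, the counters that compute exponents.\<close>

locale instance_machine = machine B Z + graph n E
  for B Z n :: nat and E :: "nat set set" +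
  fixes k l :: nat and es :: "(nat \<times> nat) list"
  assumes l: "1 \<le> l" "l \<le> k" and kn: "k \<le> n"
    and es: "edge_list_of es E" and n_le: "n \<le> card E + 1"
    and B_ge: "100 * (k + 1)\<^sup>2 * (n + 1)\<^sup>2 \<le> B"
begin

definition m :: nat where "m = length es"

lemma m_card: "m = card E"
  using es distinct_card[of "map (\<lambda>(u, v). {u, v}) es"] by (simp add: m_def edge_list_of_def)

lemma es_nth: "i < m \<Longrightarrow> {fst (es ! i), snd (es ! i)} \<in> E \<and> fst (es ! i) < n \<and> snd (es ! i) < n"
proof -
  assume "i < m"
  then have "es ! i \<in> set es" by (simp add: m_def)
  moreover obtain u v where uv: "es ! i = (u, v)" by (cases "es ! i")
  ultimately have "{u, v} \<in> (\<lambda>(u, v). {u, v}) ` set es"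
    by (intro image_eqI[of _ _ "(u, v)"]) auto
  then have "{u, v} \<in> E" using es by (simp add: edge_list_of_def)
  then show ?thesis using edge_vertices uv by simp
qed

lemma n_pos: "1 \<le> n" using l kn by simp

lemma m_le: "m \<le> n * n"
proof -
  have "E \<subseteq> (\<lambda>(u, v). {u, v}) ` ({..<n} \<times> {..<n})"
  proof
    fix e assume "e \<in> E"
    then obtain u v where "e = {u, v}" "u < n" "v < n" using graph unfolding simple_graph_def by blast
    then show "e \<in> (\<lambda>(u, v). {u, v}) ` ({..<n} \<times> {..<n})" by (intro image_eqI[of _ _ "(u, v)"]) auto
  qed
  then have "card E \<le> card ((\<lambda>(u, v). {u, v}) ` ({..<n} \<times> {..<n}))"
    by (intro card_mono) auto
  also have "\<dots> \<le> card ({..<n} \<times> {..<n})" by (rule card_image_le) auto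
  finally show ?thesis by (simp add: m_card)
qed

lemma B_large: "100 * (n * n) + 200 * n + 100 \<le> B" "100 * (k + 1) * (k + 1) * (n + 1) \<le> B"
proof -
  have "100 * 1 * (n + 1)\<^sup>2 \<le> 100 * (k + 1)\<^sup>2 * (n + 1)\<^sup>2" by (intro mult_le_mono) auto
  also note B_ge
  finally show "100 * (n * n) + 200 * n + 100 \<le> B" by (simp add: power2_eq_square)
  have "100 * (k + 1) * (k + 1) * (n + 1) = 100 * (k + 1)\<^sup>2 * (n + 1)"
    by (simp only: power2_eq_square mult.assoc)
  also have "\<dots> \<le> 100 * (k + 1)\<^sup>2 * (n + 1)\<^sup>2"
    by (intro mult_le_mono order_refl) (simp add: power2_eq_square)
  also note B_ge
  finally show "100 * (k + 1) * (k + 1) * (n + 1) \<le> B" .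
qed

section \<open>Tables that replace division and multiplication\<close>

definition L :: nat where "L = (LEAST i. n \<le> 2 ^ i)"

lemma L_ge: "n \<le> 2 ^ L"
  unfolding L_def by (rule LeastI[of _ n]) (simp add: less_imp_le)

lemma less_L: "i < L \<Longrightarrow> 2 ^ i < n"
  unfolding L_def by (drule not_less_Least) simp

lemma L_less: "2 ^ L < 2 * n"
proof (cases L)
  case 0
  then show ?thesis using n_pos by simp
next
  case (Suc i)
  then have "2 ^ i < n" by (intro less_L) simp
  then show ?thesis using Suc by simp
qed

text \<open>The mark for unreachable vertices exceeds \<open>n\<close> and every threshold that is
  tested, the largest being below \<open>2 * 2 ^ L\<close>, so comparisons need no special
  case.\<close>

definition inf_dist :: nat where "inf_dist = 4 * 2 ^ L + 1"

lemma inf_dist_gt: "n < inf_dist" and inf_dist_le: "inf_dist \<le> 8 * n"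
  using L_ge L_less by (auto simp: inf_dist_def)

lemma small_le_B: "x \<le> 10 * n + 10 \<Longrightarrow> x \<le> B" "x \<le> 10 * (n * n) + 10 * n + 10 \<Longrightarrow> x \<le> B"
  using B_large(1) by auto

text \<open>The entry for 1 is 0, so that a repeatedly halved counter ends in 0 and stops its loop.
  This entry is never written: arrays start out as zero.\<close>

definition half_ok :: "(nat \<Rightarrow> nat) \<Rightarrow> bool" where
  "half_ok f \<longleftrightarrow> f 1 = 0 \<and> (\<forall>i<L. f (2 ^ Suc i) = 2 ^ i)"

lemma triple_powers:
  assumes "reg s ''n'' = n" "arr s ''half'' 1 = 0"
  shows "triple powers_prog s (6 * n + 5) (\<lambda>s'. reg s' ''p'' = 2 ^ L \<and> half_ok (arr s' ''half''))"
  unfolding powers_prog_def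
proof (rule triple_Assign_Seq)
  let ?I = "\<lambda>s. reg s ''n'' = n \<and> (\<exists>i\<le>L. reg s ''p'' = 2 ^ i \<and> arr s ''half'' 1 = 0 \<and>
    (\<forall>i'<i. arr s ''half'' (2 ^ Suc i') = 2 ^ i'))"
  let ?s = "set_reg ''p'' (aval (Lit 1) s) s"
  show "triple (While (Less (Var ''p'') (Var ''n''))
       (Seq (Store ''half'' (Add (Var ''p'') (Var ''p'')) (Var ''p''))
         (Assign ''p'' (Add (Var ''p'') (Var ''p''))))) ?s (6 * n + 5 - 1)
     (\<lambda>s'. reg s' ''p'' = 2 ^ L \<and> half_ok (arr s' ''half''))"
  proof (rule triple_While[where I = ?I and \<Phi> = "\<lambda>s. 3 * (2 * n - reg s ''p'')"])
    show "?I ?s" using assms by (auto intro: exI[of _ 0])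
    fix s'
    assume I: "?I s'" and b: "bval (Less (Var ''p'') (Var ''n'')) s'"
    then obtain i where i: "i \<le> L" "reg s' ''p'' = 2 ^ i" "arr s' ''half'' 1 = 0"
      "\<forall>i'<i. arr s' ''half'' (2 ^ Suc i') = 2 ^ i'" by auto
    have lt: "2 ^ i < n" using b I i by simp
    have iL: "i < L" using lt L_ge i(1) by (metis le_neq_implies_less not_le)
    have ne: "2 ^ i + 2 ^ i \<noteq> Suc 0" by presburger
    have dbl: "2 ^ i + 2 ^ i = (2::nat) ^ Suc i" by simp
    have "(1::nat) \<le> 2 ^ i" by simp
    \<comment> \<open>A doubling adds at least 1 to \<open>p\<close>, which stays below
      \<open>2 * n\<close>; a potential linear in \<open>n\<close> is good enough here.\<close>
    then have pot: "3 + 3 * (2 * n - (2 ^ i + 2 ^ i)) \<le> 3 * (2 * n - 2 ^ i)" using lt by arith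
    have nb: "n \<le> B" "2 * n \<le> B" by (auto intro: small_le_B)
    have I': "?I (set_reg ''p'' (2 ^ i + 2 ^ i) (s'\<lparr>arr := (arr s')(''half'' := (arr s' ''half'')(2 ^ i + 2 ^ i := 2 ^ i))\<rparr>))"
    proof -
      have "\<forall>i'<Suc i. ((arr s' ''half'')(2 ^ i + 2 ^ i := 2 ^ i)) (2 ^ Suc i') = 2 ^ i'"
        using i(4) unfolding dbl by (auto simp: less_Suc_eq simp del: power_Suc)
      then show ?thesis using I i(3) iL ne by (auto intro!: exI[of _ "Suc i"])
    qed
    show "\<exists>T. triple (Seq (Store ''half'' (Add (Var ''p'') (Var ''p'')) (Var ''p''))
         (Assign ''p'' (Add (Var ''p'') (Var ''p'')))) s' T
         (\<lambda>s''. ?I s'' \<and> T + 1 + 3 * (2 * n - reg s'' ''p'') \<le> 3 * (2 * n - reg s' ''p''))"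
      using I' nb i(2) lt pot by (intro exI[of _ 2] triple_Store_Seq triple_Assign) simp_all
  next
    fix s'
    assume I: "?I s'" and b: "\<not> bval (Less (Var ''p'') (Var ''n'')) s'"
    then obtain i where i: "i \<le> L" "reg s' ''p'' = 2 ^ i" "arr s' ''half'' 1 = 0"
      "\<forall>i'<i. arr s' ''half'' (2 ^ Suc i') = 2 ^ i'" by auto
    then have "i = L" using b I less_L[of i] by (auto simp: le_less)
    then show "reg s' ''p'' = 2 ^ L \<and> half_ok (arr s' ''half'')" using i by (auto simp: half_ok_def)
  qed auto
qed (use B_pos in auto)

lemma mod_rows [simp]: "mod_regs rows_prog = {''x'', ''v''}" "mod_arrs rows_prog = {''O''}"
  by (auto simp: rows_prog_def)

lemma triple_rows:
  assumes "reg s ''n'' = n"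
  shows "triple rows_prog s (4 * n + 3) (\<lambda>s'. \<forall>v<n. arr s' ''O'' v = v * n)"
  unfolding rows_prog_def
proof (rule triple_Assign_Seq)
  let ?s = "set_reg ''x'' (aval (Lit 0) s) s"
  let ?P = "Seq (Store ''O'' (Var ''v'') (Var ''x'')) (Assign ''x'' (Add (Var ''x'') (Var ''n'')))"
  show "triple (For ''v'' ''n'' ?P) ?s (4 * n + 3 - 1) (\<lambda>s'. \<forall>v<n. arr s' ''O'' v = v * n)"
  proof (rule triple_For[where I = "\<lambda>i s. reg s ''x'' = i * n \<and> (\<forall>v<i. arr s ''O'' v = v * n)" and T = "\<lambda>_. 2"])
    fix i s' assume i: "i < n" "reg s' ''v'' = i" "framed (For ''v'' ''n'' ?P) ?s s'"
      and I: "reg s' ''x'' = i * n \<and> (\<forall>v<i. arr s' ''O'' v = v * n)"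
    have n: "reg s' ''n'' = n" using i(3) assms by (simp add: agree_off_reg)
    have "(i + 1) * n \<le> n * n" using i by (intro mult_le_mono1) simp
    then have b: "i * n + n \<le> B" by (intro small_le_B(2)) simp
    show "triple ?P s' 2 (\<lambda>s''. reg (set_reg ''v'' (Suc i) s'') ''x'' = Suc i * n \<and>
        (\<forall>v<Suc i. arr (set_reg ''v'' (Suc i) s'') ''O'' v = v * n))"
      using b n I i by (intro triple_Store_Seq triple_Assign) (auto simp: less_Suc_eq)
  qed (use assms in auto)
qed auto

section \<open>Adjacency lists\<close>

definition adjacency :: "(nat \<Rightarrow> nat) \<Rightarrow> (nat \<Rightarrow> nat) \<Rightarrow> (nat \<Rightarrow> nat) \<Rightarrow> nat \<Rightarrow> (nat \<times> nat) set \<Rightarrow> bool" where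
  "adjacency nx head to c A \<longleftrightarrow> (\<forall>e. 0 < e \<and> e \<le> c \<longrightarrow> nx e < e) \<and> (\<forall>u. head u \<le> c) \<and>
     (\<forall>u<n. to ` set (chain nx (head u)) = {y. (u, y) \<in> A}) \<and>
     (\<Sum>u<n. length (chain nx (head u))) = c"

text \<open>The new arc has a larger number than all arcs in the lists, so by
  \<open>chain_cong\<close> the old lists persist and that of \<open>u\<close> gets a new front
  element. The sum of the list lengths is carried along for the running time of the
  searches.\<close>

lemma adjacency_arc:
  assumes a: "adjacency nx head to c A" and u: "u < n"
  shows "adjacency (nx(Suc c := head u)) (head(u := Suc c)) (to(Suc c := y)) (Suc c) (insert (u, y) A)"
proof -
  let ?nx = "nx(Suc c := head u)"
  have head: "head v \<le> c" for v using a by (simp add: adjacency_def)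
  have ch: "chain ?nx (head v) = chain nx (head v)" for v
    using head[of v] by (intro chain_cong) auto
  have new: "chain ?nx (Suc c) = Suc c # chain nx (head u)"
    using head[of u] ch[of u] by (subst chain.simps) simp
  have to: "(to(Suc c := y)) ` set (chain nx (head v)) = to ` set (chain nx (head v))" for v
    using head[of v] set_chain_le[of _ nx "head v"] by (intro image_cong) fastforce+
  have all: "chain ?nx ((head(u := Suc c)) v) = (if v = u then Suc c # chain nx (head u) else chain nx (head v))" for v
    using ch new by simp
  have "(\<Sum>v<n. length (chain ?nx ((head(u := Suc c)) v))) =
      (\<Sum>v<n. length (chain nx (head v)) + (if v = u then 1 else 0))"
    unfolding all by (intro sum.cong) auto
  also have "\<dots> = c + 1" using a u by (simp add: sum.distrib adjacency_def sum.delta)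
  finally have s: "(\<Sum>v<n. length (chain ?nx ((head(u := Suc c)) v))) = Suc c" by simp
  have im: "(to(Suc c := y)) ` set (chain ?nx ((head(u := Suc c)) v)) = {y'. (v, y') \<in> insert (u, y) A}"
    if "v < n" for v
    using a that u to[of v] unfolding all by (auto simp: adjacency_def)
  have nx: "?nx e < e" if "0 < e" "e \<le> Suc c" for e
    using a that head[of u] by (auto simp: adjacency_def le_Suc_eq less_Suc_eq_le)
  have head': "(head(u := Suc c)) v \<le> Suc c" for v using head[of v] by simp
  show ?thesis unfolding adjacency_def using s im nx head' by blast
qed

definition adj_state :: "state \<Rightarrow> nat \<Rightarrow> (nat \<times> nat) set \<Rightarrow> bool" where
  "adj_state s c A \<longleftrightarrow> adjacency (arr s ''nx'') (arr s ''hd'') (arr s ''to'') c A"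

lemma mod_arc [simp]: "mod_regs (arc_prog a b) = {''c''}" "mod_arrs (arc_prog a b) = {''to'', ''nx'', ''hd''}"
  by (auto simp: arc_prog_def)

lemma triple_arc:
  assumes "a \<notin> {''to'', ''nx'', ''hd''}" "b \<notin> {''to'', ''nx'', ''hd''}" "reg s ''c'' = c" "reg s ''i'' = i"
    "adj_state s c A" "arr s a i = u" "arr s b i = v" "u < n" "v < n" "Suc c \<le> B"
  shows "triple (arc_prog a b) s 4 (\<lambda>s'. reg s' ''c'' = Suc c \<and> adj_state s' (Suc c) (insert (u, v) A))"
proof (rule triple_bounded)
  assume bd: "bounded s"
  show ?thesis unfolding arc_prog_def
    using assms adjacency_arc[of "arr s ''nx''" "arr s ''hd''" "arr s ''to''" c A u v] boundedD(2)[OF bd]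
    by (intro triple_Assign_Seq triple_Store_Seq triple_Store) (auto simp: adj_state_def)
qed

definition arcs_of :: "nat \<Rightarrow> (nat \<times> nat) set" where
  "arcs_of i = {(u, v). \<exists>j<i. es ! j = (u, v) \<or> es ! j = (v, u)}"

definition adj_ok :: "state \<Rightarrow> bool" where
  "adj_ok s \<longleftrightarrow> (\<forall>e. 0 < e \<and> e \<le> 2 * m \<longrightarrow> arr s ''nx'' e < e) \<and> (\<forall>u. arr s ''hd'' u \<le> 2 * m) \<and>
     (\<forall>u<n. arr s ''to'' ` set (chain (arr s ''nx'') (arr s ''hd'' u)) = {y. {u, y} \<in> E}) \<and>
     (\<Sum>u<n. length (chain (arr s ''nx'') (arr s ''hd'' u))) = 2 * m"

lemma arcs_of_m: "(u, y) \<in> arcs_of m \<longleftrightarrow> {u, y} \<in> E"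
proof
  assume "(u, y) \<in> arcs_of m"
  then obtain j where "j < m" "es ! j = (u, y) \<or> es ! j = (y, u)" by (auto simp: arcs_of_def)
  then show "{u, y} \<in> E" using es_nth[of j] by (auto simp: insert_commute)
next
  assume "{u, y} \<in> E"
  then have "{u, y} \<in> (\<lambda>(u, v). {u, v}) ` set es" using es by (simp add: edge_list_of_def)
  then obtain a b where ab: "(a, b) \<in> set es" "{u, y} = {a, b}" by auto
  then obtain j where "j < m" "es ! j = (a, b)" by (auto simp: in_set_conv_nth m_def)
  then show "(u, y) \<in> arcs_of m" using ab(2) by (auto simp: arcs_of_def doubleton_eq_iff)
qed

lemma mod_adjacency [simp]:
  "mod_regs adjacency_prog = {''c'', ''i''}" "mod_arrs adjacency_prog = {''to'', ''nx'', ''hd''}"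
  by (auto simp: adjacency_prog_def)

lemma triple_adjacency:
  assumes m: "reg s ''m'' = m"
    and sd: "\<forall>i<m. arr s ''src'' i = fst (es ! i) \<and> arr s ''dst'' i = snd (es ! i)"
    and z: "arr s ''nx'' = (\<lambda>_. 0)" "arr s ''hd'' = (\<lambda>_. 0)"
  shows "triple adjacency_prog s (10 * m + 3) adj_ok"
  unfolding adjacency_prog_def
proof (rule triple_Assign_Seq)
  let ?s = "set_reg ''c'' (aval (Lit 0) s) s"
  let ?P = "Seq (arc_prog ''src'' ''dst'') (arc_prog ''dst'' ''src'')"
  show "triple (For ''i'' ''m'' ?P) ?s (10 * m + 3 - 1) adj_ok"
  proof (rule triple_For[where I = "\<lambda>i s. reg s ''c'' = 2 * i \<and> adj_state s (2 * i) (arcs_of i)" and T = "\<lambda>_. 8"])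
    fix i s' assume i: "i < m" "reg s' ''i'' = i" "framed (For ''i'' ''m'' ?P) ?s s'"
      and I: "reg s' ''c'' = 2 * i \<and> adj_state s' (2 * i) (arcs_of i)"
    obtain u v where e: "es ! i = (u, v)" by (cases "es ! i")
    have sd': "arr s' ''src'' i = u" "arr s' ''dst'' i = v"
      using i sd e by (simp_all add: agree_off_arr)
    have uv: "u < n" "v < n" using es_nth[OF i(1)] e by auto
    have "2 * i + 2 \<le> 2 * (n * n)" using i(1) m_le by linarith
    then have b: "2 * i + 2 \<le> B" by (intro small_le_B(2)) simp
    have A: "insert (v, u) (insert (u, v) (arcs_of i)) = arcs_of (Suc i)"
      using e by (auto simp: arcs_of_def less_Suc_eq)
    show "triple ?P s' 8 (\<lambda>s''. reg (set_reg ''i'' (Suc i) s'') ''c'' = 2 * Suc i \<and>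
        adj_state (set_reg ''i'' (Suc i) s'') (2 * Suc i) (arcs_of (Suc i)))"
    proof (rule triple_Seq_framed[OF triple_arc[where c = "2 * i" and u = u and v = v and i = i and A = "arcs_of i"]])
      fix s1 assume f1: "framed (arc_prog ''src'' ''dst'') s' s1"
        and p1: "reg s1 ''c'' = Suc (2 * i) \<and> adj_state s1 (Suc (2 * i)) (insert (u, v) (arcs_of i))"
      show "triple (arc_prog ''dst'' ''src'') s1 4 (\<lambda>s''. reg (set_reg ''i'' (Suc i) s'') ''c'' = 2 * Suc i \<and>
          adj_state (set_reg ''i'' (Suc i) s'') (2 * Suc i) (arcs_of (Suc i)))"
        using f1 p1 sd' uv b i
        by (intro triple_conseq[OF triple_arc[where c = "Suc (2 * i)" and u = v and v = u and i = i
               and A = "insert (u, v) (arcs_of i)"]])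
           (auto simp: agree_off_reg agree_off_arr adj_state_def A)
    qed (use I i sd' uv b in auto)
  next
    fix s' assume "reg s' ''c'' = 2 * m \<and> adj_state s' (2 * m) (arcs_of m)"
    then show "adj_ok s'" by (simp add: adj_ok_def adj_state_def adjacency_def arcs_of_m)
  qed (use m z in \<open>auto simp: adj_state_def adjacency_def arcs_of_def chain.simps\<close>)
qed auto

end

section \<open>Breadth-first search from one source\<close>

context instance_machine begin

text \<open>The sound half of the search: queued distances are realised by walks and do not decrease
  along the queue. The bound \<open>d (Q i) \<le> i\<close> keeps them below
  \<open>inf_dist\<close>.\<close>

definition bfs_core :: "nat \<Rightarrow> (nat \<Rightarrow> nat) \<Rightarrow> (nat \<Rightarrow> nat) \<Rightarrow> nat \<Rightarrow> bool" where
  "bfs_core src d Q t \<longleftrightarrow> (\<forall>i<t. Q i < n) \<and> inj_on Q {..<t} \<and>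
     (\<forall>v<n. d v \<noteq> inf_dist \<longleftrightarrow> v \<in> Q ` {..<t}) \<and>
     (\<forall>i<t. d (Q i) \<le> i \<and> near (d (Q i)) src (Q i)) \<and>
     (\<forall>i j. i \<le> j \<and> j < t \<longrightarrow> d (Q i) \<le> d (Q j)) \<and> src \<in> Q ` {..<t} \<and> d src = 0"

text \<open>The complete half: once the whole queue is processed, with \<open>h = t\<close>, no edge
  leads out of it or to a vertex whose recorded distance is too large.\<close>

definition bfs_closed :: "(nat \<Rightarrow> nat) \<Rightarrow> (nat \<Rightarrow> nat) \<Rightarrow> nat \<Rightarrow> nat \<Rightarrow> bool" where
  "bfs_closed d Q t h \<longleftrightarrow> (\<forall>i<h. \<forall>y. {Q i, y} \<in> E \<longrightarrow> y \<in> Q ` {..<t} \<and> d y \<le> d (Q i) + 1)"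

lemma bfs_core_le:
  assumes "bfs_core src d Q t"
  shows "t \<le> n"
proof -
  have "card (Q ` {..<t}) = t" using assms by (simp add: bfs_core_def card_image)
  moreover have "Q ` {..<t} \<subseteq> {..<n}" using assms by (auto simp: bfs_core_def)
  ultimately show ?thesis using card_mono[of "{..<n}" "Q ` {..<t}"] by simp
qed

text \<open>The premise \<open>sp\<close>, that no queued vertex is more than one step beyond
  \<open>u\<close>, keeps the queue sorted when \<open>y\<close> is appended at distance
  \<open>d u + 1\<close>.\<close>

lemma bfs_visit:
  assumes c: "bfs_core src d Q t" and h: "h < t" "u = Q h" and e: "{u, y} \<in> E"
    and y: "d y = inf_dist" and sp: "\<forall>i<t. d (Q i) \<le> d u + 1" and cl: "bfs_closed d Q t h"
  defines "d' \<equiv> d(y := d u + 1)" and "Q' \<equiv> Q(t := y)"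
  shows "bfs_core src d' Q' (Suc t)" "\<forall>i<Suc t. d' (Q' i) \<le> d' u + 1" "bfs_closed d' Q' (Suc t) h"
    "d' u = d u"
proof -
  have yn: "y < n" using e edge_vertices by blast
  then have yQ: "y \<notin> Q ` {..<t}" using c y by (auto simp: bfs_core_def)
  have old: "Q' i = Q i" "d' (Q i) = d (Q i)" if "i < t" for i
    using that yQ by (auto simp: Q'_def d'_def)
  have new: "Q' t = y" "d' y = d u + 1" by (auto simp: Q'_def d'_def)
  have img: "Q' ` {..<Suc t} = insert y (Q ` {..<t})"
    using old new by (auto simp: lessThan_Suc)
  show du: "d' u = d u" using old h by simp
  have hle: "d u \<le> h" and nu: "near (d u) src u" using c h by (auto simp: bfs_core_def)
  have tn: "t \<le> n" using bfs_core_le[OF c] .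
  \<comment> \<open>The new distance must differ from the mark for unvisited vertices.\<close>
  have lt: "d u + 1 < inf_dist" using hle h tn inf_dist_gt by linarith
  have "near 1 u y" using e edge_vertices near_1 by blast
  then have ny: "near (d u + 1) src y" using nu near_trans by blast
  have "inj_on Q' {..<Suc t}"
    unfolding lessThan_Suc
  proof (rule inj_on_insert[THEN iffD2], intro conjI)
    show "inj_on Q' {..<t}" using c old by (auto simp: bfs_core_def inj_on_def)
    show "Q' t \<notin> Q' ` ({..<t} - {t})" using yQ old new by auto
  qed
  moreover have "d' v \<noteq> inf_dist \<longleftrightarrow> v \<in> Q' ` {..<Suc t}" if "v < n" for v
    using c that lt unfolding img by (auto simp: d'_def bfs_core_def)
  moreover have "src \<in> Q' ` {..<Suc t}" "d' src = 0"
    using c yQ unfolding img by (auto simp: d'_def bfs_core_def)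
  moreover have "Q' i < n" "d' (Q' i) \<le> i" "near (d' (Q' i)) src (Q' i)" if "i < Suc t" for i
    using c that old[of i] new ny yn hle h by (auto simp: bfs_core_def less_Suc_eq)
  moreover have "d' (Q' i) \<le> d' (Q' j)" if "i \<le> j" "j < Suc t" for i j
    using c that old new sp by (cases "j = t"; cases "i = t") (auto simp: bfs_core_def less_Suc_eq)
  ultimately show "bfs_core src d' Q' (Suc t)" by (simp add: bfs_core_def)
  show "\<forall>i<Suc t. d' (Q' i) \<le> d' u + 1"
    using old new sp du by (auto simp: less_Suc_eq)
  show "bfs_closed d' Q' (Suc t) h" unfolding bfs_closed_def
  proof (intro allI impI)
    fix i z assume i: "i < h" and z: "{Q' i, z} \<in> E"
    have "z \<in> Q ` {..<t} \<and> d z \<le> d (Q i) + 1"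
      using cl i z old[of i] h by (auto simp: bfs_closed_def)
    then show "z \<in> Q' ` {..<Suc t} \<and> d' z \<le> d' (Q' i) + 1"
      using yQ old[of i] i h unfolding img by (auto simp: d'_def)
  qed
qed

lemma bfs_final:
  assumes c: "bfs_core src d Q t" and cl: "bfs_closed d Q t t" and v: "v < n" and x: "x < inf_dist"
  shows "d v \<le> x \<longleftrightarrow> near x src v"
proof -
  \<comment> \<open>Induction on the length of the walk: its last edge leaves a processed
    vertex.\<close>
  have *: "v \<in> Q ` {..<t} \<and> d v \<le> x" if "near x src v" for v x
    using that
  proof (induction x arbitrary: v)
    case 0
    then show ?case using c by (auto simp: near_0 bfs_core_def)
  next
    case (Suc x)
    then obtain z where z: "near x src z" "near 1 z v" using near_split[of x 1 src v] by auto
    then have IH: "z \<in> Q ` {..<t}" "d z \<le> x" using Suc.IH by auto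
    show ?case
    proof (cases "z = v")
      case False
      then have "{z, v} \<in> E" using z near_1 by blast
      then show ?thesis using cl IH by (fastforce simp: bfs_closed_def)
    qed (use IH in auto)
  qed
  show ?thesis
  proof
    assume le: "d v \<le> x"
    then have "v \<in> Q ` {..<t}" using c v x by (auto simp: bfs_core_def)
    then have "near (d v) src v" using c by (auto simp: bfs_core_def)
    then show "near x src v" using le near_mono by blast
  qed (use * in blast)
qed

abbreviation dist_row :: "nat \<Rightarrow> state \<Rightarrow> nat \<Rightarrow> nat" where
  "dist_row src s \<equiv> \<lambda>v. arr s ''D'' (src * n + v)"

definition bfs_env :: "nat \<Rightarrow> state \<Rightarrow> bool" where
  "bfs_env src s \<longleftrightarrow> src < n \<and> reg s ''o'' = src * n \<and> reg s ''F'' = inf_dist \<and> adj_ok s"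

lemma adj_ok_cong:
  "adj_ok s \<Longrightarrow> arr s' ''nx'' = arr s ''nx'' \<Longrightarrow> arr s' ''hd'' = arr s ''hd'' \<Longrightarrow> arr s' ''to'' = arr s ''to'' \<Longrightarrow>
    adj_ok s'"
  by (simp add: adj_ok_def)

lemma mod_scan [simp]: "mod_regs scan_prog = {''y'', ''t'', ''e''}" "mod_arrs scan_prog = {''D'', ''Q''}"
  by (auto simp: scan_prog_def)

lemma mod_queue [simp]:
  "mod_regs queue_prog = {''u'', ''h'', ''e'', ''y'', ''t''}" "mod_arrs queue_prog = {''D'', ''Q''}"
  by (auto simp: queue_prog_def)

text \<open>Each neighbour of \<open>u\<close> is in the queue or on the unread rest of its list, so
  \<open>u\<close> is closed when the rest is empty. The state \<open>s0\<close> records the queue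
  up to \<open>h\<close> and the rows of earlier sources, which a scan leaves alone.\<close>

definition scan_inv :: "nat \<Rightarrow> nat \<Rightarrow> nat \<Rightarrow> state \<Rightarrow> state \<Rightarrow> bool" where
  "scan_inv src h u s0 s \<longleftrightarrow> reg s ''e'' \<le> 2 * m \<and>
     bfs_core src (dist_row src s) (arr s ''Q'') (reg s ''t'') \<and>
     bfs_closed (dist_row src s) (arr s ''Q'') (reg s ''t'') h \<and>
     h < reg s ''t'' \<and> arr s ''Q'' h = u \<and> (\<forall>i\<le>h. arr s ''Q'' i = arr s0 ''Q'' i) \<and>
     (\<forall>i<reg s ''t''. dist_row src s (arr s ''Q'' i) \<le> dist_row src s u + 1) \<and>
     (\<forall>e \<in> set (chain (arr s ''nx'') (reg s ''e'')). {u, arr s ''to'' e} \<in> E) \<and>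
     (\<forall>y. {u, y} \<in> E \<longrightarrow> y \<in> arr s ''Q'' ` {..<reg s ''t''} \<or>
        y \<in> arr s ''to'' ` set (chain (arr s ''nx'') (reg s ''e''))) \<and>
     (\<forall>i<src * n. arr s ''D'' i = arr s0 ''D'' i)"

lemma triple_scan:
  assumes env: "bfs_env src s" "reg s ''u'' = u" and inv: "scan_inv src h u s0 s"
  shows "triple scan_prog s (7 * length (chain (arr s ''nx'') (reg s ''e'')) + 1)
    (\<lambda>s'. scan_inv src h u s0 s' \<and> reg s' ''e'' = 0)"
proof -
  let ?\<Phi> = "\<lambda>s. 7 * length (chain (arr s ''nx'') (reg s ''e''))"
  let ?P = "(Seq (Assign ''y'' (Cell ''to'' (Var ''e'')))
     (Seq (If (Equal (Cell ''D'' (Add (Var ''o'') (Var ''y''))) (Var ''F''))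
        (Seq (Store ''D'' (Add (Var ''o'') (Var ''y'')) (Add (Cell ''D'' (Add (Var ''o'') (Var ''u''))) (Lit 1)))
        (Seq (Store ''Q'' (Var ''t'') (Var ''y''))
          (Assign ''t'' (Add (Var ''t'') (Lit 1))))) Skip)
      (Assign ''e'' (Cell ''nx'' (Var ''e'')))))"
  show ?thesis unfolding scan_prog_def
  proof (rule triple_While[where I = "scan_inv src h u s0" and \<Phi> = ?\<Phi>])
    fix s' assume I: "scan_inv src h u s0 s'" and b: "bval (Less (Lit 0) (Var ''e'')) s'"
      and f: "framed ?P s s'" and bd: "bounded s'"
    define e where "e = reg s' ''e''"
    define y where "y = arr s' ''to'' e"
    define t where "t = reg s' ''t''"
    define nx where "nx = arr s' ''nx''"
    have c: "reg s' ''o'' = src * n" "reg s' ''F'' = inf_dist" "reg s' ''u'' = u" "src < n"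
      using env f by (simp_all add: bfs_env_def agree_off_reg)
    have adj: "adj_ok s'" by (rule adj_ok_cong[of s]) (use env f in \<open>simp_all add: bfs_env_def agree_off_arr\<close>)
    have e: "0 < e" "e \<le> 2 * m" using b I by (simp_all add: e_def scan_inv_def)
    then have nxe: "nx e < e" using adj by (simp add: adj_ok_def nx_def)
    have ch: "chain nx e = e # chain nx (nx e)" by (subst chain.simps) (simp add: nxe)
    have yE: "{u, y} \<in> E" using I ch by (simp add: scan_inv_def e_def nx_def y_def)
    have core: "bfs_core src (dist_row src s') (arr s' ''Q'') t" and cl: "bfs_closed (dist_row src s') (arr s' ''Q'') t h"
      and ht: "h < t" "u = arr s' ''Q'' h"
      and sp: "\<forall>i<t. dist_row src s' (arr s' ''Q'' i) \<le> dist_row src s' u + 1"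
      using I by (simp_all add: scan_inv_def t_def)
    have tn: "t \<le> n" using bfs_core_le[OF core] .
    have bds: "arr s' a i \<le> B" "reg s' x \<le> B" for a i x using boundedD[OF bd] by auto
    have du: "dist_row src s' u \<le> n" using core ht tn by (fastforce simp: bfs_core_def)
    have "triple ?P s' 6 (\<lambda>s''. scan_inv src h u s0 s'' \<and> reg s'' ''e'' = nx e \<and> arr s'' ''nx'' = nx)"
    proof (rule triple_Assign_Seq)
      let ?s = "set_reg ''y'' (aval (Cell ''to'' (Var ''e'')) s') s'"
      let ?Q = "\<lambda>s''. scan_inv src h u s0 (set_reg ''e'' (nx e) s'') \<and> reg s'' ''e'' = e \<and> arr s'' ''nx'' = nx"
      have "triple (If (Equal (Cell ''D'' (Add (Var ''o'') (Var ''y''))) (Var ''F''))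
        (Seq (Store ''D'' (Add (Var ''o'') (Var ''y'')) (Add (Cell ''D'' (Add (Var ''o'') (Var ''u''))) (Lit 1)))
        (Seq (Store ''Q'' (Var ''t'') (Var ''y''))
          (Assign ''t'' (Add (Var ''t'') (Lit 1))))) Skip) ?s 4 ?Q"
      proof (rule triple_If[where T = 3])
        assume "bval (Equal (Cell ''D'' (Add (Var ''o'') (Var ''y''))) (Var ''F'')) ?s"
        then have dy: "dist_row src s' y = inf_dist" using c by (simp add: y_def e_def)
        define s2 where "s2 = ?s\<lparr>arr := (arr ?s)(''D'' := (arr s' ''D'')(src * n + y := arr s' ''D'' (src * n + u) + 1),
             ''Q'' := (arr s' ''Q'')(t := y)), reg := (reg ?s)(''t'' := Suc t, ''e'' := nx e)\<rparr>"
        have row: "dist_row src s2 = (dist_row src s')(y := dist_row src s' u + 1)"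
          by (auto simp: s2_def)
        have Q: "arr s2 ''Q'' = (arr s' ''Q'')(t := y)" "reg s2 ''t'' = Suc t" by (auto simp: s2_def)
        note v = bfs_visit[OF core ht yE dy sp cl, folded row Q(1)]
        have img: "arr s2 ''Q'' ` {..<Suc t} = insert y (arr s' ''Q'' ` {..<t})"
          unfolding Q by (auto simp: lessThan_Suc)
        have "scan_inv src h u s0 s2" unfolding scan_inv_def Q(2)
        proof (intro conjI)
          show "\<forall>y'. {u, y'} \<in> E \<longrightarrow> y' \<in> arr s2 ''Q'' ` {..<Suc t} \<or>
            y' \<in> arr s2 ''to'' ` set (chain (arr s2 ''nx'') (reg s2 ''e''))"
            using I ch unfolding img by (auto simp: scan_inv_def s2_def e_def nx_def y_def t_def)
          show "\<forall>e\<in>set (chain (arr s2 ''nx'') (reg s2 ''e'')). {u, arr s2 ''to'' e} \<in> E"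
            using I ch by (simp add: scan_inv_def s2_def e_def nx_def)
          show "bfs_core src (dist_row src s2) (arr s2 ''Q'') (Suc t)" by (rule v(1))
          show "bfs_closed (dist_row src s2) (arr s2 ''Q'') (Suc t) h" by (rule v(3))
          show "\<forall>i<Suc t. dist_row src s2 (arr s2 ''Q'' i) \<le> dist_row src s2 u + 1" by (rule v(2))
          show "reg s2 ''e'' \<le> 2 * m" using e nxe by (simp add: s2_def)
          show "h < Suc t" "arr s2 ''Q'' h = u" using ht by (auto simp: Q)
          show "\<forall>i\<le>h. arr s2 ''Q'' i = arr s0 ''Q'' i" using I ht by (auto simp: Q scan_inv_def)
          show "\<forall>i<src * n. arr s2 ''D'' i = arr s0 ''D'' i" using I by (auto simp: s2_def scan_inv_def)
        qed
        then show "triple (Seq (Store ''D'' (Add (Var ''o'') (Var ''y'')) (Add (Cell ''D'' (Add (Var ''o'') (Var ''u''))) (Lit 1)))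
          (Seq (Store ''Q'' (Var ''t'') (Var ''y''))
          (Assign ''t'' (Add (Var ''t'') (Lit 1))))) ?s 3 ?Q"
          using c du tn bds small_le_B(1)[of "Suc (dist_row src s' u)"] small_le_B(1)[of "Suc t"]
          by (intro triple_Store_Seq triple_Assign)
             (auto simp: s2_def e_def nx_def y_def t_def fun_upd_twist)
      next
        assume nb: "\<not> bval (Equal (Cell ''D'' (Add (Var ''o'') (Var ''y''))) (Var ''F'')) ?s"
        then have dy: "dist_row src s' y \<noteq> inf_dist" using c by (simp add: y_def e_def)
        have "y < n" using yE edge_vertices by blast
        then have yQ: "y \<in> arr s' ''Q'' ` {..<t}" using core dy by (auto simp: bfs_core_def)
        have "scan_inv src h u s0 (set_reg ''e'' (nx e) ?s)"
          using I ch e nxe yQ by (auto simp: scan_inv_def e_def[symmetric] nx_def[symmetric] t_def[symmetric] y_def[symmetric])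
        then show "triple Skip ?s 3 ?Q" by (intro triple_Skip) (auto simp: e_def nx_def)
      qed simp
      then show "triple (Seq (If (Equal (Cell ''D'' (Add (Var ''o'') (Var ''y''))) (Var ''F''))
        (Seq (Store ''D'' (Add (Var ''o'') (Var ''y'')) (Add (Cell ''D'' (Add (Var ''o'') (Var ''u''))) (Lit 1)))
        (Seq (Store ''Q'' (Var ''t'') (Var ''y''))
          (Assign ''t'' (Add (Var ''t'') (Lit 1))))) Skip)
        (Assign ''e'' (Cell ''nx'' (Var ''e'')))) ?s (6 - 1)
        (\<lambda>s''. scan_inv src h u s0 s'' \<and> reg s'' ''e'' = nx e \<and> arr s'' ''nx'' = nx)"
      proof (rule triple_Seq_framed[where ?T2.0 = 1])
        fix s3 assume "?Q s3" "bounded s3"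
        then show "triple (Assign ''e'' (Cell ''nx'' (Var ''e''))) s3 1
          (\<lambda>s''. scan_inv src h u s0 s'' \<and> reg s'' ''e'' = nx e \<and> arr s'' ''nx'' = nx)"
          using bds(1)[of "''nx''" e] by (intro triple_Assign) (auto simp: nx_def)
      qed simp
    qed (use bds in auto)
    then have "triple ?P s' 6 (\<lambda>s''. scan_inv src h u s0 s'' \<and> 6 + 1 + ?\<Phi> s'' \<le> ?\<Phi> s')"
      by (rule triple_conseq) (auto simp: ch e_def[symmetric] nx_def[symmetric])
    then show "\<exists>T. triple ?P s' T (\<lambda>s''. scan_inv src h u s0 s'' \<and> T + 1 + ?\<Phi> s'' \<le> ?\<Phi> s')" by blast
  qed (use inv in auto)
qed

definition queue_inv :: "nat \<Rightarrow> state \<Rightarrow> state \<Rightarrow> bool" where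
  "queue_inv src s0 s \<longleftrightarrow> reg s ''h'' \<le> reg s ''t'' \<and>
     bfs_core src (dist_row src s) (arr s ''Q'') (reg s ''t'') \<and>
     bfs_closed (dist_row src s) (arr s ''Q'') (reg s ''t'') (reg s ''h'') \<and>
     (reg s ''h'' < reg s ''t'' \<longrightarrow> (\<forall>i<reg s ''t''. dist_row src s (arr s ''Q'' i) \<le>
        dist_row src s (arr s ''Q'' (reg s ''h'')) + 1)) \<and>
     (\<forall>i<src * n. arr s ''D'' i = arr s0 ''D'' i)"

text \<open>Every vertex not yet taken from the queue carries the cost of its future scan. The lists
  have total length \<open>2 * m\<close>, so the potential starts at
  \<open>5 * n + 14 * m\<close>.\<close>

definition queue_pot :: "state \<Rightarrow> nat" where
  "queue_pot s = (\<Sum>v \<in> {..<n} - arr s ''Q'' ` {..<reg s ''h''}.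
     5 + 7 * length (chain (arr s ''nx'') (arr s ''hd'' v)))"

lemma triple_queue:
  assumes env: "bfs_env src s" and inv: "queue_inv src s0 s"
  shows "triple queue_prog s (queue_pot s + 1)
    (\<lambda>s'. (\<forall>v<n. \<forall>x<inf_dist. dist_row src s' v \<le> x \<longleftrightarrow> near x src v) \<and> (\<forall>i<src * n. arr s' ''D'' i = arr s0 ''D'' i))"
  unfolding queue_prog_def
proof (rule triple_While[where I = "queue_inv src s0" and \<Phi> = queue_pot])
  let ?P = "(Seq (Assign ''u'' (Cell ''Q'' (Var ''h'')))
     (Seq (Assign ''h'' (Add (Var ''h'') (Lit 1)))
     (Seq (Assign ''e'' (Cell ''hd'' (Var ''u''))) scan_prog)))"
  fix s' assume I: "queue_inv src s0 s'" and b: "bval (Less (Var ''h'') (Var ''t'')) s'"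
    and f: "framed ?P s s'" and bd: "bounded s'"
  define h where "h = reg s' ''h''"
  define t where "t = reg s' ''t''"
  define u where "u = arr s' ''Q'' h"
  define nx where "nx = arr s' ''nx''"
  define len where "len = (\<lambda>v. length (chain nx (arr s' ''hd'' v)))"
  define s1 where "s1 = s'\<lparr>reg := (reg s')(''u'' := u, ''h'' := Suc h, ''e'' := arr s' ''hd'' u)\<rparr>"
  have c: "reg s' ''o'' = src * n" "reg s' ''F'' = inf_dist" "src < n"
    using env f by (simp_all add: bfs_env_def agree_off_reg)
  have adj: "adj_ok s'" by (rule adj_ok_cong[of s]) (use env f in \<open>simp_all add: bfs_env_def agree_off_arr\<close>)
  have bds: "arr s' a i \<le> B" "reg s' x \<le> B" for a i x using boundedD[OF bd] by auto
  have core: "bfs_core src (dist_row src s') (arr s' ''Q'') t" and ht: "h < t"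
    using I b by (auto simp: queue_inv_def h_def t_def)
  have tn: "t \<le> n" using bfs_core_le[OF core] .
  have un: "u < n" using core ht by (auto simp: bfs_core_def u_def)
  have env1: "bfs_env src s1" using c adj by (auto simp: bfs_env_def s1_def adj_ok_def)
  have nb: "arr s' ''to'' ` set (chain nx (arr s' ''hd'' u)) = {y. {u, y} \<in> E}"
    using adj un by (simp add: adj_ok_def nx_def)
  then have "\<forall>e\<in>set (chain nx (arr s' ''hd'' u)). {u, arr s' ''to'' e} \<in> E" by blast
  then have scan: "scan_inv src h u s' s1"
    using I ht adj nb unfolding scan_inv_def queue_inv_def
    by (simp add: s1_def h_def t_def u_def adj_ok_def nx_def)
  \<comment> \<open>The queue is injective, so \<open>u\<close> was not taken before and its own
    term pays for this round.\<close>
  have le: "7 * len u + 4 + 1 + (\<Sum>v\<in>{..<n} - arr s' ''Q'' ` {..<Suc h}. 5 + 7 * len v) \<le> queue_pot s'"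
  proof -
    have "inj_on (arr s' ''Q'') {..<t}" using core by (simp add: bfs_core_def)
    then have "arr s' ''Q'' x \<noteq> u" if "x < h" for x
      using that ht inj_onD[of "arr s' ''Q''" "{..<t}" x h] by (auto simp: u_def)
    then have "u \<notin> arr s' ''Q'' ` {..<h}" by blast
    then have "{..<n} - arr s' ''Q'' ` {..<h} = insert u ({..<n} - arr s' ''Q'' ` {..<Suc h})"
      using un by (auto simp: lessThan_Suc u_def)
    moreover have "u \<notin> {..<n} - arr s' ''Q'' ` {..<Suc h}" by (auto simp: u_def)
    ultimately show ?thesis by (simp add: queue_pot_def h_def[symmetric] len_def nx_def)
  qed
  have sc: "triple scan_prog s1 (7 * len u + 1)
      (\<lambda>s''. queue_inv src s0 s'' \<and> 7 * len u + 4 + 1 + queue_pot s'' \<le> queue_pot s')"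
  proof (rule triple_conseq[OF triple_scan[OF env1 _ scan]])
    fix s2 assume f2: "framed scan_prog s1 s2" and p: "scan_inv src h u s' s2 \<and> reg s2 ''e'' = 0"
    have h2: "reg s2 ''h'' = Suc h" using f2 by (simp add: agree_off_reg s1_def)
    have a2: "arr s2 ''nx'' = nx" "arr s2 ''hd'' = arr s' ''hd''"
      using f2 by (simp_all add: agree_off_arr s1_def nx_def)
    let ?d = "dist_row src s2" and ?Q = "arr s2 ''Q''" and ?t = "reg s2 ''t''"
    have core2: "bfs_core src ?d ?Q ?t" and cl2: "bfs_closed ?d ?Q ?t h" and ht2: "h < ?t" "?Q h = u"
      and sp2: "\<forall>i<?t. ?d (?Q i) \<le> ?d u + 1" and nb2: "\<forall>y. {u, y} \<in> E \<longrightarrow> y \<in> ?Q ` {..<?t}"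
      and same: "\<forall>i\<le>h. ?Q i = arr s' ''Q'' i" and D2: "\<forall>i<src * n. arr s2 ''D'' i = arr s' ''D'' i"
      using p by (auto simp: scan_inv_def)
    have "bfs_closed ?d ?Q ?t (Suc h)" unfolding bfs_closed_def
    proof (intro allI impI)
      fix i y assume i: "i < Suc h" and e: "{?Q i, y} \<in> E"
      show "y \<in> ?Q ` {..<?t} \<and> ?d y \<le> ?d (?Q i) + 1"
      proof (cases "i = h")
        case True
        then have "y \<in> ?Q ` {..<?t}" using e nb2 ht2 by simp
        then show ?thesis using sp2 True ht2 by auto
      next
        case False
        then have "i < h" using i by simp
        then show ?thesis using cl2 e unfolding bfs_closed_def by blast
      qed
    qed
    \<comment> \<open>The next vertex is no closer to the source than \<open>u\<close>, so the bound
      \<open>sp2\<close> carries over to it.\<close>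
    moreover have "?d (?Q i) \<le> ?d (?Q (Suc h)) + 1" if "Suc h < ?t" "i < ?t" for i
    proof -
      have "?d (?Q h) \<le> ?d (?Q (Suc h))" using core2 that(1) by (simp add: bfs_core_def)
      then show ?thesis using sp2 that(2) ht2 by fastforce
    qed
    ultimately have "queue_inv src s0 s2" using core2 ht2 D2 I by (simp add: queue_inv_def h2)
    moreover have "?Q ` {..<Suc h} = arr s' ''Q'' ` {..<Suc h}" using same by (intro image_cong) auto
    then have "queue_pot s2 = (\<Sum>v\<in>{..<n} - arr s' ''Q'' ` {..<Suc h}. 5 + 7 * len v)"
      unfolding queue_pot_def h2 a2 len_def by simp
    ultimately show "queue_inv src s0 s2 \<and> 7 * len u + 4 + 1 + queue_pot s2 \<le> queue_pot s'" using le by simp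
  qed (auto simp: s1_def len_def nx_def)
  have "triple ?P s' (7 * len u + 4) (\<lambda>s''. queue_inv src s0 s'' \<and> 7 * len u + 4 + 1 + queue_pot s'' \<le> queue_pot s')"
    using bds(1)[of "''Q''" h] bds(1)[of "''hd''" u] small_le_B(1)[of "Suc h"] ht tn
    by (intro triple_Assign_Seq)
       (use sc in \<open>auto simp: s1_def h_def[symmetric] u_def[symmetric]\<close>)
  then show "\<exists>T. triple ?P s' T (\<lambda>s''. queue_inv src s0 s'' \<and> T + 1 + queue_pot s'' \<le> queue_pot s')" by blast
next
  fix s' assume I: "queue_inv src s0 s'" and b: "\<not> bval (Less (Var ''h'') (Var ''t'')) s'"
  then have "reg s' ''h'' = reg s' ''t''" by (simp add: queue_inv_def)
  then show "(\<forall>v<n. \<forall>x<inf_dist. dist_row src s' v \<le> x \<longleftrightarrow> near x src v) \<and> (\<forall>i<src * n. arr s' ''D'' i = arr s0 ''D'' i)"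
    using I bfs_final[of src "dist_row src s'" "arr s' ''Q''" "reg s' ''t''"] by (simp add: queue_inv_def)
qed (use inv in auto)

lemma mod_bfs [simp]:
  "mod_regs bfs_prog = {''o'', ''v'', ''u'', ''h'', ''e'', ''y'', ''t''}" "mod_arrs bfs_prog = {''D'', ''Q''}"
  by (auto simp: bfs_prog_def)

text \<open>Sources are handled in increasing order, so it is enough to preserve the cells below
  \<open>src * n\<close>, which hold the earlier rows.\<close>

lemma triple_bfs:
  assumes n: "reg s ''n'' = n" and src: "reg s ''s'' = src" "src < n" and F: "reg s ''F'' = inf_dist"
    and O: "\<forall>v<n. arr s ''O'' v = v * n" and adj: "adj_ok s"
  shows "triple bfs_prog s (8 * n + 14 * m + 9)
    (\<lambda>s'. (\<forall>v<n. \<forall>x<inf_dist. dist_row src s' v \<le> x \<longleftrightarrow> near x src v) \<and> (\<forall>i<src * n. arr s' ''D'' i = arr s ''D'' i))"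
    (is "triple _ _ _ ?Q")
  unfolding bfs_prog_def
proof (rule triple_Assign_Seq)
  let ?s1 = "set_reg ''o'' (aval (Cell ''O'' (Var ''s'')) s) s"
  let ?init = "For ''v'' ''n'' (Store ''D'' (Add (Var ''o'') (Var ''v'')) (Var ''F''))"
  have "(src + 1) * n \<le> n * n" using src by (intro mult_le_mono1) simp
  then have "src * n + n \<le> B" by (intro small_le_B(2)) simp
  then show "aval (Cell ''O'' (Var ''s'')) s \<le> B" using src O by simp
  let ?R = "\<lambda>s'. (\<forall>v<n. arr s' ''D'' (src * n + v) = inf_dist) \<and> (\<forall>i<src * n. arr s' ''D'' i = arr s ''D'' i)"
  have FB: "inf_dist \<le> B" using inf_dist_le by (intro small_le_B(1)) simp
  have init: "triple ?init ?s1 (3 * n + 2) ?R"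
  proof (rule triple_For[where I = "\<lambda>i s'. (\<forall>v<i. arr s' ''D'' (src * n + v) = inf_dist) \<and>
        (\<forall>i<src * n. arr s' ''D'' i = arr s ''D'' i)" and T = "\<lambda>_. 1"])
    fix i s' assume i: "i < n" "reg s' ''v'' = i" "framed ?init ?s1 s'"
      and I: "(\<forall>v<i. arr s' ''D'' (src * n + v) = inf_dist) \<and> (\<forall>i<src * n. arr s' ''D'' i = arr s ''D'' i)"
    have "reg s' ''o'' = src * n" "reg s' ''F'' = inf_dist"
      using i(3) src O F by (simp_all add: agree_off_reg)
    then show "triple (Store ''D'' (Add (Var ''o'') (Var ''v'')) (Var ''F'')) s' 1
      (\<lambda>s''. (\<forall>v<Suc i. arr (set_reg ''v'' (Suc i) s'') ''D'' (src * n + v) = inf_dist) \<and>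
          (\<forall>ia<src * n. arr (set_reg ''v'' (Suc i) s'') ''D'' ia = arr s ''D'' ia))"
      using I i FB by (intro triple_Store) (auto simp: less_Suc_eq)
  qed (use n in auto)
  show "triple (Seq ?init (Seq (Store ''D'' (Add (Var ''o'') (Var ''s'')) (Lit 0))
     (Seq (Store ''Q'' (Lit 0) (Var ''s'')) (Seq (Assign ''h'' (Lit 0))
     (Seq (Assign ''t'' (Lit 1)) queue_prog))))) ?s1 (8 * n + 14 * m + 9 - 1) ?Q"
  proof (rule triple_Seq_framed[OF init])
    fix s2 assume f: "framed ?init ?s1 s2" and R: "?R s2" and bd: "bounded s2"
    define s3 where "s3 = s2\<lparr>arr := (arr s2)(''D'' := (arr s2 ''D'')(src * n + src := 0),
      ''Q'' := (arr s2 ''Q'')(0 := src)), reg := (reg s2)(''h'' := 0, ''t'' := 1)\<rparr>"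
    have r: "reg s2 ''o'' = src * n" "reg s2 ''s'' = src" "reg s2 ''F'' = inf_dist"
      using f src O F by (simp_all add: agree_off_reg)
    have adj2: "adj_ok s2" by (rule adj_ok_cong[OF adj]) (use f in \<open>simp_all add: agree_off_arr\<close>)
    have env: "bfs_env src s3" using r adj2 src by (auto simp: bfs_env_def s3_def adj_ok_def)
    have inv: "queue_inv src s s3"
      using R src inf_dist_gt
      by (auto simp: queue_inv_def s3_def bfs_core_def bfs_closed_def near_refl inj_on_def)
    have pot: "queue_pot s3 = 5 * n + 14 * m"
    proof -
      have "queue_pot s3 = (\<Sum>v<n. 5 + 7 * length (chain (arr s2 ''nx'') (arr s2 ''hd'' v)))"
        by (simp add: queue_pot_def s3_def)
      also have "\<dots> = 5 * n + 7 * (\<Sum>v<n. length (chain (arr s2 ''nx'') (arr s2 ''hd'' v)))"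
        by (simp only: sum.distrib sum_distrib_left) simp
      also have "\<dots> = 5 * n + 14 * m" using adj2 by (simp add: adj_ok_def)
      finally show ?thesis .
    qed
    have sl: "src \<le> B" using src by (intro small_le_B(1)) simp
    have "triple queue_prog s3 (5 * n + 14 * m + 1) ?Q"
      using triple_queue[OF env inv] pot by simp
    then show "triple (Seq (Store ''D'' (Add (Var ''o'') (Var ''s'')) (Lit 0))
     (Seq (Store ''Q'' (Lit 0) (Var ''s'')) (Seq (Assign ''h'' (Lit 0))
     (Seq (Assign ''t'' (Lit 1)) queue_prog)))) s2 (5 * n + 14 * m + 5) ?Q"
      using r B_pos sl by (intro triple_Store_Seq triple_Assign_Seq) (auto simp: s3_def)
  qed simp
qed simp

text \<open>The matrix is specified through comparisons with thresholds below
  \<open>inf_dist\<close>, which is all that the later programs do with it.\<close>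

definition dist_ok :: "state \<Rightarrow> bool" where
  "dist_ok s \<longleftrightarrow> reg s ''n'' = n \<and> reg s ''p'' = 2 ^ L \<and> half_ok (arr s ''half'') \<and>
     (\<forall>v<n. arr s ''O'' v = v * n) \<and>
     (\<forall>u<n. \<forall>v<n. \<forall>x<inf_dist. arr s ''D'' (u * n + v) \<le> x \<longleftrightarrow> near x u v)"

lemma mod_powers [simp]: "mod_regs powers_prog = {''p''}" "mod_arrs powers_prog = {''half''}"
  by (auto simp: powers_prog_def)

lemma mod_distances [simp]:
  "mod_regs distances_prog = {''p'', ''F'', ''x'', ''v'', ''c'', ''i'', ''s'', ''o'', ''u'', ''h'', ''e'', ''y'', ''t''}"
  "mod_arrs distances_prog = {''half'', ''O'', ''to'', ''nx'', ''hd'', ''D'', ''Q''}"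
  by (auto simp: distances_prog_def)

lemma triple_distances:
  assumes s: "reg s ''n'' = n" "reg s ''m'' = m" "arr s ''half'' 1 = 0" "arr s ''nx'' = (\<lambda>_. 0)" "arr s ''hd'' = (\<lambda>_. 0)"
    and sd: "\<forall>i<m. arr s ''src'' i = fst (es ! i) \<and> arr s ''dst'' i = snd (es ! i)"
  shows "triple distances_prog s (14 + 12 * n + 10 * m + n * (8 * n + 14 * m + 9)) dist_ok"
proof -
  let ?F = "Assign ''F'' (Add (Add (Add (Var ''p'') (Var ''p'')) (Add (Var ''p'') (Var ''p''))) (Lit 1))"
  have bfs: "triple (For ''s'' ''n'' bfs_prog) s3 (2 + 2 * n + n * (8 * n + 14 * m + 9)) dist_ok"
    if p: "reg s3 ''n'' = n" "reg s3 ''p'' = 2 ^ L" "half_ok (arr s3 ''half'')" "reg s3 ''F'' = inf_dist"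
      "\<forall>v<n. arr s3 ''O'' v = v * n" "adj_ok s3" for s3
  proof (rule triple_For[where I = "\<lambda>i s'. \<forall>u<i. \<forall>v<n. \<forall>x<inf_dist. arr s' ''D'' (u * n + v) \<le> x \<longleftrightarrow> near x u v"
        and T = "\<lambda>_. 8 * n + 14 * m + 9"])
    fix i s' assume i: "i < n" "reg s' ''s'' = i" "framed (For ''s'' ''n'' bfs_prog) s3 s'"
      and I: "\<forall>u<i. \<forall>v<n. \<forall>x<inf_dist. arr s' ''D'' (u * n + v) \<le> x \<longleftrightarrow> near x u v"
    have a: "adj_ok s'" by (rule adj_ok_cong[OF p(6)]) (use i(3) in \<open>simp_all add: agree_off_arr\<close>)
    have idx: "u * n + v < i * n" if "u < i" "v < n" for u v
    proof -
      have "(u + 1) * n \<le> i * n" using that by (intro mult_le_mono1) simp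
      then show ?thesis using that by simp
    qed
    show "triple bfs_prog s' (8 * n + 14 * m + 9)
      (\<lambda>s''. \<forall>u<Suc i. \<forall>v<n. \<forall>x<inf_dist. arr (set_reg ''s'' (Suc i) s'') ''D'' (u * n + v) \<le> x \<longleftrightarrow> near x u v)"
      using i p a I idx by (intro triple_conseq[OF triple_bfs[where src = i]])
        (auto simp: agree_off_reg agree_off_arr less_Suc_eq)
  next
    fix s' assume f: "framed (For ''s'' ''n'' bfs_prog) s3 s'"
      and I: "\<forall>u<n. \<forall>v<n. \<forall>x<inf_dist. arr s' ''D'' (u * n + v) \<le> x \<longleftrightarrow> near x u v"
    then show "dist_ok s'" using p by (simp add: dist_ok_def agree_off_reg agree_off_arr)
  qed (use p in auto)
  have FB: "inf_dist \<le> B" using inf_dist_le by (intro small_le_B(1)) simp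
  show ?thesis unfolding distances_prog_def
  proof (rule triple_Seq_framed[OF triple_powers[OF s(1,3)]])
    fix s1 assume f1: "framed powers_prog s s1" and p1: "reg s1 ''p'' = 2 ^ L \<and> half_ok (arr s1 ''half'')"
    show "triple (Seq ?F (Seq rows_prog (Seq adjacency_prog (For ''s'' ''n'' bfs_prog)))) s1
      (1 + ((4 * n + 3) + ((10 * m + 3) + (2 + 2 * n + n * (8 * n + 14 * m + 9))))) dist_ok"
    proof (rule triple_Assign_Seq)
      let ?s2 = "set_reg ''F'' (aval (Add (Add (Add (Var ''p'') (Var ''p'')) (Add (Var ''p'') (Var ''p''))) (Lit 1)) s1) s1"
      have F: "reg ?s2 ''F'' = inf_dist" using p1 by (simp add: inf_dist_def)
      show "triple (Seq rows_prog (Seq adjacency_prog (For ''s'' ''n'' bfs_prog))) ?s2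
        (1 + ((4 * n + 3) + ((10 * m + 3) + (2 + 2 * n + n * (8 * n + 14 * m + 9)))) - 1) dist_ok"
      proof (rule triple_Seq_framed[OF triple_rows])
        show "reg ?s2 ''n'' = n" using f1 s by (simp add: agree_off_reg)
        fix s3 assume f3: "framed rows_prog ?s2 s3" and p3: "\<forall>v<n. arr s3 ''O'' v = v * n"
        show "triple (Seq adjacency_prog (For ''s'' ''n'' bfs_prog)) s3
          ((10 * m + 3) + (2 + 2 * n + n * (8 * n + 14 * m + 9))) dist_ok"
        proof (rule triple_Seq_framed[OF triple_adjacency])
          fix s4 assume f4: "framed adjacency_prog s3 s4" and p4: "adj_ok s4"
          show "triple (For ''s'' ''n'' bfs_prog) s4 (2 + 2 * n + n * (8 * n + 14 * m + 9)) dist_ok"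
            using f1 f3 f4 p1 p3 p4 s F by (intro bfs) (simp_all add: agree_off_reg agree_off_arr)
        qed (use f1 f3 s sd in \<open>simp_all add: agree_off_reg agree_off_arr\<close>)
      qed simp
    qed (use p1 FB in \<open>auto simp: inf_dist_def\<close>)
  qed simp
qed

end

section \<open>Greedy hitting sets\<close>

text \<open>Multiplication by a constant of the program, unfolded into additions.\<close>

fun times_exp :: "nat \<Rightarrow> aexp \<Rightarrow> aexp" where
  "times_exp 0 e = Lit 0"
| "times_exp (Suc c) e = Add e (times_exp c e)"

lemma aval_times_exp [simp]: "aval (times_exp c e) s = c * aval e s"
  by (induction c) auto

definition near_test :: "string \<Rightarrow> aexp \<Rightarrow> aexp \<Rightarrow> bexp" where
  "near_test x y g = Less (Cell ''D'' (Add (Cell ''O'' (Var x)) y)) (Add g (Lit 1))"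

definition gap_exp :: "nat \<Rightarrow> aexp" where
  "gap_exp r = times_exp (2 * r - 1) (Var ''b'')"

definition count_prog :: "string \<Rightarrow> bexp \<Rightarrow> com" where
  "count_prog x c = Seq (Assign ''cnt'' (Lit 0))
     (For x ''n'' (If c (Assign ''cnt'' (Add (Var ''cnt'') (Lit 1))) Skip))"

text \<open>Each level has its own array, and the length of the name encodes the level. The explicit
  first letter lets the simplifier tell it from other names.\<close>

abbreviation sample_name :: "nat \<Rightarrow> string" where
  "sample_name r \<equiv> CHR ''S'' # replicate r (CHR ''S'')"

abbreviation far_name :: "nat \<Rightarrow> string" where
  "far_name r \<equiv> CHR ''f'' # replicate r (CHR ''f'')"

text \<open>A power of two close to \<open>n\<close> to the power \<open>e / d\<close>: the first
  loop collects \<open>e * L\<close>, the second adds \<open>d\<close> per doubling of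
  \<open>N\<close> until it gets there.\<close>

definition size_prog :: "nat \<Rightarrow> nat \<Rightarrow> com" where
  "size_prog e d = Seq (Assign ''x'' (Lit 1)) (Seq (Assign ''t'' (Lit 0))
     (Seq (While (Less (Var ''x'') (Var ''n''))
        (Seq (Assign ''x'' (Add (Var ''x'') (Var ''x''))) (Assign ''t'' (Add (Var ''t'') (Lit e)))))
     (Seq (Assign ''N'' (Lit 1)) (Seq (Assign ''y'' (Lit 0))
     (While (Less (Var ''y'') (Var ''t''))
        (Seq (Assign ''N'' (Add (Var ''N'') (Var ''N''))) (Assign ''y'' (Add (Var ''y'') (Lit d)))))))))"

definition heavy_prog :: "nat \<Rightarrow> com" where
  "heavy_prog r = For ''v'' ''n'' (Seq (count_prog ''w'' (near_test ''v'' (Var ''w'') (gap_exp r)))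
     (Seq (If (Less (Var ''cnt'') (Var ''N'')) (Store ''hv'' (Var ''v'') (Lit 0)) (Store ''hv'' (Var ''v'') (Lit 1)))
     (Seq (Store (far_name r) (Var ''v'') (Lit 1)) (Store (sample_name r) (Var ''v'') (Lit 0)))))"

definition clear_prog :: "nat \<Rightarrow> com" where
  "clear_prog r = For ''v'' ''n'' (If (near_test ''v'' (Var ''x'') (gap_exp r))
     (Store (far_name r) (Var ''v'') (Lit 0)) Skip)"

definition unhit_test :: "nat \<Rightarrow> bexp" where
  "unhit_test r = Conj (Less (Lit 0) (Cell ''hv'' (Var ''v'')))
     (Conj (Less (Lit 0) (Cell (far_name r) (Var ''v''))) (near_test ''v'' (Var ''x'') (gap_exp r)))"

text \<open>Greedy selection should take a vertex close to the most unhit heavy vertices, but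
  finding it anew for every pick would cost too much. A pass takes every vertex that reaches the
  threshold \<open>T\<close>, and \<open>T\<close> is halved between passes: this loses a factor 2,
  and \<open>L + 1\<close> passes of quadratic cost suffice.\<close>

definition pass_prog :: "nat \<Rightarrow> com" where
  "pass_prog r = For ''x'' ''n'' (Seq (count_prog ''v'' (unhit_test r))
     (If (Less (Var ''cnt'') (Var ''T'')) Skip
       (Seq (Store (sample_name r) (Var ''x'') (Lit 1)) (clear_prog r))))"

text \<open>Vertex 0 is added at the end so that the sample is never empty.\<close>

definition sample_prog :: "nat \<Rightarrow> nat \<Rightarrow> nat \<Rightarrow> com" where
  "sample_prog e d r = Seq (size_prog e d) (Seq (heavy_prog r)
     (Seq (Assign ''T'' (Var ''p''))
     (Seq (While (Less (Lit 0) (Var ''T'')) (Seq (pass_prog r) (Assign ''T'' (Cell ''half'' (Var ''T'')))))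
       (Store (sample_name r) (Lit 0) (Lit 1)))))"

lemma mod_count [simp]: "mod_regs (count_prog x c) = {''cnt'', x}" "mod_arrs (count_prog x c) = {}"
  by (auto simp: count_prog_def)

lemma mod_size [simp]: "mod_regs (size_prog e d) = {''x'', ''t'', ''N'', ''y''}" "mod_arrs (size_prog e d) = {}"
  by (auto simp: size_prog_def)

lemma mod_heavy [simp]: "mod_regs (heavy_prog r) = {''v'', ''cnt'', ''w''}"
  "mod_arrs (heavy_prog r) = {''hv'', far_name r, sample_name r}"
  by (auto simp: heavy_prog_def)

lemma mod_clear [simp]: "mod_regs (clear_prog r) = {''v''}" "mod_arrs (clear_prog r) = {far_name r}"
  by (auto simp: clear_prog_def)

lemma mod_pass [simp]: "mod_regs (pass_prog r) = {''x'', ''cnt'', ''v''}"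
  "mod_arrs (pass_prog r) = {far_name r, sample_name r}"
  by (auto simp: pass_prog_def)

lemma mod_sample [simp]: "mod_regs (sample_prog e d r) = {''x'', ''t'', ''N'', ''y'', ''v'', ''cnt'', ''w'', ''T''}"
  "mod_arrs (sample_prog e d r) = {''hv'', far_name r, sample_name r}"
  by (auto simp: sample_prog_def)

lemma floorlog_two_power: "floorlog 2 (2 ^ a) = Suc a"
proof -
  have "floorlog 2 (1 * 2 ^ a) = floorlog 2 1 + a" by (rule floorlog_power) auto
  moreover have "floorlog 2 1 = 1" by (simp add: floorlog_def)
  ultimately show ?thesis by simp
qed

context instance_machine begin

lemma dist_ok_cong:
  assumes "dist_ok s" "agree_off X A s s'" "''n'' \<notin> X" "''p'' \<notin> X" "''half'' \<notin> A" "''O'' \<notin> A" "''D'' \<notin> A"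
  shows "dist_ok s'"
  using assms by (simp add: dist_ok_def agree_off_reg agree_off_arr)

lemma near_test:
  assumes "dist_ok s" "reg s x = u" "u < n" "aval y s = v" "v < n" "aval g s < inf_dist"
  shows "bval (near_test x y g) s \<longleftrightarrow> near (aval g s) u v"
  using assms by (auto simp: near_test_def dist_ok_def less_Suc_eq_le)

lemma triple_count:
  assumes n: "reg s ''n'' = n" and x: "x \<noteq> ''cnt''" "x \<noteq> ''n''"
    and c: "\<And>s' i. i < n \<Longrightarrow> reg s' x = i \<Longrightarrow> agree_off {''cnt'', x} {} s s' \<Longrightarrow> bval c s' \<longleftrightarrow> P i"
  shows "triple (count_prog x c) s (4 * n + 3) (\<lambda>s'. reg s' ''cnt'' = card {i. i < n \<and> P i})"
  unfolding count_prog_def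
proof (rule triple_Assign_Seq)
  let ?s = "set_reg ''cnt'' (aval (Lit 0) s) s"
  let ?P = "If c (Assign ''cnt'' (Add (Var ''cnt'') (Lit 1))) Skip"
  show "triple (For x ''n'' ?P) ?s (4 * n + 3 - 1) (\<lambda>s'. reg s' ''cnt'' = card {i. i < n \<and> P i})"
  proof (rule triple_For[where I = "\<lambda>i s'. reg s' ''cnt'' = card {j. j < i \<and> P j}" and T = "\<lambda>_. 2"])
    fix i s' assume i: "i < n" "reg s' x = i" "framed (For x ''n'' ?P) ?s s'"
      and I: "reg s' ''cnt'' = card {j. j < i \<and> P j}"
    have b: "bval c s' \<longleftrightarrow> P i"
      using i by (intro c) (auto simp: agree_off_def)
    have "card {j. j < i \<and> P j} \<le> card {..<i}" by (intro card_mono) auto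
    then have le: "Suc (card {j. j < i \<and> P j}) \<le> B" using i by (intro small_le_B(1)) simp
    have "{j. j < Suc i \<and> P j} = (if P i then insert i {j. j < i \<and> P j} else {j. j < i \<and> P j})"
      by (auto simp: less_Suc_eq)
    then have cd: "card {j. j < Suc i \<and> P j} = (if P i then Suc (card {j. j < i \<and> P j}) else card {j. j < i \<and> P j})"
      by simp
    show "triple ?P s' 2 (\<lambda>s''. reg (set_reg x (Suc i) s'') ''cnt'' = card {j. j < Suc i \<and> P j})"
      using b le I x cd by (intro triple_If[where T = 1] triple_Assign triple_Skip) auto
  qed (use n x in auto)
qed auto

text \<open>The ceiling of \<open>e * L / d\<close>, in the form in which the loop of
  \<open>size_prog\<close> finds it. For \<open>e = d = 0\<close>, which occurs at level 0 if
  \<open>k = l\<close>, it is 0.\<close>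

definition size_exp :: "nat \<Rightarrow> nat \<Rightarrow> nat" where
  "size_exp e d = (LEAST i. e * L \<le> d * i)"

lemma L_le: "L \<le> 2 * n"
  using L_less less_exp[of L] by linarith

lemma size_exp_le: "e \<le> d \<Longrightarrow> size_exp e d \<le> L"
  unfolding size_exp_def by (rule Least_le) simp

lemma size_exp_ge: "e \<le> d \<Longrightarrow> e * L \<le> d * size_exp e d"
  unfolding size_exp_def by (rule LeastI[of _ L]) simp

lemma less_size_exp: "i < size_exp e d \<Longrightarrow> d * i < e * L"
  unfolding size_exp_def by (drule not_less_Least) simp

lemma triple_size:
  assumes n: "reg s ''n'' = n" and ed: "e \<le> d" "d \<le> 2 * (k + 1) * (k + 1)"
  shows "triple (size_prog e d) s (12 * n + 8) (\<lambda>s'. reg s' ''N'' = 2 ^ size_exp e d)"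
proof -
  have Bn: "2 * n \<le> B" by (intro small_le_B) simp
  have dB: "d * i + d \<le> B" if "i \<le> L" for i
  proof -
    have "d * i + d \<le> (2 * (k + 1) * (k + 1)) * (i + 1)" using ed mult_le_mono1[of d "2 * (k + 1) * (k + 1)" "i + 1"] by simp
    also have "\<dots> \<le> (2 * (k + 1) * (k + 1)) * (2 * (n + 1))" using that L_le by (intro mult_le_mono2) simp
    also have "\<dots> \<le> 100 * (k + 1) * (k + 1) * (n + 1)"
    proof -
      have "(2 * x * x) * (2 * y) \<le> 100 * x * x * y" for x y :: nat by (simp add: algebra_simps)
      then show ?thesis .
    qed
    finally show ?thesis using B_large(2) by linarith
  qed
  have eB: "e * i + e \<le> B" if "i \<le> L" for i
  proof -
    have "e * i + e \<le> d * i + d" using ed by (intro add_mono mult_le_mono1)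
    then show ?thesis using dB[OF that] by linarith
  qed
  let ?P = "Seq (Assign ''x'' (Add (Var ''x'') (Var ''x''))) (Assign ''t'' (Add (Var ''t'') (Lit e)))"
  let ?I = "\<lambda>s. reg s ''n'' = n \<and> (\<exists>i\<le>L. reg s ''x'' = 2 ^ i \<and> reg s ''t'' = e * i)"
  have w1: "triple (While (Less (Var ''x'') (Var ''n'')) ?P) s1 (6 * n + 1) (\<lambda>s'. reg s' ''t'' = e * L)"
    if s1: "?I s1" for s1
  proof (rule triple_While[where I = ?I and \<Phi> = "\<lambda>s. 3 * (2 * n - reg s ''x'')"])
    fix s' assume I: "?I s'" and b: "bval (Less (Var ''x'') (Var ''n'')) s'"
    then obtain i where i: "i \<le> L" "reg s' ''x'' = 2 ^ i" "reg s' ''t'' = e * i" by auto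
    have lt: "2 ^ i < n" using b I i by simp
    have iL: "i < L" using lt L_ge i(1) by (metis le_neq_implies_less not_le)
    have "(1::nat) \<le> 2 ^ i" by simp
    then have pot: "3 + 3 * (2 * n - (2 ^ i + 2 ^ i)) \<le> 3 * (2 * n - 2 ^ i)" using lt by arith
    have I': "?I (set_reg ''t'' (e * i + e) (set_reg ''x'' (2 ^ i + 2 ^ i) s'))"
      using I iL by (auto intro!: exI[of _ "Suc i"])
    show "\<exists>T. triple ?P s' T (\<lambda>s''. ?I s'' \<and> T + 1 + 3 * (2 * n - reg s'' ''x'') \<le> 3 * (2 * n - reg s' ''x''))"
      using I' Bn lt i(2,3) eB[of i] iL pot
      by (intro exI[of _ 2] triple_Assign_Seq triple_Assign) simp_all
  next
    fix s' assume I: "?I s'" and b: "\<not> bval (Less (Var ''x'') (Var ''n'')) s'"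
    then obtain i where i: "i \<le> L" "reg s' ''x'' = 2 ^ i" "reg s' ''t'' = e * i" by auto
    then have "i = L" using b I less_L[of i] by (auto simp: le_less)
    then show "reg s' ''t'' = e * L" using i by simp
  qed (use s1 in auto)
  let ?P2 = "Seq (Assign ''N'' (Add (Var ''N'') (Var ''N''))) (Assign ''y'' (Add (Var ''y'') (Lit d)))"
  let ?z = "size_exp e d"
  let ?J = "\<lambda>s. reg s ''t'' = e * L \<and> (\<exists>i\<le>?z. reg s ''N'' = 2 ^ i \<and> reg s ''y'' = d * i)"
  have zL: "?z \<le> L" using size_exp_le ed by simp
  then have "(2::nat) ^ ?z \<le> 2 ^ L" by (intro power_increasing) auto
  then have zn: "2 ^ ?z \<le> 2 * n" using L_less by linarith
  have w2: "triple (While (Less (Var ''y'') (Var ''t'')) ?P2) s1 (6 * n + 1) (\<lambda>s'. reg s' ''N'' = 2 ^ ?z)"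
    if s1: "?J s1" for s1
  proof (rule triple_While[where I = ?J and \<Phi> = "\<lambda>s. 3 * (2 ^ ?z - reg s ''N'')"])
    fix s' assume I: "?J s'" and b: "bval (Less (Var ''y'') (Var ''t'')) s'"
    then obtain i where i: "i \<le> ?z" "reg s' ''N'' = 2 ^ i" "reg s' ''y'' = d * i" by auto
    have lt: "d * i < e * L" using b I i by simp
    have iz: "i < ?z" using lt size_exp_ge[OF ed(1)] i(1) by (metis le_neq_implies_less not_le)
    then have le: "2 ^ Suc i \<le> (2::nat) ^ ?z" by (intro power_increasing) auto
    have "1 \<le> x \<Longrightarrow> 2 * x \<le> y \<Longrightarrow> 3 + 3 * (y - (x + x)) \<le> 3 * (y - x)" for x y :: nat by arith
    from this[of "2 ^ i" "2 ^ ?z"]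
    have pot: "(3::nat) + 3 * (2 ^ ?z - (2 ^ i + 2 ^ i)) \<le> 3 * (2 ^ ?z - 2 ^ i)" using le by simp
    have I': "?J (set_reg ''y'' (d * i + d) (set_reg ''N'' (2 ^ i + 2 ^ i) s'))"
      using I iz by (auto intro!: exI[of _ "Suc i"])
    show "\<exists>T. triple ?P2 s' T (\<lambda>s''. ?J s'' \<and> T + 1 + 3 * (2 ^ ?z - reg s'' ''N'') \<le> 3 * (2 ^ ?z - reg s' ''N''))"
      using I' Bn le zn i(2,3) dB[of i] iz zL pot
      by (intro exI[of _ 2] triple_Assign_Seq triple_Assign) simp_all
  next
    fix s' assume I: "?J s'" and b: "\<not> bval (Less (Var ''y'') (Var ''t'')) s'"
    then obtain i where i: "i \<le> ?z" "reg s' ''N'' = 2 ^ i" "reg s' ''y'' = d * i" by auto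
    then have "i = ?z" using b I less_size_exp[of i e d] by (auto simp: le_less)
    then show "reg s' ''N'' = 2 ^ ?z" using i by simp
  next
    show "3 * (2 ^ ?z - reg s1 ''N'') + 1 \<le> 6 * n + 1" using zn by simp
  qed (use s1 in auto)
  show ?thesis unfolding size_prog_def
  proof (intro triple_Assign_Seq)
    let ?s = "set_reg ''t'' (aval (Lit 0) (set_reg ''x'' (aval (Lit 1) s) s)) (set_reg ''x'' (aval (Lit 1) s) s)"
    show "triple (Seq (While (Less (Var ''x'') (Var ''n'')) ?P)
     (Seq (Assign ''N'' (Lit 1)) (Seq (Assign ''y'' (Lit 0)) (While (Less (Var ''y'') (Var ''t'')) ?P2))))
      ?s (12 * n + 8 - 1 - 1) (\<lambda>s'. reg s' ''N'' = 2 ^ ?z)"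
    proof (rule triple_Seq_framed[OF w1[of ?s], where ?T2.0 = "6 * n + 3"])
      fix s2 :: state assume t: "reg s2 ''t'' = e * L"
      show "triple (Seq (Assign ''N'' (Lit 1)) (Seq (Assign ''y'' (Lit 0)) (While (Less (Var ''y'') (Var ''t'')) ?P2)))
        s2 (6 * n + 3) (\<lambda>s'. reg s' ''N'' = 2 ^ ?z)"
        using B_pos t by (intro triple_Assign_Seq triple_conseq[OF w2]) (auto intro: exI[of _ 0])
    qed (use n in \<open>auto intro: exI[of _ 0]\<close>)
  qed (use B_pos in auto)
qed

section \<open>Balls and heavy vertices\<close>

definition gap :: "nat \<Rightarrow> nat \<Rightarrow> nat" where
  "gap b r = (2 * r - 1) * b"

lemma aval_gap [simp]: "aval (gap_exp r) s = gap (reg s ''b'') r"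
  by (simp add: gap_exp_def gap_def)

definition heavy_ok :: "nat \<Rightarrow> nat \<Rightarrow> (nat \<Rightarrow> nat) \<Rightarrow> bool" where
  "heavy_ok g N hv \<longleftrightarrow> (\<forall>v<n. hv v \<noteq> 0 \<longleftrightarrow> N \<le> card {u. u < n \<and> near g v u})"

lemma triple_heavy:
  assumes s: "dist_ok s" "reg s ''b'' = b" "gap b r < inf_dist" "reg s ''N'' = N"
  shows "triple (heavy_prog r) s (4 * (n * n) + 10 * n + 2) (\<lambda>s'. heavy_ok (gap b r) N (arr s' ''hv'') \<and>
     (\<forall>v<n. arr s' (far_name r) v = 1 \<and> arr s' (sample_name r) v = 0))"
  unfolding heavy_prog_def
proof (rule triple_For[where I = "\<lambda>i s'. (\<forall>v<i. (arr s' ''hv'' v \<noteq> 0 \<longleftrightarrow> N \<le> card {u. u < n \<and> near (gap b r) v u}) \<and>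
      arr s' (far_name r) v = 1 \<and> arr s' (sample_name r) v = 0)" and T = "\<lambda>_. 4 * n + 7"])
  let ?c = "count_prog ''w'' (near_test ''v'' (Var ''w'') (gap_exp r))"
  let ?P = "Seq ?c
     (Seq (If (Less (Var ''cnt'') (Var ''N'')) (Store ''hv'' (Var ''v'') (Lit 0)) (Store ''hv'' (Var ''v'') (Lit 1)))
     (Seq (Store (far_name r) (Var ''v'') (Lit 1)) (Store (sample_name r) (Var ''v'') (Lit 0))))"
  fix i s' assume i: "i < n" "reg s' ''v'' = i" "framed (For ''v'' ''n'' ?P) s s'"
    and I: "\<forall>v<i. (arr s' ''hv'' v \<noteq> 0 \<longleftrightarrow> N \<le> card {u. u < n \<and> near (gap b r) v u}) \<and>
      arr s' (far_name r) v = 1 \<and> arr s' (sample_name r) v = 0"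
  have d': "dist_ok s'" by (rule dist_ok_cong[OF s(1) i(3)]) auto
  have r': "reg s' ''b'' = b" "reg s' ''N'' = N" "reg s' ''n'' = n"
    using i(3) s d' by (simp_all add: agree_off_reg dist_ok_def)
  have cnt: "triple ?c s' (4 * n + 3) (\<lambda>s''. reg s'' ''cnt'' = card {u. u < n \<and> near (gap b r) i u})"
  proof (rule triple_count)
    fix s2 u assume u: "u < n" "reg s2 ''w'' = u" "agree_off {''cnt'', ''w''} {} s' s2"
    have "dist_ok s2" by (rule dist_ok_cong[OF d' u(3)]) auto
    moreover have "reg s2 ''b'' = b" "reg s2 ''v'' = i" using u(3) r' i by (simp_all add: agree_off_reg)
    ultimately show "bval (near_test ''v'' (Var ''w'') (gap_exp r)) s2 = near (gap b r) i u"
      using near_test[of s2 "''v''" i "Var ''w''" u "gap_exp r"] s(3) u i by simp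
  qed (use r' in auto)
  let ?h = "If (Less (Var ''cnt'') (Var ''N'')) (Store ''hv'' (Var ''v'') (Lit 0)) (Store ''hv'' (Var ''v'') (Lit 1))"
  show "triple ?P s' (4 * n + 7) (\<lambda>s''. \<forall>v<Suc i. (arr (set_reg ''v'' (Suc i) s'') ''hv'' v \<noteq> 0 \<longleftrightarrow> N \<le> card {u. u < n \<and> near (gap b r) v u}) \<and>
      arr (set_reg ''v'' (Suc i) s'') (far_name r) v = 1 \<and> arr (set_reg ''v'' (Suc i) s'') (sample_name r) v = 0)"
    (is "triple _ _ _ ?R")
  proof (rule triple_Seq_framed[OF cnt, where ?T2.0 = 4])
    fix s2 assume f: "framed ?c s' s2" and c: "reg s2 ''cnt'' = card {u. u < n \<and> near (gap b r) i u}"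
    have r2: "reg s2 ''v'' = i" "reg s2 ''N'' = N" "arr s2 = arr s'"
      using f i r' by (auto simp: agree_off_def)
    have h: "triple ?h s2 2 (\<lambda>s3. (\<forall>v. v \<noteq> i \<longrightarrow> arr s3 ''hv'' v = arr s' ''hv'' v) \<and>
        (arr s3 ''hv'' i \<noteq> 0 \<longleftrightarrow> N \<le> card {u. u < n \<and> near (gap b r) i u}))"
      using r2 c B_pos by (intro triple_If[where T = 1] triple_Store) auto
    show "triple (Seq ?h (Seq (Store (far_name r) (Var ''v'') (Lit 1)) (Store (sample_name r) (Var ''v'') (Lit 0)))) s2 4 ?R"
    proof (rule triple_Seq_framed[OF h, where ?T2.0 = 2])
      fix s3 assume f3: "framed ?h s2 s3" and p: "(\<forall>v. v \<noteq> i \<longrightarrow> arr s3 ''hv'' v = arr s' ''hv'' v) \<and>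
        (arr s3 ''hv'' i \<noteq> 0 \<longleftrightarrow> N \<le> card {u. u < n \<and> near (gap b r) i u})"
      have hv: "arr s3 ''hv'' v \<noteq> 0 \<longleftrightarrow> N \<le> card {u. u < n \<and> near (gap b r) v u}" if "v < Suc i" for v
        using p I that by (cases "v = i") auto
      have r3: "reg s3 ''v'' = i" "arr s3 (far_name r) = arr s' (far_name r)" "arr s3 (sample_name r) = arr s' (sample_name r)"
        using f3 r2 by (auto simp: agree_off_def)
      show "triple (Seq (Store (far_name r) (Var ''v'') (Lit 1)) (Store (sample_name r) (Var ''v'') (Lit 0))) s3 2 ?R"
        using r3 hv I B_pos by (intro triple_Store_Seq triple_Store) (auto simp: less_Suc_eq)
    qed simp
  qed simp
qed (use s in \<open>auto simp: dist_ok_def heavy_ok_def algebra_simps\<close>)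

lemma triple_clear:
  assumes s: "dist_ok s" "reg s ''b'' = b" "gap b r < inf_dist" "reg s ''x'' = x" "x < n"
  shows "triple (clear_prog r) s (4 * n + 2)
    (\<lambda>s'. \<forall>v<n. arr s' (far_name r) v = (if near (gap b r) v x then 0 else arr s (far_name r) v))"
  unfolding clear_prog_def
proof (rule triple_For[where I = "\<lambda>i s'. \<forall>v<n. arr s' (far_name r) v =
     (if v < i \<and> near (gap b r) v x then 0 else arr s (far_name r) v)" and T = "\<lambda>_. 2"])
  let ?P = "If (near_test ''v'' (Var ''x'') (gap_exp r)) (Store (far_name r) (Var ''v'') (Lit 0)) Skip"
  fix i s' assume i: "i < n" "reg s' ''v'' = i" "framed (For ''v'' ''n'' ?P) s s'"
    and I: "\<forall>v<n. arr s' (far_name r) v = (if v < i \<and> near (gap b r) v x then 0 else arr s (far_name r) v)"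
  have d': "dist_ok s'" by (rule dist_ok_cong[OF s(1) i(3)]) auto
  have r': "reg s' ''b'' = b" "reg s' ''x'' = x" using i(3) s by (simp_all add: agree_off_reg)
  have "bval (near_test ''v'' (Var ''x'') (gap_exp r)) s' \<longleftrightarrow> near (gap b r) i x"
    using near_test[of s' "''v''" i "Var ''x''" x "gap_exp r"] d' r' i s by simp
  then show "triple ?P s' 2 (\<lambda>s''. \<forall>v<n. arr (set_reg ''v'' (Suc i) s'') (far_name r) v =
     (if v < Suc i \<and> near (gap b r) v x then 0 else arr s (far_name r) v))"
    using I i by (intro triple_If[where T = 1] triple_Store triple_Skip) (auto simp: less_Suc_eq)
qed (use s in \<open>auto simp: dist_ok_def\<close>)

section \<open>Greedy selection with falling thresholds\<close>

definition unhit :: "(nat \<Rightarrow> nat) \<Rightarrow> (nat \<Rightarrow> nat) \<Rightarrow> nat set" where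
  "unhit hv f = {v. v < n \<and> hv v \<noteq> 0 \<and> f v \<noteq> 0}"

definition chosen :: "(nat \<Rightarrow> nat) \<Rightarrow> nat set" where
  "chosen S = {x. x < n \<and> S x \<noteq> 0}"

text \<open>A cleared flag certifies a chosen vertex nearby. The converse is not kept, since vertex
  0 joins the sample without clearing flags.\<close>

definition hit_ok :: "nat \<Rightarrow> (nat \<Rightarrow> nat) \<Rightarrow> (nat \<Rightarrow> nat) \<Rightarrow> bool" where
  "hit_ok g S f \<longleftrightarrow> (\<forall>v<n. f v = 0 \<longrightarrow> (\<exists>s<n. S s \<noteq> 0 \<and> near g v s))"

lemma hit_ok_mono: "hit_ok g S f \<Longrightarrow> (\<And>x. S x \<noteq> 0 \<Longrightarrow> S' x \<noteq> 0) \<Longrightarrow> hit_ok g S' f"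
  unfolding hit_ok_def by blast

lemma finite_unhit [simp]: "finite (unhit hv f)" and finite_chosen [simp]: "finite (chosen S)"
  by (auto simp: unhit_def chosen_def)

lemma unhit_pick:
  assumes "\<forall>v<n. f' v = (if near g v x then 0 else f v)"
  shows "unhit hv f' = unhit hv f - {v \<in> unhit hv f. near g v x}"
  using assms by (auto simp: unhit_def split: if_splits)

text \<open>Every pick hits at least \<open>T\<close> unhit vertices, so \<open>T\<close> times the
  number of chosen vertices plus the number of unhit ones never grows. The unhit set only shrinks,
  so the bound below \<open>T\<close> established at \<open>x\<close> still holds when the pass
  ends.\<close>

lemma triple_pass:
  assumes s: "dist_ok s" "reg s ''b'' = b" "gap b r < inf_dist" "reg s ''T'' = T" "1 \<le> T"
    and hv: "hv = arr s ''hv''" and hit: "hit_ok (gap b r) (arr s (sample_name r)) (arr s (far_name r))"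
  shows "triple (pass_prog r) s (8 * (n * n) + 10 * n + 2) (\<lambda>s'.
    hit_ok (gap b r) (arr s' (sample_name r)) (arr s' (far_name r)) \<and>
    (\<forall>x<n. card {v \<in> unhit hv (arr s' (far_name r)). near (gap b r) v x} < T) \<and>
    card (chosen (arr s' (sample_name r))) * T + card (unhit hv (arr s' (far_name r))) \<le>
    card (chosen (arr s (sample_name r))) * T + card (unhit hv (arr s (far_name r))))"
  unfolding pass_prog_def
proof (rule triple_For[where I = "\<lambda>i s'.
    hit_ok (gap b r) (arr s' (sample_name r)) (arr s' (far_name r)) \<and>
    (\<forall>x<i. card {v \<in> unhit hv (arr s' (far_name r)). near (gap b r) v x} < T) \<and>
    card (chosen (arr s' (sample_name r))) * T + card (unhit hv (arr s' (far_name r))) \<le>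
    card (chosen (arr s (sample_name r))) * T + card (unhit hv (arr s (far_name r)))" and T = "\<lambda>_. 8 * n + 8"])
  let ?c = "count_prog ''v'' (unhit_test r)"
  let ?h = "If (Less (Var ''cnt'') (Var ''T'')) Skip
       (Seq (Store (sample_name r) (Var ''x'') (Lit 1)) (clear_prog r))"
  fix i s' assume i: "i < n" "reg s' ''x'' = i" "framed (For ''x'' ''n'' (Seq ?c ?h)) s s'"
    and I: "hit_ok (gap b r) (arr s' (sample_name r)) (arr s' (far_name r)) \<and>
    (\<forall>x<i. card {v \<in> unhit hv (arr s' (far_name r)). near (gap b r) v x} < T) \<and>
    card (chosen (arr s' (sample_name r))) * T + card (unhit hv (arr s' (far_name r))) \<le>
    card (chosen (arr s (sample_name r))) * T + card (unhit hv (arr s (far_name r)))"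
  define f where "f = arr s' (far_name r)"
  define S where "S = arr s' (sample_name r)"
  define U where "U = unhit hv f"
  define g where "g = gap b r"
  have d': "dist_ok s'" by (rule dist_ok_cong[OF s(1) i(3)]) auto
  have r': "reg s' ''b'' = b" "reg s' ''T'' = T" "reg s' ''n'' = n" "arr s' ''hv'' = hv"
    using i(3) s d' hv by (simp_all add: agree_off_reg agree_off_arr dist_ok_def)
  let ?P = "\<lambda>v. hv v \<noteq> 0 \<and> f v \<noteq> 0 \<and> near g v i"
  have cnt: "triple ?c s' (4 * n + 3) (\<lambda>s''. reg s'' ''cnt'' = card {v. v < n \<and> ?P v})"
  proof (rule triple_count)
    fix s2 v assume v: "v < n" "reg s2 ''v'' = v" "agree_off {''cnt'', ''v''} {} s' s2"
    have "dist_ok s2" by (rule dist_ok_cong[OF d' v(3)]) auto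
    moreover have "reg s2 ''b'' = b" "reg s2 ''x'' = i" "arr s2 = arr s'"
      using v(3) r' i by (auto simp: agree_off_def)
    ultimately show "bval (unhit_test r) s2 = ?P v"
      using near_test[of s2 "''v''" v "Var ''x''" i "gap_exp r"] s(3) v i r'
      by (simp add: unhit_test_def f_def g_def)
  qed (use r' in auto)
  have cU: "{v. v < n \<and> ?P v} = {v \<in> U. near g v i}" by (auto simp: U_def unhit_def)
  show "triple (Seq ?c ?h) s' (8 * n + 8) (\<lambda>s''.
    hit_ok (gap b r) (arr (set_reg ''x'' (Suc i) s'') (sample_name r)) (arr (set_reg ''x'' (Suc i) s'') (far_name r)) \<and>
    (\<forall>x<Suc i. card {v \<in> unhit hv (arr (set_reg ''x'' (Suc i) s'') (far_name r)). near (gap b r) v x} < T) \<and>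
    card (chosen (arr (set_reg ''x'' (Suc i) s'') (sample_name r))) * T + card (unhit hv (arr (set_reg ''x'' (Suc i) s'') (far_name r))) \<le>
    card (chosen (arr s (sample_name r))) * T + card (unhit hv (arr s (far_name r))))" (is "triple _ _ _ ?R")
  proof (rule triple_Seq_framed[OF cnt, where ?T2.0 = "4 * n + 5"])
    fix s2 assume f2: "framed ?c s' s2" and c: "reg s2 ''cnt'' = card {v. v < n \<and> ?P v}"
    have r2: "reg s2 ''x'' = i" "reg s2 ''T'' = T" "reg s2 ''b'' = b" "arr s2 = arr s'"
      using f2 i r' by (auto simp: agree_off_def)
    have d2: "dist_ok s2" by (rule dist_ok_cong[OF d' f2]) auto
    show "triple ?h s2 (4 * n + 5) ?R"
    proof (rule triple_If[where T = "4 * n + 4"])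
      assume "bval (Less (Var ''cnt'') (Var ''T'')) s2"
      then have "card {v \<in> U. near g v i} < T" using c cU r2 by simp
      then show "triple Skip s2 (4 * n + 4) ?R"
        using I r2 by (intro triple_Skip) (auto simp: less_Suc_eq U_def f_def g_def)
    next
      assume "\<not> bval (Less (Var ''cnt'') (Var ''T'')) s2"
      then have le: "T \<le> card {v \<in> U. near g v i}" using c cU r2 by simp
      let ?s3 = "s2\<lparr>arr := (arr s2)(sample_name r := (arr s2 (sample_name r))(aval (Var ''x'') s2 := aval (Lit 1) s2))\<rparr>"
      have d3: "dist_ok ?s3" using d2 by (simp add: dist_ok_def)
      show "triple (Seq (Store (sample_name r) (Var ''x'') (Lit 1)) (clear_prog r)) s2 (4 * n + 4) ?R"
      proof (rule triple_Store_Seq)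
        show "triple (clear_prog r) ?s3 (4 * n + 4 - 1) ?R"
        proof (rule triple_conseq[OF triple_clear[OF d3, where b = b and x = i]])
          fix s4 assume f4: "framed (clear_prog r) ?s3 s4"
            and p: "\<forall>v<n. arr s4 (far_name r) v = (if near (gap b r) v i then 0 else arr ?s3 (far_name r) v)"
          let ?f = "arr s4 (far_name r)" and ?S = "arr s4 (sample_name r)"
          have p': "\<forall>v<n. ?f v = (if near g v i then 0 else f v)" using p r2 by (simp add: f_def g_def)
          have S: "?S = S(i := 1)" using f4 r2 by (simp add: agree_off_arr S_def)
          have U': "unhit hv ?f = U - {v \<in> U. near g v i}" unfolding U_def by (rule unhit_pick[OF p'])
          have "card (unhit hv ?f) + card {v \<in> U. near g v i} = card U"
            unfolding U' using card_mono[of U "{v \<in> U. near g v i}"] by (subst card_Diff_subset) (auto simp: U_def)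
          moreover have "card (chosen ?S) * T \<le> (card (chosen S) + 1) * T"
          proof (intro mult_le_mono1)
            have "chosen ?S \<subseteq> insert i (chosen S)" unfolding S by (auto simp: chosen_def)
            then have "card (chosen ?S) \<le> card (insert i (chosen S))" by (intro card_mono) auto
            also have "\<dots> \<le> card (chosen S) + 1" by (simp add: card_insert_if)
            finally show "card (chosen ?S) \<le> card (chosen S) + 1" .
          qed
          ultimately have "card (chosen ?S) * T + card (unhit hv ?f) \<le> card (chosen S) * T + card U"
            using le by (simp add: algebra_simps)
          moreover have "hit_ok g ?S ?f" unfolding hit_ok_def
          proof (intro allI impI)
            fix v assume v: "v < n" "?f v = 0"
            show "\<exists>s<n. ?S s \<noteq> 0 \<and> near g v s"
            proof (cases "near g v i")
              case False
              then have "f v = 0" using p' v by simp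
              then obtain t where "t < n" "S t \<noteq> 0" "near g v t"
                using I v by (auto simp: hit_ok_def f_def S_def g_def)
              then show ?thesis unfolding S by (auto intro!: exI[of _ t])
            qed (use i S in auto)
          qed
          \<comment> \<open>For \<open>x = i\<close> the pick has just emptied the set, and
            \<open>1 \<le> T\<close>.\<close>
          moreover have "card {v \<in> unhit hv ?f. near g v x} < T" if "x < Suc i" for x
          proof (cases "x = i")
            case True
            then have "{v \<in> unhit hv ?f. near g v x} = {}" unfolding U' by auto
            then show ?thesis using s(5) by (metis card.empty less_le_trans zero_less_one)
          next
            case False
            have "card {v \<in> unhit hv ?f. near g v x} \<le> card {v \<in> U. near g v x}"
              unfolding U' by (intro card_mono) (auto simp: U_def)
            also have "\<dots> < T" using I that False by (simp add: U_def f_def g_def)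
            finally show ?thesis .
          qed
          ultimately show "?R s4" using I by (simp add: U_def f_def S_def g_def)
        qed (use r2 s i in auto)
      qed (use B_pos in auto)
    qed simp
  qed simp
qed (use s hit in \<open>auto simp: dist_ok_def algebra_simps\<close>)

text \<open>\<open>card (chosen S) - 1\<close> leaves room for vertex 0, which is always added.
  Balls are small around the vertices still flagged because all heavy vertices have been
  hit.\<close>

definition sample_ok :: "nat \<Rightarrow> nat \<Rightarrow> (nat \<Rightarrow> nat) \<Rightarrow> (nat \<Rightarrow> nat) \<Rightarrow> bool" where
  "sample_ok g N S f \<longleftrightarrow> hit_ok g S f \<and> (\<forall>v<n. f v \<noteq> 0 \<longrightarrow> card {u. u < n \<and> near g v u} < N) \<and> S 0 \<noteq> 0 \<and>
     (card (chosen S) - 1) * N \<le> 2 * n * (L + 1)"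

text \<open>Double counting pairs of a heavy unhit vertex and a vertex close to it.\<close>

lemma unhit_count:
  assumes hv: "heavy_ok g N hv" and lt: "\<forall>x<n. card {v \<in> unhit hv f. near g v x} \<le> c"
  shows "card (unhit hv f) * N \<le> n * c"
proof -
  let ?U = "unhit hv f"
  have "card ?U * N = (\<Sum>v\<in>?U. N)" by simp
  also have "\<dots> \<le> (\<Sum>v\<in>?U. card {u. u < n \<and> near g v u})"
    using hv by (intro sum_mono) (auto simp: heavy_ok_def unhit_def)
  also have "\<dots> = (\<Sum>v\<in>?U. \<Sum>u<n. of_bool (near g v u))"
    by (intro sum.cong refl) (simp add: Collect_conj_eq lessThan_def Int_commute)
  also have "\<dots> = (\<Sum>u<n. \<Sum>v\<in>?U. of_bool (near g v u))" by (rule sum.swap)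
  also have "\<dots> = (\<Sum>u<n. card {v \<in> ?U. near g v u})"
    by (intro sum.cong refl) (simp add: Collect_conj_eq Int_commute)
  also have "\<dots> \<le> (\<Sum>u<n. c)" using lt by (intro sum_mono) auto
  finally show ?thesis by simp
qed

text \<open>When the threshold is \<open>2 ^ a\<close>, at most \<open>2 * 2 ^ a\<close> unhit heavy
  vertices are near any vertex, by the previous pass. Double counting bounds the unhit set by
  \<open>2 * n * 2 ^ a / N\<close>; each pick removes at least \<open>2 ^ a\<close> of it, so a pass
  picks at most \<open>2 * n / N\<close> vertices.\<close>

lemma triple_sample:
  assumes s: "dist_ok s" "reg s ''b'' = b" "gap b r < inf_dist" and ed: "e \<le> d" "d \<le> 2 * (k + 1) * (k + 1)"
  shows "triple (sample_prog e d r) s ((L + 2) * (8 * (n * n) + 22 * n + 16))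
    (\<lambda>s'. sample_ok (gap b r) (2 ^ size_exp e d) (arr s' (sample_name r)) (arr s' (far_name r)))" (is "triple _ _ _ ?Q")
proof -
  define g where "g = gap b r"
  define N where "N = (2::nat) ^ size_exp e d"
  define W where "W = 8 * (n * n) + 10 * n + 4"
  let ?P = "Seq (pass_prog r) (Assign ''T'' (Cell ''half'' (Var ''T'')))"
  define I where "I = (\<lambda>hv (s::state). let f = arr s (far_name r); S = arr s (sample_name r) in
    hit_ok g S f \<and>
    ((\<exists>a\<le>L. reg s ''T'' = 2 ^ a \<and> card (chosen S) * N \<le> 2 * n * (L - a) \<and>
        (\<forall>x<n. card {v \<in> unhit hv f. near g v x} \<le> 2 * 2 ^ a)) \<or>
     (reg s ''T'' = 0 \<and> card (chosen S) * N \<le> 2 * n * (L + 1) \<and> unhit hv f = {})))"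
  define \<Phi> where "\<Phi> = (\<lambda>s::state. (if reg s ''T'' = 0 then 0 else (floorlog 2 (reg s ''T'')) * W))"
  have W: "(W - 1) + 1 + \<Phi> s'' \<le> \<Phi> s'"
    if T: "reg s' ''T'' = 2 ^ a" "reg s'' ''T'' = (if a = 0 then 0 else 2 ^ (a - 1))" for a and s' s'' :: state
  proof -
    have "\<Phi> s' = Suc a * W" using T(1) by (simp add: \<Phi>_def floorlog_two_power)
    moreover have "\<Phi> s'' = a * W" using T(2) by (cases a) (auto simp: \<Phi>_def floorlog_two_power)
    moreover have "1 \<le> W" by (simp add: W_def)
    ultimately show ?thesis by simp
  qed
  have loop: "triple (While (Less (Lit 0) (Var ''T'')) ?P) s2 ((L + 1) * W + 1)
      (\<lambda>s'. hit_ok g (arr s' (sample_name r)) (arr s' (far_name r)) \<and>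
        card (chosen (arr s' (sample_name r))) * N \<le> 2 * n * (L + 1) \<and> unhit hv (arr s' (far_name r)) = {})"
    if s2: "dist_ok s2" "reg s2 ''b'' = b" "arr s2 ''hv'' = hv" "heavy_ok g N hv" "I hv s2" "reg s2 ''T'' = 2 ^ L" for s2 hv
  proof (rule triple_While[where I = "I hv" and \<Phi> = \<Phi>])
    fix s' assume I: "I hv s'" and t: "bval (Less (Lit 0) (Var ''T'')) s'" and f: "framed ?P s2 s'"
    let ?f = "arr s' (far_name r)" and ?S = "arr s' (sample_name r)"
    obtain a where a: "a \<le> L" "reg s' ''T'' = 2 ^ a" "card (chosen ?S) * N \<le> 2 * n * (L - a)"
      "\<forall>x<n. card {v \<in> unhit hv ?f. near g v x} \<le> 2 * 2 ^ a" and hit: "hit_ok g ?S ?f"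
      using I t by (auto simp: I_def Let_def)
    have d': "dist_ok s'" by (rule dist_ok_cong[OF s2(1) f]) auto
    have r': "reg s' ''b'' = b" "hv = arr s' ''hv''" using f s2 by (simp_all add: agree_off_reg agree_off_arr)
    have half: "arr s' ''half'' (2 ^ a) = (if a = 0 then 0 else 2 ^ (a - 1))"
      using d' a(1) by (cases a) (auto simp: dist_ok_def half_ok_def)
    have hN: "card (unhit hv ?f) * N \<le> n * (2 * 2 ^ a)" by (rule unhit_count[OF s2(4) a(4)])
    have "triple ?P s' (W - 1) (\<lambda>s''. I hv s'' \<and> W - 1 + 1 + \<Phi> s'' \<le> \<Phi> s')"
    proof (rule triple_Seq_framed[OF triple_pass[OF d' r'(1) s(3) a(2) _ r'(2) hit[unfolded g_def]], where ?T2.0 = 1])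
      fix s3 assume f3: "framed (pass_prog r) s' s3" and bd: "bounded s3"
        and p: "hit_ok (gap b r) (arr s3 (sample_name r)) (arr s3 (far_name r)) \<and>
          (\<forall>x<n. card {v \<in> unhit hv (arr s3 (far_name r)). near (gap b r) v x} < 2 ^ a) \<and>
          card (chosen (arr s3 (sample_name r))) * 2 ^ a + card (unhit hv (arr s3 (far_name r))) \<le>
          card (chosen ?S) * 2 ^ a + card (unhit hv ?f)"
      let ?f3 = "arr s3 (far_name r)" and ?S3 = "arr s3 (sample_name r)"
      have T3: "reg s3 ''T'' = 2 ^ a" "arr s3 ''half'' = arr s' ''half''"
        using f3 a(2) by (simp_all add: agree_off_reg agree_off_arr)
      have small: "card {v \<in> unhit hv ?f3. near g v x} < 2 ^ a" if "x < n" for x using p that by (simp add: g_def)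
      \<comment> \<open>Everything is multiplied by \<open>N\<close> and \<open>2 ^ a\<close> so
        that no division occurs; cancelling \<open>2 ^ a\<close> leaves a growth of at most
        \<open>2 * n\<close>.\<close>
      have "(card (chosen ?S3) * N) * 2 ^ a = (card (chosen ?S3) * 2 ^ a) * N" by simp
      also have "\<dots> \<le> (card (chosen ?S) * 2 ^ a + card (unhit hv ?f)) * N"
        using p by (intro mult_le_mono1) linarith
      also have "\<dots> = card (chosen ?S) * N * 2 ^ a + card (unhit hv ?f) * N" by (simp add: algebra_simps)
      also have "\<dots> \<le> card (chosen ?S) * N * 2 ^ a + n * (2 * 2 ^ a)" using hN by simp
      also have "\<dots> = (card (chosen ?S) * N + 2 * n) * 2 ^ a" by (simp add: algebra_simps)
      finally have "card (chosen ?S3) * N \<le> card (chosen ?S) * N + 2 * n" by simp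
      also have "\<dots> \<le> 2 * n * (L - a) + 2 * n" using a(3) by simp
      also have "\<dots> = 2 * n * (L - a + 1)" by simp
      finally have cS: "card (chosen ?S3) * N \<le> 2 * n * (L - a + 1)" .
      have "I hv (set_reg ''T'' (arr s' ''half'' (2 ^ a)) s3)"
      proof (cases a)
        case 0
        \<comment> \<open>An unhit vertex is near itself, so counts below 1 leave none.\<close>
        have "unhit hv ?f3 = {}"
        proof (rule ccontr)
          assume "unhit hv ?f3 \<noteq> {}"
          then obtain v where v: "v \<in> unhit hv ?f3" by blast
          then have "v < n" by (simp add: unhit_def)
          then have "{v' \<in> unhit hv ?f3. near g v' v} = {}" using small[of v] 0 by simp
          then show False using v near_refl[OF \<open>v < n\<close>] by blast
        qed
        then show ?thesis using p cS 0 half by (simp add: I_def g_def Let_def)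
      next
        case (Suc a')
        have "L - a + 1 = L - a'" using Suc a(1) by simp
        then show ?thesis
          using p cS small Suc half a(1) unfolding I_def Let_def
          by (intro conjI disjI1 exI[of _ a']) (auto simp: g_def less_imp_le)
      qed
      moreover have "W - 1 + 1 + \<Phi> (set_reg ''T'' (arr s' ''half'' (2 ^ a)) s3) \<le> \<Phi> s'"
        by (rule W[OF a(2)]) (simp add: half)
      ultimately show "triple (Assign ''T'' (Cell ''half'' (Var ''T''))) s3 1 (\<lambda>s''. I hv s'' \<and> W - 1 + 1 + \<Phi> s'' \<le> \<Phi> s')"
        using T3 boundedD(2)[OF bd, of "''half''"] by (intro triple_Assign) auto
    qed (auto simp: W_def)
    then show "\<exists>T. triple ?P s' T (\<lambda>s''. I hv s'' \<and> T + 1 + \<Phi> s'' \<le> \<Phi> s')" by blast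
  next
    show "\<Phi> s2 + 1 \<le> (L + 1) * W + 1" using s2(6) by (simp add: \<Phi>_def floorlog_two_power)
  qed (use s2 in \<open>auto simp: I_def Let_def\<close>)
  have r0: "reg s ''n'' = n" "reg s ''p'' = 2 ^ L" using s by (auto simp: dist_ok_def)
  have pB: "2 ^ L \<le> B" using L_less by (intro small_le_B(1)) simp
  show ?thesis unfolding sample_prog_def
  proof (rule triple_Seq_framed[OF triple_size[OF r0(1) ed]])
    fix s1 assume f1: "framed (size_prog e d) s s1" and p1: "reg s1 ''N'' = 2 ^ size_exp e d"
    have d1: "dist_ok s1" by (rule dist_ok_cong[OF s(1) f1]) auto
    have b1: "reg s1 ''b'' = b" using f1 s by (simp add: agree_off_reg)
    show "triple (Seq (heavy_prog r) (Seq (Assign ''T'' (Var ''p''))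
      (Seq (While (Less (Lit 0) (Var ''T'')) ?P) (Store (sample_name r) (Lit 0) (Lit 1))))) s1
      ((4 * (n * n) + 10 * n + 2) + (1 + (((L + 1) * W + 1) + 1))) ?Q"
    proof (rule triple_Seq_framed[OF triple_heavy[OF d1 b1 s(3) p1]])
      fix s2 assume f2: "framed (heavy_prog r) s1 s2" and p2: "heavy_ok (gap b r) (2 ^ size_exp e d) (arr s2 ''hv'') \<and>
        (\<forall>v<n. arr s2 (far_name r) v = 1 \<and> arr s2 (sample_name r) v = 0)"
      have d2: "dist_ok s2" by (rule dist_ok_cong[OF d1 f2]) auto
      let ?hv = "arr s2 ''hv''"
      let ?s3 = "set_reg ''T'' (aval (Var ''p'') s2) s2"
      have T3: "reg ?s3 ''T'' = 2 ^ L" using d2 by (simp add: dist_ok_def)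
      have d3: "dist_ok ?s3" using d2 by (simp add: dist_ok_def)
      have b3: "reg ?s3 ''b'' = b" using f2 b1 by (simp add: agree_off_reg)
      have ch0: "chosen (arr s2 (sample_name r)) = {}" using p2 by (auto simp: chosen_def)
      \<comment> \<open>Before the first pass the bound of the invariant holds because there are
        only \<open>n \<le> 2 ^ L\<close> vertices.\<close>
      have cc: "card {v \<in> A. near g v x} \<le> 2 * 2 ^ L" if "A \<subseteq> {..<n}" for A x
      proof -
        have "card {v \<in> A. near g v x} \<le> card {..<n}" using that by (intro card_mono) auto
        then show ?thesis using L_ge by simp
      qed
      have "unhit ?hv (arr s2 (far_name r)) \<subseteq> {..<n}" by (auto simp: unhit_def)
      note cc' = cc[OF this]
      have h2: "hit_ok g (arr s2 (sample_name r)) (arr s2 (far_name r))" using p2 by (simp add: hit_ok_def)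
      have I3: "I ?hv ?s3" unfolding I_def Let_def
        using h2 ch0 T3 cc' by (intro conjI disjI1 exI[of _ L]) simp_all
      show "triple (Seq (Assign ''T'' (Var ''p'')) (Seq (While (Less (Lit 0) (Var ''T'')) ?P)
        (Store (sample_name r) (Lit 0) (Lit 1)))) s2 (1 + (((L + 1) * W + 1) + 1)) ?Q"
      proof (rule triple_Assign_Seq)
        show "triple (Seq (While (Less (Lit 0) (Var ''T'')) ?P) (Store (sample_name r) (Lit 0) (Lit 1)))
          ?s3 (1 + (((L + 1) * W + 1) + 1) - 1) ?Q"
        proof (rule triple_Seq_framed[OF loop[OF d3 b3 _ _ I3 T3], where ?T2.0 = 1])
          fix s4 :: state assume p4: "hit_ok g (arr s4 (sample_name r)) (arr s4 (far_name r)) \<and>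
            card (chosen (arr s4 (sample_name r))) * N \<le> 2 * n * (L + 1) \<and> unhit ?hv (arr s4 (far_name r)) = {}"
          let ?S = "arr s4 (sample_name r)" and ?f = "arr s4 (far_name r)"
          have "chosen (?S(0 := 1)) \<subseteq> insert 0 (chosen ?S)" by (auto simp: chosen_def)
          then have "card (chosen (?S(0 := 1))) \<le> card (insert 0 (chosen ?S))" by (intro card_mono) auto
          also have "\<dots> \<le> card (chosen ?S) + 1" by (simp add: card_insert_if)
          finally have "(card (chosen (?S(0 := 1))) - 1) * N \<le> card (chosen ?S) * N" by (intro mult_le_mono1) simp
          then have c: "(card (chosen (?S(0 := 1))) - 1) * N \<le> 2 * n * (L + 1)" using p4 by linarith
          have h: "hit_ok g (?S(0 := 1)) ?f" by (rule hit_ok_mono[of g ?S]) (use p4 in auto)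
          have "card {u. u < n \<and> near g v u} < N" if "v < n" "?f v \<noteq> 0" for v
          proof -
            have "?hv v = 0" using that p4 by (auto simp: unhit_def)
            then show ?thesis using p2 that by (auto simp: heavy_ok_def g_def N_def)
          qed
          then show "triple (Store (sample_name r) (Lit 0) (Lit 1)) s4 1 ?Q"
            using c h B_pos by (intro triple_Store) (auto simp: sample_ok_def g_def N_def)
        qed (use p2 in \<open>auto simp: g_def N_def\<close>)
      qed (use d2 pB in \<open>auto simp: dist_ok_def\<close>)
    qed simp
  next
    have "(L + 1) * W \<le> (L + 1) * (8 * (n * n) + 22 * n + 16)" by (intro mult_le_mono2) (simp add: W_def)
    then show "12 * n + 8 + (4 * (n * n) + 10 * n + 2 + (1 + ((L + 1) * W + 1 + 1)))
      \<le> (L + 2) * (8 * (n * n) + 22 * n + 16)" by simp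
  qed
qed

end

section \<open>The search for centers\<close>

text \<open>Finds \<open>R = a - 1\<close>, \<open>b = R div (2 * l)\<close> and
  \<open>d = 2 * R - b\<close> by counting \<open>R\<close> up. \<open>acc\<close> is the next
  multiple of \<open>2 * l\<close>; when it is met, \<open>b\<close> grows by 1, and
  \<open>d\<close> by 1 instead of 2.\<close>

definition radius_prog :: "nat \<Rightarrow> com" where
  "radius_prog l = Seq (Assign ''r'' (Lit 0)) (Seq (Assign ''b'' (Lit 0))
     (Seq (Assign ''acc'' (Lit (2 * l))) (Seq (Assign ''d'' (Lit 0))
     (While (Less (Add (Var ''r'') (Lit 1)) (Var ''a''))
       (Seq (Assign ''r'' (Add (Var ''r'') (Lit 1)))
       (If (Equal (Var ''r'') (Var ''acc''))
         (Seq (Assign ''b'' (Add (Var ''b'') (Lit 1)))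
         (Seq (Assign ''acc'' (Add (Var ''acc'') (Lit (2 * l))))
           (Assign ''d'' (Add (Var ''d'') (Lit 1)))))
         (Assign ''d'' (Add (Var ''d'') (Lit 2)))))))))"

text \<open>A conjunction over the guessed centers, unrolled since their number is a constant of the
  program.\<close>

fun all_test :: "(nat \<Rightarrow> bexp) \<Rightarrow> nat \<Rightarrow> bexp" where
  "all_test f 0 = Equal (Lit 0) (Lit 0)"
| "all_test f (Suc i) = Conj (all_test f i) (f i)"

lemma bval_all_test [simp]: "bval (all_test f j) s \<longleftrightarrow> (\<forall>i<j. bval (f i) s)"
  by (induction j) (auto simp: less_Suc_eq)

fun copy_prog :: "nat \<Rightarrow> com" where
  "copy_prog 0 = Skip"
| "copy_prog (Suc i) = Seq (copy_prog i) (Store ''C'' (Lit i) (Cell ''c'' (Lit i)))"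

definition leaf_prog :: "nat \<Rightarrow> com" where
  "leaf_prog k = Seq (Assign ''bad'' (Lit 0))
     (Seq (For ''v'' ''n'' (If (all_test (\<lambda>i. Neg (near_test ''v'' (Cell ''c'' (Lit i)) (Var ''d''))) k)
        (Assign ''bad'' (Lit 1)) Skip))
     (If (Equal (Var ''bad'') (Lit 0))
        (Seq (copy_prog k) (Seq (Assign ''R'' (Var ''d'')) (Assign ''ok'' (Lit 1)))) Skip))"

abbreviation loop_name :: "nat \<Rightarrow> string" where
  "loop_name j \<equiv> CHR ''x'' # replicate j (CHR ''x'')"

abbreviation pivot_name :: "nat \<Rightarrow> string" where
  "pivot_name j \<equiv> CHR ''w'' # replicate j (CHR ''w'')"

text \<open>The distance is compared with \<open>2 * R - g (l - i)\<close>, but the subtracted term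
  is moved to the other side; this is faithful because \<open>g (l - i) \<le> R\<close>.\<close>

definition uncovered_test :: "nat \<Rightarrow> nat \<Rightarrow> bexp" where
  "uncovered_test l i = Less (Add (Var ''r'') (Var ''r''))
     (Add (Cell ''D'' (Add (Cell ''O'' (Var ''v'')) (Cell ''c'' (Lit i)))) (gap_exp (l - i)))"

text \<open>\<open>n\<close> is not a vertex and serves as the answer that no pivot exists.\<close>

definition pivot_prog :: "nat \<Rightarrow> nat \<Rightarrow> com" where
  "pivot_prog l j = Seq (Assign (pivot_name j) (Var ''n''))
     (For ''v'' ''n'' (If (Conj (Less (Lit 0) (Cell (far_name (l - j)) (Var ''v'')))
        (all_test (uncovered_test l) j)) (Assign (pivot_name j) (Var ''v'')) Skip))"

definition branch_prog :: "nat \<Rightarrow> bexp \<Rightarrow> com \<Rightarrow> com" where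
  "branch_prog j t P = For (loop_name j) ''n''
     (If t (Seq (Store ''c'' (Lit j) (Var (loop_name j))) P) Skip)"

fun enum_prog :: "nat \<Rightarrow> nat \<Rightarrow> nat \<Rightarrow> com" where
  "enum_prog k r 0 = leaf_prog k"
| "enum_prog k r (Suc q) = branch_prog (k - Suc q)
     (Less (Lit 0) (Cell (sample_name r) (Var (loop_name (k - Suc q))))) (enum_prog k r q)"

text \<open>The last argument counts the missing centers. With \<open>j\<close> centers guessed the
  level is \<open>l - j\<close>, which truncated subtraction keeps at 0 from \<open>j = l\<close>
  on; at level 0 no pivot exists, and the enumeration takes over.\<close>

fun search_prog :: "nat \<Rightarrow> nat \<Rightarrow> nat \<Rightarrow> com" where
  "search_prog k l 0 = leaf_prog k"
| "search_prog k l (Suc q) = Seq (pivot_prog l (k - Suc q))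
     (If (Less (Var (pivot_name (k - Suc q))) (Var ''n''))
        (branch_prog (k - Suc q)
          (near_test (pivot_name (k - Suc q)) (Var (loop_name (k - Suc q))) (gap_exp (l - (k - Suc q))))
          (search_prog k l q))
        (enum_prog k (l - (k - Suc q)) (Suc q)))"

text \<open>What a search from depth \<open>j\<close> on may overwrite. Loop and pivot registers of
  smaller depth are not among it, so the enclosing loops survive.\<close>

definition search_regs :: "nat \<Rightarrow> string set" where
  "search_regs j = {''bad'', ''v'', ''R'', ''ok''} \<union> (\<lambda>i. loop_name i) ` {j..} \<union> (\<lambda>i. pivot_name i) ` {j..}"

lemma search_regs_mono: "i \<le> j \<Longrightarrow> search_regs j \<subseteq> search_regs i"
  unfolding search_regs_def by (intro Un_mono image_mono) auto

lemma search_regs_mem [simp]: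
  "''bad'' \<in> search_regs j" "''v'' \<in> search_regs j" "''R'' \<in> search_regs j" "''ok'' \<in> search_regs j"
  by (auto simp: search_regs_def)

lemma search_regs_names [simp]:
  "''n'' \<notin> search_regs j" "''p'' \<notin> search_regs j" "''r'' \<notin> search_regs j" "''b'' \<notin> search_regs j"
  "''d'' \<notin> search_regs j" "loop_name i \<in> search_regs j \<longleftrightarrow> j \<le> i" "pivot_name i \<in> search_regs j \<longleftrightarrow> j \<le> i"
  by (auto simp: search_regs_def)

lemma mod_copy: "mod_regs (copy_prog i) = {}" "mod_arrs (copy_prog i) \<subseteq> {''C''}"
  by (induction i) auto

lemma mod_leaf: "mod_regs (leaf_prog k) = {''bad'', ''v'', ''R'', ''ok''}" "mod_arrs (leaf_prog k) \<subseteq> {''C''}"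
  using mod_copy by (auto simp: leaf_prog_def)

lemma mod_pivot [simp]: "mod_regs (pivot_prog l j) = {pivot_name j, ''v''}" "mod_arrs (pivot_prog l j) = {}"
  by (auto simp: pivot_prog_def)

lemma mod_branch [simp]: "mod_regs (branch_prog j t P) = insert (loop_name j) (mod_regs P)"
  "mod_arrs (branch_prog j t P) = insert ''c'' (mod_arrs P)"
  by (auto simp: branch_prog_def)

lemma mod_enum: "q \<le> k \<Longrightarrow> mod_regs (enum_prog k r q) \<subseteq> search_regs (k - q) \<and> mod_arrs (enum_prog k r q) \<subseteq> {''C'', ''c''}"
proof (induction q)
  case 0
  then show ?case using mod_leaf[of k] by auto
next
  case (Suc q)
  have "search_regs (k - q) \<subseteq> search_regs (k - Suc q)" by (rule search_regs_mono) simp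
  moreover have "loop_name (k - Suc q) \<in> search_regs (k - Suc q)" by simp
  ultimately show ?case using Suc by (simp only: enum_prog.simps mod_branch) auto
qed

lemma mod_search: "q \<le> k \<Longrightarrow> mod_regs (search_prog k l q) \<subseteq> search_regs (k - q) \<and> mod_arrs (search_prog k l q) \<subseteq> {''C'', ''c''}"
proof (induction q)
  case 0
  then show ?case using mod_leaf[of k] by auto
next
  case (Suc q)
  have "search_regs (k - q) \<subseteq> search_regs (k - Suc q)" by (rule search_regs_mono) simp
  moreover have "loop_name (k - Suc q) \<in> search_regs (k - Suc q)" "pivot_name (k - Suc q) \<in> search_regs (k - Suc q)"
    "''v'' \<in> search_regs (k - Suc q)" by simp_all
  ultimately show ?case using Suc mod_enum[of "Suc q" k "l - (k - Suc q)"]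
    by (simp only: search_prog.simps mod_regs.simps mod_arrs.simps mod_branch mod_pivot) auto
qed

context instance_machine begin

lemma mod_radius [simp]: "mod_regs (radius_prog l') = {''r'', ''b'', ''acc'', ''d''}" "mod_arrs (radius_prog l') = {}"
  by (auto simp: radius_prog_def)

lemma triple_radius:
  assumes a: "reg s ''a'' = a" "1 \<le> a" "a \<le> 2 * n"
  shows "triple (radius_prog l) s (12 * n + 5) (\<lambda>s'. reg s' ''r'' = a - 1 \<and> reg s' ''b'' = (a - 1) div (2 * l) \<and>
    reg s' ''d'' = 2 * (a - 1) - (a - 1) div (2 * l))" (is "triple _ _ _ ?Q")
proof -
  let ?I = "\<lambda>s. reg s ''a'' = a \<and> reg s ''r'' < a \<and> reg s ''b'' * (2 * l) \<le> reg s ''r'' \<and>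
    reg s ''r'' < reg s ''acc'' \<and> reg s ''acc'' = (reg s ''b'' + 1) * (2 * l) \<and> reg s ''d'' + reg s ''b'' = 2 * reg s ''r''"
  let ?P = "(Seq (Assign ''r'' (Add (Var ''r'') (Lit 1)))
       (If (Equal (Var ''r'') (Var ''acc''))
         (Seq (Assign ''b'' (Add (Var ''b'') (Lit 1)))
         (Seq (Assign ''acc'' (Add (Var ''acc'') (Lit (2 * l))))
           (Assign ''d'' (Add (Var ''d'') (Lit 1)))))
         (Assign ''d'' (Add (Var ''d'') (Lit 2)))))"
  have lB: "2 * l \<le> B" using l kn by (intro small_le_B(1)) simp
  have "triple (While (Less (Add (Var ''r'') (Lit 1)) (Var ''a'')) ?P) s1 (12 * n + 1) ?Q" if "?I s1" for s1
  proof (rule triple_While[where I = ?I and \<Phi> = "\<lambda>s. 6 * (a - 1 - reg s ''r'')"])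
    fix s' assume I: "?I s'" and t: "bval (Less (Add (Var ''r'') (Lit 1)) (Var ''a'')) s'"
    obtain r b x where r: "reg s' ''r'' = r" "reg s' ''b'' = b" "x = b * (2 * l)" by blast
    have r1: "r + 1 < a" using t I r by simp
    have I': "reg s' ''a'' = a" "x \<le> r" "r < x + 2 * l" "reg s' ''acc'' = x + 2 * l" "reg s' ''d'' + b = 2 * r"
      using I r by auto
    have "b \<le> x" using l r(3) by simp
    then have br: "b \<le> r" using I'(2) by linarith
    have bds: "r + 1 \<le> B" "b + 1 \<le> B" "x + 2 * l + 2 * l \<le> B" "reg s' ''d'' + 2 \<le> B"
      using r1 br I' a(3) l kn by (auto intro!: small_le_B(1))
    have x': "Suc b * (2 * l) = x + 2 * l" by (simp add: r(3))
    let ?s1 = "set_reg ''r'' (r + 1) s'"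
    let ?Q' = "\<lambda>s''. ?I s'' \<and> 5 + 1 + 6 * (a - 1 - reg s'' ''r'') \<le> 6 * (a - 1 - r)"
    have "triple (If (Equal (Var ''r'') (Var ''acc''))
         (Seq (Assign ''b'' (Add (Var ''b'') (Lit 1)))
         (Seq (Assign ''acc'' (Add (Var ''acc'') (Lit (2 * l))))
           (Assign ''d'' (Add (Var ''d'') (Lit 1)))))
         (Assign ''d'' (Add (Var ''d'') (Lit 2)))) ?s1 4 ?Q'"
    proof (rule triple_If[where T = 3])
      assume eq: "bval (Equal (Var ''r'') (Var ''acc'')) ?s1"
      then have "r + 1 = x + 2 * l" using I' by simp
      then show "triple (Seq (Assign ''b'' (Add (Var ''b'') (Lit 1)))
         (Seq (Assign ''acc'' (Add (Var ''acc'') (Lit (2 * l))))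
           (Assign ''d'' (Add (Var ''d'') (Lit 1))))) ?s1 3 ?Q'"
        using bds r1 I' l x' r(2) by (intro triple_Assign_Seq triple_Assign) (auto simp: r(3))
    next
      assume eq: "\<not> bval (Equal (Var ''r'') (Var ''acc'')) ?s1"
      then have "r + 1 < x + 2 * l" using I' by simp
      then show "triple (Assign ''d'' (Add (Var ''d'') (Lit 2))) ?s1 3 ?Q'"
        using bds r1 I' l r(2) by (intro triple_Assign) (auto simp: r(3))
    qed simp
    then show "\<exists>T. triple ?P s' T (\<lambda>s''. ?I s'' \<and> T + 1 + 6 * (a - 1 - reg s'' ''r'') \<le> 6 * (a - 1 - reg s' ''r''))"
      using bds(1) r by (intro exI[of _ 5] triple_Assign_Seq) auto
  next
    fix s' assume I: "?I s'" and t: "\<not> bval (Less (Add (Var ''r'') (Lit 1)) (Var ''a'')) s'"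
    then have "reg s' ''r'' = a - 1" by auto
    moreover have "reg s' ''r'' div (2 * l) = reg s' ''b''"
      using I by (intro div_nat_eqI) (auto simp: algebra_simps)
    ultimately show "?Q s'" using I by auto
  qed (use that a in auto)
  then show ?thesis unfolding radius_prog_def using a lB l by (intro triple_Assign_Seq) auto
qed

end

text \<open>The sample and flag arrays are frozen into the parameters \<open>S\<close> and
  \<open>F\<close>: the search does not modify them, and the combinatorial argument can refer to
  fixed sets.\<close>

locale search_machine = instance_machine +
  fixes R :: nat and N :: "nat \<Rightarrow> nat" and S F :: "nat \<Rightarrow> nat \<Rightarrow> nat"
  assumes R: "R < 2 ^ L" and N_0: "N 0 = 1" and N_pos: "\<And>r. 1 \<le> N r"
    and samples: "\<And>r. r \<le> l \<Longrightarrow> sample_ok (gap (R div (2 * l)) r) (N r) (S r) (F r)"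
begin

definition b :: nat where "b = R div (2 * l)"

lemma samples_b: "r \<le> l \<Longrightarrow> sample_ok (gap b r) (N r) (S r) (F r)"
  using samples by (simp add: b_def)

sublocale level_search n E k l R b "gap b" "\<lambda>r v. S r v \<noteq> 0" "\<lambda>r v. F r v \<noteq> 0"
proof
  show "1 \<le> l" "l \<le> k" by (rule l)+
  show "b = R div (2 * l)" by (rule b_def)
  show "gap b = (\<lambda>r. (2 * r - 1) * b)" by (auto simp: gap_def)
  fix v assume v: "v < n"
  \<comment> \<open>At level 0 the balls of flagged vertices have fewer than \<open>N 0 = 1\<close>
    elements, but a ball contains its own center.\<close>
  show "\<not> F 0 v \<noteq> 0"
  proof
    assume "F 0 v \<noteq> 0"
    then have "card {u. u < n \<and> near (gap b 0) v u} < 1" using samples_b[of 0] v N_0 by (auto simp: sample_ok_def)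
    then have "{u. u < n \<and> near (gap b 0) v u} = {}" by simp
    then show False using near_refl[OF v] v by blast
  qed
next
  fix r assume r: "r \<le> l"
  show "\<exists>s<n. S r s \<noteq> 0" using samples_b[OF r] n_pos by (auto simp: sample_ok_def intro!: exI[of _ 0])
  fix v assume "v < n" "\<not> F r v \<noteq> 0"
  then show "\<exists>s<n. S r s \<noteq> 0 \<and> near (gap b r) v s"
    using samples_b[OF r] by (auto simp: sample_ok_def hit_ok_def)
qed

lemma gap_less: "r \<le> l \<Longrightarrow> gap b r < inf_dist"
  using g_le[of r] R by (simp add: inf_dist_def)

definition env :: "state \<Rightarrow> bool" where
  "env s \<longleftrightarrow> dist_ok s \<and> reg s ''r'' = R \<and> reg s ''b'' = b \<and> reg s ''d'' = 2 * R - b \<and>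
     (\<forall>r\<le>l. arr s (sample_name r) = S r \<and> arr s (far_name r) = F r)"

lemma env_cong:
  assumes "env s" "agree_off X A s s'" "X \<subseteq> search_regs 0" "A \<subseteq> {''C'', ''c''}"
  shows "env s'"
proof -
  have X: "''n'' \<notin> X" "''p'' \<notin> X" "''r'' \<notin> X" "''b'' \<notin> X" "''d'' \<notin> X" using assms(3) search_regs_names by blast+
  have A: "''half'' \<notin> A" "''O'' \<notin> A" "''D'' \<notin> A" "sample_name r \<notin> A" "far_name r \<notin> A" for r
    using assms(4) by auto
  have "dist_ok s'" using assms(1) X A by (intro dist_ok_cong[OF _ assms(2)]) (auto simp: env_def)
  then show ?thesis
    using assms(1) X A unfolding env_def by (simp add: agree_off_reg[OF assms(2)] agree_off_arr[OF assms(2)])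
qed

definition success :: "state \<Rightarrow> bool" where
  "success s \<longleftrightarrow> reg s ''ok'' = 1 \<and> covers k (2 * R - b) (arr s ''C'') \<and> reg s ''R'' = 2 * R - b"

definition unchanged :: "state \<Rightarrow> state \<Rightarrow> bool" where
  "unchanged s s' \<longleftrightarrow> reg s' ''ok'' = reg s ''ok'' \<and> arr s' ''C'' = arr s ''C'' \<and> reg s' ''R'' = reg s ''R''"

text \<open>The search does not stop at a success: later leaves either overwrite it by another
  solution or leave it alone. The converse of \<open>G\<close> implying success is not claimed; only
  a failure is conclusive, it refutes \<open>G\<close>.\<close>

definition outcome :: "nat \<Rightarrow> bool \<Rightarrow> state \<Rightarrow> state \<Rightarrow> bool" where
  "outcome j G s s' \<longleftrightarrow> (\<forall>i<j. arr s' ''c'' i = arr s ''c'' i) \<and> (success s' \<or> unchanged s s' \<and> \<not> G)"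

lemma success_unchanged: "success s \<Longrightarrow> unchanged s s' \<Longrightarrow> success s'"
  by (simp add: success_def unchanged_def)

lemma unchanged_trans: "unchanged s s' \<Longrightarrow> unchanged s' s'' \<Longrightarrow> unchanged s s''"
  by (simp add: unchanged_def)

lemma covers_cong:
  assumes "\<And>i. i < k' \<Longrightarrow> c' i = c i" "covers k' x c"
  shows "covers k' x c'"
  using assms unfolding covers_def by metis

lemma triple_copy:
  "triple (copy_prog i) s (i + 1) (\<lambda>s'. (\<forall>j<i. arr s' ''C'' j = arr s ''c'' j) \<and> arr s' ''c'' = arr s ''c'')"
proof (induction i)
  case 0
  then show ?case by (auto intro: triple_Skip)
next
  case (Suc i)
  show ?case unfolding copy_prog.simps
  proof (rule triple_Seq_framed[OF Suc, where ?T2.0 = 1])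
    fix s' assume bd: "bounded s'" and p: "(\<forall>j<i. arr s' ''C'' j = arr s ''c'' j) \<and> arr s' ''c'' = arr s ''c''"
    show "triple (Store ''C'' (Lit i) (Cell ''c'' (Lit i))) s' 1
      (\<lambda>s'. (\<forall>j<Suc i. arr s' ''C'' j = arr s ''c'' j) \<and> arr s' ''c'' = arr s ''c'')"
      using p boundedD(2)[OF bd, of "''c''" i] by (intro triple_Store) (auto simp: less_Suc_eq)
  qed simp
qed

lemma triple_leaf:
  assumes e: "env s" and c: "\<forall>i<k. arr s ''c'' i < n"
  shows "triple (leaf_prog k) s (4 * n + k + 7) (outcome k (covers k (2 * R - b) (arr s ''c'')) s)"
  unfolding leaf_prog_def
proof (rule triple_Assign_Seq)
  let ?s = "set_reg ''bad'' (aval (Lit 0) s) s"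
  let ?t = "all_test (\<lambda>i. Neg (near_test ''v'' (Cell ''c'' (Lit i)) (Var ''d''))) k"
  let ?P = "If ?t (Assign ''bad'' (Lit 1)) Skip"
  let ?c = "arr s ''c''"
  let ?cov = "\<lambda>v. \<exists>i<k. near (2 * R - b) v (?c i)"
  have dlt: "2 * R - b < inf_dist" using R by (simp add: inf_dist_def)
  have loop: "triple (For ''v'' ''n'' ?P) ?s (4 * n + 2) (\<lambda>s'. reg s' ''bad'' = 0 \<longleftrightarrow> (\<forall>v<n. ?cov v))"
  proof (rule triple_For[where I = "\<lambda>i s'. reg s' ''bad'' = 0 \<longleftrightarrow> (\<forall>v<i. ?cov v)" and T = "\<lambda>_. 2"])
    fix i s' assume i: "i < n" "reg s' ''v'' = i" "framed (For ''v'' ''n'' ?P) ?s s'"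
      and I: "reg s' ''bad'' = 0 \<longleftrightarrow> (\<forall>v<i. ?cov v)"
    have fr: "agree_off {''v'', ''bad''} {} s s'" using i(3) by (auto simp: agree_off_def)
    have e': "env s'" by (rule env_cong[OF e fr]) (auto simp: search_regs_def)
    have c': "arr s' ''c'' = ?c" using fr by (simp add: agree_off_arr)
    have "bval (near_test ''v'' (Cell ''c'' (Lit i')) (Var ''d'')) s' \<longleftrightarrow> near (2 * R - b) i (?c i')" if "i' < k" for i'
      using near_test[of s' "''v''" i "Cell ''c'' (Lit i')" "?c i'" "Var ''d''"] e' i c c' that dlt
      by (simp add: env_def)
    then have "bval ?t s' \<longleftrightarrow> \<not> ?cov i" by auto
    then show "triple ?P s' 2 (\<lambda>s''. reg (set_reg ''v'' (Suc i) s'') ''bad'' = 0 \<longleftrightarrow> (\<forall>v<Suc i. ?cov v))"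
      using I B_pos by (intro triple_If[where T = 1] triple_Assign triple_Skip) (auto simp: less_Suc_eq)
  qed (use e in \<open>auto simp: env_def dist_ok_def\<close>)
  show "triple (Seq (For ''v'' ''n'' ?P) (If (Equal (Var ''bad'') (Lit 0))
        (Seq (copy_prog k) (Seq (Assign ''R'' (Var ''d'')) (Assign ''ok'' (Lit 1)))) Skip)) ?s
      (4 * n + k + 7 - 1) (outcome k (covers k (2 * R - b) ?c) s)"
  proof (rule triple_Seq_framed[OF loop, where ?T2.0 = "k + 4"])
    fix s2 assume f: "framed (For ''v'' ''n'' ?P) ?s s2" and p: "reg s2 ''bad'' = 0 \<longleftrightarrow> (\<forall>v<n. ?cov v)"
    have fr: "agree_off {''v'', ''bad''} {} s s2" using f by (auto simp: agree_off_def)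
    have s2: "arr s2 = arr s" "reg s2 ''d'' = 2 * R - b" "reg s2 ''ok'' = reg s ''ok''" "reg s2 ''R'' = reg s ''R''"
      using fr e by (auto simp: agree_off_def env_def)
    show "triple (If (Equal (Var ''bad'') (Lit 0))
        (Seq (copy_prog k) (Seq (Assign ''R'' (Var ''d'')) (Assign ''ok'' (Lit 1)))) Skip) s2 (k + 4)
        (outcome k (covers k (2 * R - b) ?c) s)"
    proof (rule triple_If[where T = "k + 3"])
      assume "bval (Equal (Var ''bad'') (Lit 0)) s2"
      then have cov: "covers k (2 * R - b) ?c" using p c by (simp add: covers_def)
      show "triple (Seq (copy_prog k) (Seq (Assign ''R'' (Var ''d'')) (Assign ''ok'' (Lit 1)))) s2 (k + 3)
          (outcome k (covers k (2 * R - b) ?c) s)"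
      proof (rule triple_Seq_framed[OF triple_copy, where ?T2.0 = 2])
        fix s3 assume f3: "framed (copy_prog k) s2 s3" and bd: "bounded s3"
          and q: "(\<forall>j<k. arr s3 ''C'' j = arr s2 ''c'' j) \<and> arr s3 ''c'' = arr s2 ''c''"
        have d3: "reg s3 ''d'' = 2 * R - b" using f3 mod_copy(1) s2 by (simp add: agree_off_reg)
        have "covers k (2 * R - b) (arr s3 ''C'')" by (rule covers_cong[OF _ cov]) (use q s2(1) in auto)
        then show "triple (Seq (Assign ''R'' (Var ''d'')) (Assign ''ok'' (Lit 1))) s3 2
          (outcome k (covers k (2 * R - b) ?c) s)"
          using d3 q s2(1) B_pos boundedD(1)[OF bd, of "''d''"]
          by (intro triple_Assign_Seq triple_Assign) (auto simp: outcome_def success_def)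
      qed simp
    next
      assume "\<not> bval (Equal (Var ''bad'') (Lit 0)) s2"
      then have "\<not> covers k (2 * R - b) ?c" using p by (simp add: covers_def)
      then show "triple Skip s2 (k + 3) (outcome k (covers k (2 * R - b) ?c) s)"
        using s2 by (intro triple_Skip) (auto simp: outcome_def unchanged_def)
    qed simp
  qed simp
qed auto

text \<open>Running through all \<open>n\<close> vertices has linear cost, and the expensive body is
  executed for at most \<open>M\<close> of them. By \<open>ext\<close> a guarantee about the array
  \<open>c\<close> seen by the body can be restated for the array at the start, as only the first
  \<open>j + 1\<close> entries matter.\<close>

lemma triple_branch:
  assumes e: "env s" and c: "\<forall>i<j. arr s ''c'' i < n"
    and mods: "mod_regs P \<subseteq> search_regs (Suc j)" "mod_arrs P \<subseteq> {''C'', ''c''}"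
    and t: "\<And>s' v. v < n \<Longrightarrow> reg s' (loop_name j) = v \<Longrightarrow> framed (branch_prog j t P) s s' \<Longrightarrow> env s' \<Longrightarrow> bval t s' \<longleftrightarrow> cand v"
    and P: "\<And>s'. env s' \<Longrightarrow> \<forall>i<Suc j. arr s' ''c'' i < n \<Longrightarrow> triple P s' T (outcome (Suc j) (G (arr s' ''c'')) s')"
    and ext: "\<And>c c'. (\<forall>i<Suc j. c i = c' i) \<Longrightarrow> G c \<longleftrightarrow> G c'"
    and M: "card {v. v < n \<and> cand v} \<le> M"
  shows "triple (branch_prog j t P) s (4 * n + 2 + M * T)
    (outcome j (\<exists>v<n. cand v \<and> G ((arr s ''c'')(j := v))) s)"
proof -
  let ?P = "If t (Seq (Store ''c'' (Lit j) (Var (loop_name j))) P) Skip"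
  let ?x = "loop_name j"
  have "?x \<notin> search_regs (Suc j)" by simp
  then have xP: "?x \<notin> mod_regs P" "''n'' \<notin> mod_regs P" using mods(1) search_regs_names(1) by blast+
  have "(\<Sum>i<n. if cand i then T + 2 else 2) = (\<Sum>i<n. (if cand i then T else 0) + 2)"
    by (intro sum.cong) auto
  also have "\<dots> = (\<Sum>i<n. if cand i then T else 0) + 2 * n" by (simp only: sum.distrib) simp
  also have "(\<Sum>i<n. if cand i then T else 0) = card {v. v < n \<and> cand v} * T"
  proof -
    have "(\<Sum>i<n. if cand i then T else 0) = (\<Sum>i\<in>{v. v < n \<and> cand v}. T)"
      by (rule sum.mono_neutral_cong_right) auto
    then show ?thesis by simp
  qed
  also have "card {v. v < n \<and> cand v} * T \<le> M * T" using M by (rule mult_le_mono1)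
  finally have time: "2 + 2 * n + (\<Sum>i<n. if cand i then T + 2 else 2) \<le> 4 * n + 2 + M * T" by simp
  show ?thesis unfolding branch_prog_def
  proof (rule triple_For[OF _ _ _ _ _ _ _ time, where I = "\<lambda>i s'. (\<forall>i'<j. arr s' ''c'' i' = arr s ''c'' i') \<and>
      (success s' \<or> unchanged s s' \<and> (\<forall>v<i. cand v \<longrightarrow> \<not> G ((arr s ''c'')(j := v))))"])
    fix i s' assume i: "i < n" "reg s' ?x = i" "framed (For ?x ''n'' ?P) s s'"
      and I: "(\<forall>i'<j. arr s' ''c'' i' = arr s ''c'' i') \<and>
        (success s' \<or> unchanged s s' \<and> (\<forall>v<i. cand v \<longrightarrow> \<not> G ((arr s ''c'')(j := v))))"
    have fr: "framed (branch_prog j t P) s s'" using i(3) by (simp add: branch_prog_def)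
    have "mod_regs P \<subseteq> search_regs 0" using mods(1) search_regs_mono[of 0 "Suc j"] by simp
    then have e': "env s'" using mods(2) by (intro env_cong[OF e fr]) auto
    have b: "bval t s' \<longleftrightarrow> cand i" by (rule t[OF i(1,2) fr e'])
    let ?R = "\<lambda>s''. (\<forall>i'<j. arr (set_reg ?x (Suc i) s'') ''c'' i' = arr s ''c'' i') \<and>
      (success (set_reg ?x (Suc i) s'') \<or> unchanged s (set_reg ?x (Suc i) s'') \<and>
        (\<forall>v<Suc i. cand v \<longrightarrow> \<not> G ((arr s ''c'')(j := v))))"
    have un: "success (set_reg ?x y s'') \<longleftrightarrow> success s''" "unchanged s (set_reg ?x y s'') \<longleftrightarrow> unchanged s s''" for y s''
      by (auto simp: success_def unchanged_def)
    show "triple ?P s' (if cand i then T + 2 else 2) ?R"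
    proof (rule triple_If[where T = "if cand i then T + 1 else 1"])
      assume "bval t s'"
      then have ci: "cand i" using b by simp
      let ?s2 = "s'\<lparr>arr := (arr s')(''c'' := (arr s' ''c'')(aval (Lit j) s' := aval (Var ?x) s'))\<rparr>"
      have e2: "env ?s2" by (rule env_cong[OF e', where X = "{}" and A = "{''c''}"]) (auto simp: agree_off_def)
      have c2: "arr ?s2 ''c'' = (arr s' ''c'')(j := i)" using i by simp
      have lt: "\<forall>i'<Suc j. arr ?s2 ''c'' i' < n" using c I i unfolding c2 by (auto simp: less_Suc_eq)
      have G2: "G (arr ?s2 ''c'') \<longleftrightarrow> G ((arr s ''c'')(j := i))"
        unfolding c2 by (rule ext) (use I in \<open>auto simp: less_Suc_eq\<close>)
      have "triple P ?s2 T ?R"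
      proof (rule triple_conseq[OF P[OF e2 lt]])
        fix s3 assume o: "outcome (Suc j) (G (arr ?s2 ''c'')) ?s2 s3"
        have "\<forall>i'<j. arr s3 ''c'' i' = arr s ''c'' i'" using o I unfolding outcome_def c2 by auto
        moreover have "success s3 \<or> unchanged s s3 \<and> (\<forall>v<Suc i. cand v \<longrightarrow> \<not> G ((arr s ''c'')(j := v)))"
        proof (cases "success s3")
          case False
          then have u: "unchanged ?s2 s3" and nG: "\<not> G ((arr s ''c'')(j := i))"
            using o G2 by (auto simp: outcome_def)
          have u': "unchanged s' s3" using u by (simp add: unchanged_def)
          then have "\<not> success s'" using False success_unchanged by blast
          then have "unchanged s s'" "\<forall>v<i. cand v \<longrightarrow> \<not> G ((arr s ''c'')(j := v))" using I by auto
          then show ?thesis using unchanged_trans[OF _ u'] nG by (auto simp: less_Suc_eq)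
        qed simp
        ultimately show "?R s3" unfolding un by simp
      qed simp
      then have "triple (Seq (Store ''c'' (Lit j) (Var ?x)) P) s' (T + 1) ?R"
        using i(1,2) by (intro triple_Store_Seq) (auto intro: small_le_B(1))
      then show "triple (Seq (Store ''c'' (Lit j) (Var ?x)) P) s' (if cand i then T + 1 else 1) ?R"
        using ci by simp
    next
      assume "\<not> bval t s'"
      then show "triple Skip s' (if cand i then T + 1 else 1) ?R"
        using I b unfolding un by (intro triple_Skip) (auto simp: less_Suc_eq)
    qed simp
  next
    fix s' assume "(\<forall>i'<j. arr s' ''c'' i' = arr s ''c'' i') \<and>
      (success s' \<or> unchanged s s' \<and> (\<forall>v<n. cand v \<longrightarrow> \<not> G ((arr s ''c'')(j := v))))"
    then show "outcome j (\<exists>v<n. cand v \<and> G ((arr s ''c'')(j := v))) s s'" by (auto simp: outcome_def)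
  qed (use e xP in \<open>auto simp: env_def dist_ok_def unchanged_def\<close>)
qed

end

text \<open>\<open>t\<close> is the time of a leaf; it also dominates the linear overhead of a loop,
  so one parameter serves for both.\<close>

fun enum_time :: "nat \<Rightarrow> nat \<Rightarrow> nat \<Rightarrow> nat" where
  "enum_time t M 0 = t"
| "enum_time t M (Suc q) = t + M * enum_time t M q"

text \<open>The costs of the two alternatives are added instead of taking their maximum, which only
  affects constants.\<close>

fun search_time :: "nat \<Rightarrow> (nat \<Rightarrow> nat) \<Rightarrow> (nat \<Rightarrow> nat) \<Rightarrow> nat \<Rightarrow> nat \<Rightarrow> nat \<Rightarrow> nat" where
  "search_time t N M k l 0 = t"
| "search_time t N M k l (Suc q) = 2 * t + N (l - (k - Suc q)) * search_time t N M k l q +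
     enum_time t (M (l - (k - Suc q))) (Suc q)"

context search_machine begin

definition leaf_time :: nat where "leaf_time = 4 * n + k + 7"

definition sample_bound :: "nat \<Rightarrow> nat" where
  "sample_bound r = 1 + 2 * n * (L + 1) div N r"

lemma card_sample: "r \<le> l \<Longrightarrow> card {v. v < n \<and> S r v \<noteq> 0} \<le> sample_bound r"
proof -
  assume "r \<le> l"
  then have "(card (chosen (S r)) - 1) * N r \<le> 2 * n * (L + 1)" using samples_b by (simp add: sample_ok_def)
  then have "card (chosen (S r)) - 1 \<le> 2 * n * (L + 1) div N r"
    using N_pos[of r] by (simp add: less_eq_div_iff_mult_less_eq)
  then show ?thesis by (simp add: sample_bound_def chosen_def)
qed

definition extendible :: "nat \<Rightarrow> nat \<Rightarrow> (nat \<Rightarrow> nat) \<Rightarrow> bool" where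
  "extendible r j c \<longleftrightarrow> (\<exists>c'. (\<forall>i<j. c' i = c i) \<and> (\<forall>i. j \<le> i \<and> i < k \<longrightarrow> c' i < n \<and> S r (c' i) \<noteq> 0) \<and>
     covers k (2 * R - b) c')"

lemma extendible_cong: "\<forall>i<j. c i = c' i \<Longrightarrow> extendible r j c \<longleftrightarrow> extendible r j c'"
  by (simp add: extendible_def)

lemma promising_cong: "\<forall>i<j. c i = c' i \<Longrightarrow> promising j c \<longleftrightarrow> promising j c'"
  by (simp add: promising_def)

lemma outcome_mono: "outcome j G s s' \<Longrightarrow> (G' \<Longrightarrow> G) \<Longrightarrow> outcome j G' s s'"
  by (auto simp: outcome_def)

lemma triple_enum:
  assumes r: "r \<le> l"
  shows "q \<le> k \<Longrightarrow> env s \<Longrightarrow> \<forall>i<k - q. arr s ''c'' i < n \<Longrightarrow>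
    triple (enum_prog k r q) s (enum_time leaf_time (sample_bound r) q)
      (outcome (k - q) (extendible r (k - q) (arr s ''c'')) s)"
proof (induction q arbitrary: s)
  case 0
  have "covers k (2 * R - b) (arr s ''c'')" if ext: "extendible r k (arr s ''c'')"
  proof -
    obtain c' where c': "\<forall>i<k. c' i = arr s ''c'' i" "covers k (2 * R - b) c'"
      using ext by (auto simp: extendible_def)
    show ?thesis by (rule covers_cong[OF _ c'(2)]) (use c'(1) in auto)
  qed
  note cov = this
  have "triple (leaf_prog k) s leaf_time (outcome k (extendible r k (arr s ''c'')) s)"
  proof (rule triple_conseq[OF triple_leaf[OF 0(2)]])
    fix s' assume "outcome k (covers k (2 * R - b) (arr s ''c'')) s s'"
    then show "outcome k (extendible r k (arr s ''c'')) s s'" by (rule outcome_mono) (rule cov)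
  qed (use 0(3) in \<open>auto simp: leaf_time_def\<close>)
  then show ?case by simp
next
  case (Suc q)
  define j where "j = k - Suc q"
  have j: "k - q = Suc j" "j < k" using Suc.prems(1) by (auto simp: j_def)
  let ?t = "Less (Lit 0) (Cell (sample_name r) (Var (loop_name j)))"
  have md: "mod_regs (enum_prog k r q) \<subseteq> search_regs (Suc j)" "mod_arrs (enum_prog k r q) \<subseteq> {''C'', ''c''}"
    using mod_enum[of q k r] Suc.prems(1) j by auto
  have "triple (branch_prog j ?t (enum_prog k r q)) s
      (4 * n + 2 + sample_bound r * enum_time leaf_time (sample_bound r) q)
      (outcome j (\<exists>v<n. S r v \<noteq> 0 \<and> extendible r (Suc j) ((arr s ''c'')(j := v))) s)"
  proof (rule triple_branch[where cand = "\<lambda>v. S r v \<noteq> 0" and G = "extendible r (Suc j)", OF Suc.prems(2) _ md])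
    show "\<forall>i<j. arr s ''c'' i < n" using Suc.prems(3) by (simp add: j_def)
    show "\<And>s' v. v < n \<Longrightarrow> reg s' (loop_name j) = v \<Longrightarrow> framed (branch_prog j ?t (enum_prog k r q)) s s' \<Longrightarrow> env s' \<Longrightarrow>
      bval ?t s' = (S r v \<noteq> 0)" using r by (simp add: env_def)
    show "\<And>s'. env s' \<Longrightarrow> \<forall>i<Suc j. arr s' ''c'' i < n \<Longrightarrow> triple (enum_prog k r q) s'
      (enum_time leaf_time (sample_bound r) q) (outcome (Suc j) (extendible r (Suc j) (arr s' ''c'')) s')"
      using Suc.IH Suc.prems(1) unfolding j(1) by simp
    show "\<And>c c'. \<forall>i<Suc j. c i = c' i \<Longrightarrow> extendible r (Suc j) c = extendible r (Suc j) c'"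
      by (rule extendible_cong)
    show "card {v. v < n \<and> S r v \<noteq> 0} \<le> sample_bound r" by (rule card_sample[OF r])
  qed
  then show ?case unfolding enum_prog.simps j_def[symmetric]
  proof (rule triple_conseq)
    fix s' assume "outcome j (\<exists>v<n. S r v \<noteq> 0 \<and> extendible r (Suc j) ((arr s ''c'')(j := v))) s s'"
    then show "outcome j (extendible r j (arr s ''c'')) s s'"
    proof (rule outcome_mono)
      assume "extendible r j (arr s ''c'')"
      then obtain c' where c': "\<forall>i<j. c' i = arr s ''c'' i" "\<forall>i. j \<le> i \<and> i < k \<longrightarrow> c' i < n \<and> S r (c' i) \<noteq> 0"
        "covers k (2 * R - b) c'" by (auto simp: extendible_def)
      then have "extendible r (Suc j) ((arr s ''c'')(j := c' j))"
        unfolding extendible_def by (intro exI[of _ c']) (auto simp: less_Suc_eq)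
      then show "\<exists>v<n. S r v \<noteq> 0 \<and> extendible r (Suc j) ((arr s ''c'')(j := v))" using c' j by blast
    qed
  qed (simp add: leaf_time_def)
qed

lemma triple_pivot:
  assumes e: "env s" and j: "j \<le> l" and c: "\<forall>i<j. arr s ''c'' i < n"
  shows "triple (pivot_prog l j) s (4 * n + 3) (\<lambda>s'.
    (reg s' (pivot_name j) = n \<and> (\<forall>w. uncovered j (arr s ''c'') w \<longrightarrow> \<not> F (l - j) w \<noteq> 0)) \<or>
    (uncovered j (arr s ''c'') (reg s' (pivot_name j)) \<and> F (l - j) (reg s' (pivot_name j)) \<noteq> 0))"
  unfolding pivot_prog_def
proof (rule triple_Assign_Seq)
  let ?w = "pivot_name j"
  let ?c = "arr s ''c''"
  let ?s = "set_reg ?w (aval (Var ''n'') s) s"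
  let ?t = "Conj (Less (Lit 0) (Cell (far_name (l - j)) (Var ''v''))) (all_test (uncovered_test l) j)"
  let ?P = "If ?t (Assign ?w (Var ''v'')) Skip"
  let ?hit = "\<lambda>w. uncovered j ?c w \<and> F (l - j) w \<noteq> 0"
  have n: "reg s ''n'' = n" using e by (simp add: env_def dist_ok_def)
  have nB: "n \<le> B" by (intro small_le_B(1)) simp
  show "aval (Var ''n'') s \<le> B" using n nB by simp
  let ?I = "\<lambda>i s'. reg s' ?w = n \<and> (\<forall>w<i. \<not> ?hit w) \<or> ?hit (reg s' ?w)"
  have "triple (For ''v'' ''n'' ?P) ?s (4 * n + 3 - 1) (?I n)"
  proof (rule triple_For[where I = ?I and T = "\<lambda>_. 2"])
    fix i s' assume i: "i < n" "reg s' ''v'' = i" "framed (For ''v'' ''n'' ?P) ?s s'" and I: "?I i s'"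
    have fr: "agree_off {''v'', ?w} {} s s'" using i(3) by (auto simp: agree_off_def)
    have e': "env s'" by (rule env_cong[OF e fr]) auto
    have c': "arr s' ''c'' = ?c" using fr by (simp add: agree_off_arr)
    have "bval (uncovered_test l i') s' \<longleftrightarrow> \<not> near (2 * R - gap b (l - i')) i (?c i')" if "i' < j" for i'
    proof -
      have "2 * R - gap b (l - i') < inf_dist" using R by (simp add: inf_dist_def)
      moreover have "?c i' < n" using c that by blast
      ultimately have "arr s' ''D'' (i * n + ?c i') \<le> 2 * R - gap b (l - i') \<longleftrightarrow> near (2 * R - gap b (l - i')) i (?c i')"
        using e' i(1) by (simp add: env_def dist_ok_def)
      moreover have "gap b (l - i') \<le> R" by (rule g_le) simp
      ultimately show ?thesis using e' i c' by (auto simp: uncovered_test_def env_def dist_ok_def)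
    qed
    then have t: "bval ?t s' \<longleftrightarrow> ?hit i"
      using e' i by (auto simp: env_def uncovered_def)
    show "triple ?P s' 2 (\<lambda>s''. ?I (Suc i) (set_reg ''v'' (Suc i) s''))"
      using t i nB I by (intro triple_If[where T = 1] triple_Assign triple_Skip) (auto simp: less_Suc_eq)
  qed (use n in auto)
  then show "triple (For ''v'' ''n'' ?P) ?s (4 * n + 3 - 1) (\<lambda>s'.
    (reg s' ?w = n \<and> (\<forall>w. uncovered j ?c w \<longrightarrow> \<not> F (l - j) w \<noteq> 0)) \<or> ?hit (reg s' ?w))"
    by (rule triple_conseq) (auto simp: uncovered_def)
qed simp

lemma triple_search:
  "q \<le> k \<Longrightarrow> k - q \<le> l \<Longrightarrow> env s \<Longrightarrow> \<forall>i<k - q. arr s ''c'' i < n \<Longrightarrow>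
    triple (search_prog k l q) s (search_time leaf_time N sample_bound k l q)
      (outcome (k - q) (promising (k - q) (arr s ''c'')) s)"
proof (induction q arbitrary: s)
  case 0
  have "covers k (2 * R - b) (arr s ''c'')" if "promising k (arr s ''c'')"
    using promising_complete[OF that] 0 by simp
  note cov = this
  have "triple (leaf_prog k) s leaf_time (outcome k (promising k (arr s ''c'')) s)"
  proof (rule triple_conseq[OF triple_leaf[OF 0(3)]])
    fix s' assume "outcome k (covers k (2 * R - b) (arr s ''c'')) s s'"
    then show "outcome k (promising k (arr s ''c'')) s s'" by (rule outcome_mono) (rule cov)
  qed (use 0(4) in \<open>auto simp: leaf_time_def\<close>)
  then show ?case by simp
next
  case (Suc q)
  define j where "j = k - Suc q"
  define r where "r = l - j"
  have j: "k - q = Suc j" "j < k" "j \<le> l" using Suc.prems(1,2) by (auto simp: j_def)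
  have rl: "r \<le> l" by (simp add: r_def)
  let ?c = "arr s ''c''" and ?w = "pivot_name j"
  let ?T = "search_time leaf_time N sample_bound k l q"
  let ?E = "enum_time leaf_time (sample_bound r) (Suc q)"
  let ?t = "near_test ?w (Var (loop_name j)) (gap_exp r)"
  have cj: "\<forall>i<j. ?c i < n" using Suc.prems(4) by (simp add: j_def)
  have md: "mod_regs (search_prog k l q) \<subseteq> search_regs (Suc j)" "mod_arrs (search_prog k l q) \<subseteq> {''C'', ''c''}"
    using mod_search[of q k l] Suc.prems(1) j by auto
  have "triple (Seq (pivot_prog l j) (If (Less (Var ?w) (Var ''n''))
        (branch_prog j ?t (search_prog k l q)) (enum_prog k r (Suc q)))) s
      (search_time leaf_time N sample_bound k l (Suc q)) (outcome j (promising j ?c) s)"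
  proof (rule triple_Seq_framed[OF triple_pivot[OF Suc.prems(3) j(3) cj], where ?T2.0 = "4 * n + 2 + N r * ?T + ?E + 1"])
    fix s1 assume f1: "framed (pivot_prog l j) s s1"
      and p: "(reg s1 ?w = n \<and> (\<forall>w. uncovered j ?c w \<longrightarrow> \<not> F (l - j) w \<noteq> 0)) \<or> (uncovered j ?c (reg s1 ?w) \<and> F (l - j) (reg s1 ?w) \<noteq> 0)"
    have e1: "env s1" by (rule env_cong[OF Suc.prems(3) f1]) auto
    have c1: "arr s1 ''c'' = ?c" using f1 by (simp add: agree_off_arr)
    have oc: "outcome j G s1 s' \<longleftrightarrow> outcome j G s s'" for G s'
      using f1 by (simp add: outcome_def unchanged_def agree_off_reg agree_off_arr)
    have n1: "reg s1 ''n'' = n" using e1 by (simp add: env_def dist_ok_def)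
    show "triple (If (Less (Var ?w) (Var ''n'')) (branch_prog j ?t (search_prog k l q)) (enum_prog k r (Suc q))) s1
        (4 * n + 2 + N r * ?T + ?E + 1) (outcome j (promising j ?c) s)"
    proof (rule triple_If[where T = "4 * n + 2 + N r * ?T + ?E"])
      assume "bval (Less (Var ?w) (Var ''n'')) s1"
      define w where "w = reg s1 ?w"
      have w: "uncovered j ?c w" "F r w \<noteq> 0" "w < n"
        using p \<open>bval (Less (Var ?w) (Var ''n'')) s1\<close> n1 by (auto simp: w_def r_def)
      \<comment> \<open>Level 0 has no far vertices, so a pivot is found only for
        \<open>j < l\<close>. This keeps the premise \<open>k - q \<le> l\<close> true for the
        recursive search.\<close>
      have "r \<noteq> 0" using not_far_0[OF w(3)] w(2) by (metis)
      then have jl: "j < l" by (simp add: r_def)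
      have "triple (branch_prog j ?t (search_prog k l q)) s1 (4 * n + 2 + N r * ?T)
        (outcome j (\<exists>v<n. near (gap b r) w v \<and> promising (Suc j) ((arr s1 ''c'')(j := v))) s1)"
      proof (rule triple_branch[where cand = "near (gap b r) w" and G = "promising (Suc j)", OF e1 _ md])
        show "\<forall>i<j. arr s1 ''c'' i < n" using cj c1 by simp
        fix s' v assume v: "v < n" "reg s' (loop_name j) = v" "framed (branch_prog j ?t (search_prog k l q)) s1 s'" "env s'"
        have "?w \<notin> search_regs (Suc j)" by simp
        then have "reg s' ?w = w" using v(3) md(1) unfolding w_def by (intro agree_off_reg[OF v(3)]) auto
        then show "bval ?t s' \<longleftrightarrow> near (gap b r) w v"
          using near_test[of s' ?w w "Var (loop_name j)" v "gap_exp r"] v w(3) gap_less[OF rl] by (simp add: env_def)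
      next
        show "\<And>s'. env s' \<Longrightarrow> \<forall>i<Suc j. arr s' ''c'' i < n \<Longrightarrow> triple (search_prog k l q) s' ?T
          (outcome (Suc j) (promising (Suc j) (arr s' ''c'')) s')"
          using Suc.IH Suc.prems(1) jl unfolding j(1) by simp
        show "\<And>c c'. \<forall>i<Suc j. c i = c' i \<Longrightarrow> promising (Suc j) c = promising (Suc j) c'" by (rule promising_cong)
        have "card {u. u < n \<and> near (gap b r) w u} < N r" using samples_b[OF rl] w by (auto simp: sample_ok_def)
        then show "card {v. v < n \<and> near (gap b r) w v} \<le> N r" by simp
      qed
      then show "triple (branch_prog j ?t (search_prog k l q)) s1 (4 * n + 2 + N r * ?T + ?E) (outcome j (promising j ?c) s)"
      proof (rule triple_conseq)
        fix s' assume "outcome j (\<exists>v<n. near (gap b r) w v \<and> promising (Suc j) ((arr s1 ''c'')(j := v))) s1 s'"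
        then show "outcome j (promising j ?c) s s'" unfolding oc
          by (rule outcome_mono) (use promising_branch[OF jl _ w(1)] c1 in \<open>auto simp: r_def\<close>)
      qed simp
    next
      assume "\<not> bval (Less (Var ?w) (Var ''n'')) s1"
      then have nofar: "\<forall>w. uncovered j ?c w \<longrightarrow> \<not> F (l - j) w \<noteq> 0"
        using p n1 by (auto simp: uncovered_def)
      have "triple (enum_prog k r (Suc q)) s1 ?E (outcome (k - Suc q) (extendible r (k - Suc q) (arr s1 ''c'')) s1)"
        by (rule triple_enum[OF rl Suc.prems(1) e1]) (use cj c1 j_def in auto)
      then show "triple (enum_prog k r (Suc q)) s1 (4 * n + 2 + N r * ?T + ?E) (outcome j (promising j ?c) s)"
      proof (rule triple_conseq)
        fix s' assume "outcome (k - Suc q) (extendible r (k - Suc q) (arr s1 ''c'')) s1 s'"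
        then show "outcome j (promising j ?c) s s'" unfolding j_def[symmetric] oc
        proof (rule outcome_mono)
          assume "promising j ?c"
          then show "extendible r j (arr s1 ''c'')"
            using promising_sample[OF j(3) _ cj nofar] unfolding extendible_def c1 r_def by blast
        qed
      qed simp
    qed simp
  qed (simp add: j_def[symmetric] r_def[symmetric] leaf_time_def)
  then show ?case unfolding search_prog.simps j_def[symmetric] r_def[symmetric] .
qed

end

section \<open>The complete algorithm\<close>

text \<open>With \<open>q = k - l + r\<close> missing centers, the exponent
  \<open>r * (2 * q + 1 - r) / (2 * q * (q + 1))\<close> of the ball size makes enumerating
  \<open>q\<close> sample vertices as expensive as branching over a ball. It is kept as a fraction
  of integers, as \<open>size_prog\<close> needs it.\<close>

definition size_num :: "nat \<Rightarrow> nat \<Rightarrow> nat \<Rightarrow> nat" where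
  "size_num k l r = r * (2 * (k - l + r) + 1 - r)"

definition size_den :: "nat \<Rightarrow> nat \<Rightarrow> nat \<Rightarrow> nat" where
  "size_den k l r = 2 * (k - l + r) * (k - l + r + 1)"

fun samples_prog :: "nat \<Rightarrow> nat \<Rightarrow> nat \<Rightarrow> com" where
  "samples_prog k l 0 = sample_prog (size_num k l 0) (size_den k l 0) 0"
| "samples_prog k l (Suc r) = Seq (samples_prog k l r) (sample_prog (size_num k l (Suc r)) (size_den k l (Suc r)) (Suc r))"

definition attempt_prog :: "nat \<Rightarrow> nat \<Rightarrow> com" where
  "attempt_prog k l = Seq (radius_prog l) (Seq (samples_prog k l l)
     (Seq (Assign ''ok'' (Lit 0)) (search_prog k l k)))"

text \<open>\<open>lo\<close> and \<open>a\<close> are radii plus 1, so that \<open>lo = 0\<close>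
  can mean that no radius has failed yet.\<close>

definition bisect_prog :: "nat \<Rightarrow> nat \<Rightarrow> com" where
  "bisect_prog k l = While (Less (Lit 0) (Var ''st''))
     (Seq (Assign ''a'' (Add (Var ''lo'') (Var ''st'')))
     (Seq (attempt_prog k l)
     (Seq (If (Equal (Var ''ok'') (Lit 0)) (Assign ''lo'' (Var ''a'')) Skip)
       (Assign ''st'' (Cell ''half'' (Var ''st''))))))"

text \<open>The first trial uses \<open>R = 2 ^ L - 1 \<ge> n - 1\<close>: its failure proves the
  k-radius infinite, its success provides the upper end of the bisection.\<close>

definition optimize_prog :: "nat \<Rightarrow> nat \<Rightarrow> com" where
  "optimize_prog k l = Seq (Assign ''a'' (Var ''p'')) (Seq (attempt_prog k l)
     (If (Equal (Var ''ok'') (Lit 0)) (Assign ''inf'' (Lit 1))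
       (Seq (Assign ''lo'' (Lit 0)) (Seq (Assign ''st'' (Cell ''half'' (Var ''p''))) (bisect_prog k l)))))"

definition mark_prog :: "aexp \<Rightarrow> com" where
  "mark_prog e = If (Equal (Cell ''mark'' e) (Lit 0))
     (Seq (Store ''mark'' e (Lit 1)) (Assign ''cnt'' (Add (Var ''cnt'') (Lit 1)))) Skip"

text \<open>The search may repeat centers, but the output needs \<open>k\<close> different ones.
  Further vertices are added to those found, which cannot spoil the covering.\<close>

definition distinct_prog :: "nat \<Rightarrow> com" where
  "distinct_prog k = Seq (Assign ''k'' (Lit k)) (Seq (Assign ''cnt'' (Lit 0))
     (Seq (For ''i'' ''k'' (mark_prog (Cell ''C'' (Var ''i''))))
     (Seq (For ''v'' ''n'' (If (Less (Var ''cnt'') (Var ''k'')) (mark_prog (Var ''v'')) Skip))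
     (Seq (Assign ''j'' (Lit 0))
       (For ''v'' ''n'' (If (Less (Lit 0) (Cell ''mark'' (Var ''v'')))
         (Seq (Store ''C'' (Var ''j'') (Var ''v'')) (Assign ''j'' (Add (Var ''j'') (Lit 1)))) Skip))))))"

definition k_center_prog :: "nat \<Rightarrow> nat \<Rightarrow> com" where
  "k_center_prog k l = Seq distances_prog (Seq (optimize_prog k l) (distinct_prog k))"

lemma mod_samples:
  "mod_regs (samples_prog k l i) = {''x'', ''t'', ''N'', ''y'', ''v'', ''cnt'', ''w'', ''T''}"
  "mod_arrs (samples_prog k l i) = {''hv''} \<union> (\<lambda>r. far_name r) ` {..i} \<union> (\<lambda>r. sample_name r) ` {..i}"
  by (induction i) (auto simp: atMost_Suc)

definition attempt_regs :: "string set" where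
  "attempt_regs = {''r'', ''b'', ''acc'', ''d'', ''x'', ''t'', ''N'', ''y'', ''v'', ''cnt'', ''w'', ''T'', ''ok''} \<union> search_regs 0"

definition attempt_arrs :: "string set" where
  "attempt_arrs = {''hv'', ''C'', ''c''} \<union> range (\<lambda>r. far_name r) \<union> range (\<lambda>r. sample_name r)"

lemma mod_attempt: "mod_regs (attempt_prog k l) \<subseteq> attempt_regs" "mod_arrs (attempt_prog k l) \<subseteq> attempt_arrs"
  using mod_search[of k k l] by (auto simp: attempt_prog_def mod_samples radius_prog_def attempt_regs_def attempt_arrs_def)

lemma attempt_names [simp]:
  "''n'' \<notin> attempt_regs" "''p'' \<notin> attempt_regs" "''a'' \<notin> attempt_regs" "''lo'' \<notin> attempt_regs" "''st'' \<notin> attempt_regs"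
  "''inf'' \<notin> attempt_regs"
  "''half'' \<notin> attempt_arrs" "''O'' \<notin> attempt_arrs" "''D'' \<notin> attempt_arrs" "''mark'' \<notin> attempt_arrs"
  by (auto simp: attempt_regs_def attempt_arrs_def search_regs_def)

context instance_machine begin

definition ball_size :: "nat \<Rightarrow> nat" where
  "ball_size r = 2 ^ size_exp (size_num k l r) (size_den k l r)"

definition sample_size :: "nat \<Rightarrow> nat" where
  "sample_size r = 1 + 2 * n * (L + 1) div ball_size r"

definition sampling_time :: nat where
  "sampling_time = (L + 2) * (8 * (n * n) + 22 * n + 16)"

definition attempt_time :: nat where
  "attempt_time = 12 * n + 6 + (l + 1) * sampling_time + search_time (4 * n + k + 7) ball_size sample_size k l k"

lemma size_num_le: "r \<le> l \<Longrightarrow> size_num k l r \<le> size_den k l r"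
proof -
  assume "r \<le> l"
  have "r * (2 * (k - l + r) + 1 - r) \<le> (k - l + r) * (2 * (k - l + r + 1))" by (intro mult_le_mono) auto
  then show ?thesis by (simp add: size_num_def size_den_def mult.commute mult.left_commute)
qed

lemma size_den_le: "r \<le> l \<Longrightarrow> size_den k l r \<le> 2 * (k + 1) * (k + 1)"
  unfolding size_den_def using l by (intro mult_le_mono) auto

lemma triple_samples:
  assumes s: "dist_ok s" "reg s ''b'' = b" "\<forall>r\<le>l. gap b r < inf_dist"
  shows "i \<le> l \<Longrightarrow> triple (samples_prog k l i) s ((i + 1) * sampling_time)
    (\<lambda>s'. \<forall>r\<le>i. sample_ok (gap b r) (ball_size r) (arr s' (sample_name r)) (arr s' (far_name r)))"
proof (induction i)
  case 0
  have "triple (sample_prog (size_num k l 0) (size_den k l 0) 0) s sampling_time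
    (\<lambda>s'. sample_ok (gap b 0) (ball_size 0) (arr s' (sample_name 0)) (arr s' (far_name 0)))"
    unfolding sampling_time_def ball_size_def
    by (rule triple_sample[OF s(1,2) _ size_num_le size_den_le]) (use s(3) in auto)
  then show ?case by simp
next
  case (Suc i)
  have "triple (Seq (samples_prog k l i) (sample_prog (size_num k l (Suc i)) (size_den k l (Suc i)) (Suc i))) s
    ((i + 1) * sampling_time + sampling_time)
    (\<lambda>s'. \<forall>r\<le>Suc i. sample_ok (gap b r) (ball_size r) (arr s' (sample_name r)) (arr s' (far_name r)))"
  proof (rule triple_Seq_framed[OF Suc.IH])
    show "i \<le> l" using Suc.prems by simp
    fix s1 assume f: "framed (samples_prog k l i) s s1"
      and p: "\<forall>r\<le>i. sample_ok (gap b r) (ball_size r) (arr s1 (sample_name r)) (arr s1 (far_name r))"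
    have d1: "dist_ok s1" by (rule dist_ok_cong[OF s(1) f]) (auto simp: mod_samples)
    have b1: "reg s1 ''b'' = b" using s f by (simp add: agree_off_reg mod_samples)
    have "triple (sample_prog (size_num k l (Suc i)) (size_den k l (Suc i)) (Suc i)) s1 sampling_time
      (\<lambda>s'. sample_ok (gap b (Suc i)) (ball_size (Suc i)) (arr s' (sample_name (Suc i))) (arr s' (far_name (Suc i))))"
      unfolding sampling_time_def ball_size_def
      by (rule triple_sample[OF d1 b1 _ size_num_le[OF Suc.prems] size_den_le[OF Suc.prems]]) (use s(3) Suc.prems in auto)
    then show "triple (sample_prog (size_num k l (Suc i)) (size_den k l (Suc i)) (Suc i)) s1 sampling_time
      (\<lambda>s'. \<forall>r\<le>Suc i. sample_ok (gap b r) (ball_size r) (arr s' (sample_name r)) (arr s' (far_name r)))"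
    proof (rule triple_conseq)
      fix s2 assume f2: "framed (sample_prog (size_num k l (Suc i)) (size_den k l (Suc i)) (Suc i)) s1 s2"
        and q: "sample_ok (gap b (Suc i)) (ball_size (Suc i)) (arr s2 (sample_name (Suc i))) (arr s2 (far_name (Suc i)))"
      have ar: "arr s2 (sample_name r) = arr s1 (sample_name r)" "arr s2 (far_name r) = arr s1 (far_name r)" if "r \<le> i" for r
        using f2 that by (auto intro!: agree_off_arr simp del: replicate.simps)
      show "\<forall>r\<le>Suc i. sample_ok (gap b r) (ball_size r) (arr s2 (sample_name r)) (arr s2 (far_name r))"
      proof (intro allI impI)
        fix r assume "r \<le> Suc i"
        then show "sample_ok (gap b r) (ball_size r) (arr s2 (sample_name r)) (arr s2 (far_name r))"
          by (cases "r = Suc i") (use q ar[of r] p in auto)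
      qed
    qed simp
  qed simp
  then show ?case by (simp add: algebra_simps)
qed

text \<open>A success may also occur for an infeasible \<open>R\<close>; only a failure is
  conclusive. So the radii at which the search succeeds need not form an interval.\<close>

definition attempted :: "nat \<Rightarrow> state \<Rightarrow> state \<Rightarrow> bool" where
  "attempted R s s' \<longleftrightarrow>
     (reg s' ''ok'' = 1 \<and> covers k (2 * R - R div (2 * l)) (arr s' ''C'') \<and> reg s' ''R'' = 2 * R - R div (2 * l)) \<or>
     (reg s' ''ok'' = 0 \<and> arr s' ''C'' = arr s ''C'' \<and> reg s' ''R'' = reg s ''R'' \<and> \<not> (\<exists>c. covers k R c))"

lemma triple_attempt:
  assumes d: "dist_ok s" and a: "reg s ''a'' = a" "1 \<le> a" "a \<le> 2 ^ L"
  shows "triple (attempt_prog k l) s attempt_time (attempted (a - 1) s)"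
proof -
  define R where "R = a - 1"
  define bb where "bb = R div (2 * l)"
  have RL: "R < 2 ^ L" using a by (simp add: R_def)
  have gl: "\<forall>r\<le>l. gap bb r < inf_dist"
  proof (intro allI impI)
    fix r assume "r \<le> l"
    then have "gap bb r \<le> 2 * l * bb" unfolding gap_def by (intro mult_le_mono1) simp
    also have "\<dots> \<le> R" by (simp add: bb_def)
    finally show "gap bb r < inf_dist" using RL by (simp add: inf_dist_def)
  qed
  let ?ST = "search_time (4 * n + k + 7) ball_size sample_size k l k"
  have a2: "a \<le> 2 * n" using a L_less by simp
  show ?thesis unfolding attempt_prog_def
  proof (rule triple_Seq_framed[OF triple_radius[OF a(1,2) a2], where ?T2.0 = "(l + 1) * sampling_time + (1 + ?ST)"])
    fix s1 assume f1: "framed (radius_prog l) s s1"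
      and p1: "reg s1 ''r'' = a - 1 \<and> reg s1 ''b'' = (a - 1) div (2 * l) \<and> reg s1 ''d'' = 2 * (a - 1) - (a - 1) div (2 * l)"
    have d1: "dist_ok s1" by (rule dist_ok_cong[OF d f1]) auto
    have r1: "reg s1 ''r'' = R" "reg s1 ''b'' = bb" "reg s1 ''d'' = 2 * R - bb" using p1 by (auto simp: R_def bb_def)
    show "triple (Seq (samples_prog k l l) (Seq (Assign ''ok'' (Lit 0)) (search_prog k l k))) s1
      ((l + 1) * sampling_time + (1 + ?ST)) (attempted (a - 1) s)"
    proof (rule triple_Seq_framed[OF triple_samples[OF d1 r1(2) gl order_refl]])
      fix s2 assume f2: "framed (samples_prog k l l) s1 s2"
        and p2: "\<forall>r\<le>l. sample_ok (gap bb r) (ball_size r) (arr s2 (sample_name r)) (arr s2 (far_name r))"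
      have d2: "dist_ok s2" by (rule dist_ok_cong[OF d1 f2]) (auto simp: mod_samples)
      interpret search_machine B Z n E k l es R ball_size "\<lambda>r. arr s2 (sample_name r)" "\<lambda>r. arr s2 (far_name r)"
      proof
        show "R < 2 ^ L" by (rule RL)
        have "size_exp (size_num k l 0) (size_den k l 0) = 0"
          unfolding size_exp_def by (rule Least_eq_0) (simp add: size_num_def)
        then show "ball_size 0 = 1" by (simp add: ball_size_def)
        show "\<And>r. 1 \<le> ball_size r" by (simp add: ball_size_def)
        show "\<And>r. r \<le> l \<Longrightarrow> sample_ok (gap (R div (2 * l)) r) (ball_size r) (arr s2 (sample_name r)) (arr s2 (far_name r))"
          using p2 by (simp add: bb_def)
      qed
      let ?s3 = "set_reg ''ok'' (aval (Lit 0) s2) s2"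
      have r2: "reg s2 ''r'' = R" "reg s2 ''b'' = bb" "reg s2 ''d'' = 2 * R - bb"
        using f2 r1 by (simp_all add: agree_off_reg mod_samples)
      have bb: "b = bb" by (simp add: b_def bb_def)
      have e3: "env ?s3" using d2 r2 by (simp add: env_def bb dist_ok_def)
      have sm: "arr s2 ''C'' = arr s ''C''" "reg s2 ''R'' = reg s ''R''"
      proof -
        have "''C'' \<notin> mod_arrs (samples_prog k l l)" by (auto simp: mod_samples)
        then show "arr s2 ''C'' = arr s ''C''" using f1 by (simp add: agree_off_arr[OF f2] agree_off_arr)
        show "reg s2 ''R'' = reg s ''R''" using f1 f2 by (simp add: agree_off_reg mod_samples)
      qed
      have tr: "triple (search_prog k l k) ?s3 (search_time leaf_time ball_size sample_bound k l k)
          (outcome (k - k) (promising (k - k) (arr ?s3 ''c'')) ?s3)"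
        by (rule triple_search) (use e3 in auto)
      have sb: "sample_bound = sample_size" by (auto simp: sample_bound_def sample_size_def)
      have "triple (search_prog k l k) ?s3 ?ST (attempted R s)"
      proof (rule triple_conseq[OF tr])
        fix s4 assume "outcome (k - k) (promising (k - k) (arr ?s3 ''c'')) ?s3 s4"
        moreover have "promising (k - k) c \<longleftrightarrow> (\<exists>cs. covers k R cs)" for c by (simp add: promising_def)
        ultimately have "success s4 \<or> unchanged ?s3 s4 \<and> \<not> (\<exists>cs. covers k R cs)"
          by (simp only: outcome_def)
        then show "attempted R s s4"
          by (auto simp: success_def unchanged_def attempted_def sm b_def)
      qed (simp add: leaf_time_def sb)
      then show "triple (Seq (Assign ''ok'' (Lit 0)) (search_prog k l k)) s2 (1 + ?ST) (attempted (a - 1) s)"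
        by (intro triple_Assign_Seq) (auto simp: R_def)
    qed simp
  qed (simp add: attempt_time_def)
qed

section \<open>Bisection for the radius\<close>

definition optimal :: "state \<Rightarrow> bool" where
  "optimal s \<longleftrightarrow> (\<exists>R. covers k (2 * R - R div (2 * l)) (arr s ''C'') \<and> reg s ''R'' = 2 * R - R div (2 * l) \<and>
     (R = 0 \<or> \<not> (\<exists>c. covers k (R - 1) c)))"

lemma mod_bisect: "mod_regs (bisect_prog k l) \<subseteq> {''a'', ''lo'', ''st''} \<union> attempt_regs"
  "mod_arrs (bisect_prog k l) \<subseteq> attempt_arrs"
  using mod_attempt[of k l] by (auto simp: bisect_prog_def)

text \<open>The invariant keeps a success at \<open>hi - 1\<close>, whose centers and radius are
  stored, and the infeasibility of \<open>lo - 1\<close> or \<open>lo = 0\<close>. When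
  \<open>hi = lo + 1\<close>, the stored solution belongs to \<open>R = lo\<close>, and no cover
  within \<open>R - 1\<close> exists unless \<open>R = 0\<close>.\<close>

lemma triple_bisect:
  assumes d: "dist_ok s" and s: "reg s ''lo'' = 0" "reg s ''st'' = arr s ''half'' (2 ^ L)"
    and C: "covers k (2 * (2 ^ L - 1) - (2 ^ L - 1) div (2 * l)) (arr s ''C'')"
    and R: "reg s ''R'' = 2 * (2 ^ L - 1) - (2 ^ L - 1) div (2 * l)"
  shows "triple (bisect_prog k l) s (L * (attempt_time + 5) + 1) optimal"
proof -
  let ?D = "\<lambda>R. 2 * R - R div (2 * l)"
  let ?P = "(Seq (Assign ''a'' (Add (Var ''lo'') (Var ''st'')))
     (Seq (attempt_prog k l)
     (Seq (If (Equal (Var ''ok'') (Lit 0)) (Assign ''lo'' (Var ''a'')) Skip)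
       (Assign ''st'' (Cell ''half'' (Var ''st''))))))"
  \<comment> \<open>\<open>hi\<close> is no register: it exceeds \<open>lo\<close> by twice the
    current step, and by 1 when the step has become 0.\<close>
  define I where "I = (\<lambda>s::state. \<exists>hi \<le> 2 ^ L. covers k (?D (hi - 1)) (arr s ''C'') \<and> reg s ''R'' = ?D (hi - 1) \<and>
    (reg s ''lo'' = 0 \<or> \<not> (\<exists>c. covers k (reg s ''lo'' - 1) c)) \<and>
    (reg s ''st'' = 0 \<and> hi = reg s ''lo'' + 1 \<or> (\<exists>i<L. reg s ''st'' = 2 ^ i \<and> hi = reg s ''lo'' + 2 ^ Suc i)))"
  define \<Phi> where "\<Phi> = (\<lambda>s::state. (if reg s ''st'' = 0 then 0 else floorlog 2 (reg s ''st'')) * (attempt_time + 5))"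
  have half: "arr s' ''half'' (2 ^ i) = (if i = 0 then 0 else 2 ^ (i - 1))" if "dist_ok s'" "i \<le> L" for s' i
    using that by (cases i) (auto simp: dist_ok_def half_ok_def)
  have pB: "2 ^ L \<le> B" using L_less by (intro small_le_B(1)) simp
  show ?thesis unfolding bisect_prog_def
  proof (rule triple_While[where I = I and \<Phi> = \<Phi>])
    show "I s" unfolding I_def using C R s half[OF d order_refl]
      by (intro exI[of _ "2 ^ L"]) (cases L, auto)
    show "\<Phi> s + 1 \<le> L * (attempt_time + 5) + 1"
      using s half[OF d order_refl] by (cases L) (auto simp: \<Phi>_def floorlog_two_power)
  next
    fix s' assume "I s'" and t: "bval (Less (Lit 0) (Var ''st'')) s'" and f: "framed ?P s s'"
    have fa: "agree_off ({''a'', ''lo'', ''st''} \<union> attempt_regs) attempt_arrs s s'"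
      using f by (rule agree_off_mono) (use mod_attempt in auto)
    have d': "dist_ok s'" by (rule dist_ok_cong[OF d fa]) auto
    define lo where "lo = reg s' ''lo''"
    obtain hi i where hi: "hi \<le> 2 ^ L" "covers k (?D (hi - 1)) (arr s' ''C'')" "reg s' ''R'' = ?D (hi - 1)"
      "lo = 0 \<or> \<not> (\<exists>c. covers k (lo - 1) c)" and i: "i < L" "reg s' ''st'' = 2 ^ i" "hi = lo + 2 ^ Suc i"
      using \<open>I s'\<close> t unfolding I_def lo_def by auto
    define a where "a = lo + 2 ^ i"
    have "(1::nat) \<le> 2 ^ i" by simp
    then have a: "1 \<le> a" "a \<le> 2 ^ L" using hi(1) i(3) unfolding a_def power_Suc by linarith+
    let ?s1 = "set_reg ''a'' (aval (Add (Var ''lo'') (Var ''st'')) s') s'"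
    have a1: "reg ?s1 ''a'' = a" using i by (simp add: a_def lo_def)
    have d1: "dist_ok ?s1" using d' by (simp add: dist_ok_def)
    have hi': "arr s' ''half'' (2 ^ i) = (if i = 0 then 0 else 2 ^ (i - 1))" using half[OF d'] i by simp
    have \<Phi>': "attempt_time + 4 + 1 + \<Phi> s'' \<le> \<Phi> s'" if "reg s'' ''st'' = arr s' ''half'' (2 ^ i)" for s''
    proof -
      have "\<Phi> s' = Suc i * (attempt_time + 5)" using i(2) by (simp add: \<Phi>_def floorlog_two_power)
      moreover have "\<Phi> s'' = i * (attempt_time + 5)"
        using that hi' by (cases i) (auto simp: \<Phi>_def floorlog_two_power)
      ultimately show ?thesis by simp
    qed
    let ?rest = "Seq (If (Equal (Var ''ok'') (Lit 0)) (Assign ''lo'' (Var ''a'')) Skip) (Assign ''st'' (Cell ''half'' (Var ''st'')))"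
    let ?Q = "\<lambda>s''. I s'' \<and> attempt_time + 4 + 1 + \<Phi> s'' \<le> \<Phi> s'"
    have "triple (Seq (attempt_prog k l) ?rest) ?s1 (attempt_time + 3) ?Q"
    proof (rule triple_Seq_framed[OF triple_attempt[OF d1 a1 a], where ?T2.0 = 3])
      fix s2 assume f2: "framed (attempt_prog k l) ?s1 s2" and bd: "bounded s2" and p: "attempted (a - 1) ?s1 s2"
      have f2': "agree_off attempt_regs attempt_arrs ?s1 s2"
        using f2 by (rule agree_off_mono) (use mod_attempt in auto)
      have r2: "reg s2 ''a'' = a" "reg s2 ''lo'' = lo" "reg s2 ''st'' = 2 ^ i" "arr s2 ''half'' = arr s' ''half''"
        using agree_off_reg[OF f2'] agree_off_arr[OF f2'] a1 i(2) by (auto simp: lo_def)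
      let ?if = "If (Equal (Var ''ok'') (Lit 0)) (Assign ''lo'' (Var ''a'')) Skip"
      have "triple ?if s2 2 (\<lambda>s3. I (set_reg ''st'' (arr s' ''half'' (2 ^ i)) s3))"
      proof (rule triple_If[where T = 1])
        assume "bval (Equal (Var ''ok'') (Lit 0)) s2"
        then have p': "arr s2 ''C'' = arr s' ''C''" "reg s2 ''R'' = reg s' ''R''" "\<not> (\<exists>c. covers k (a - 1) c)"
          using p by (auto simp: attempted_def)
        have "I (set_reg ''st'' (arr s' ''half'' (2 ^ i)) (set_reg ''lo'' a s2))"
          unfolding I_def using hi p' i hi' by (intro exI[of _ hi]) (cases i, auto simp: a_def)
        then show "triple (Assign ''lo'' (Var ''a'')) s2 1 (\<lambda>s3. I (set_reg ''st'' (arr s' ''half'' (2 ^ i)) s3))"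
          using r2 a pB by (intro triple_Assign) auto
      next
        assume "\<not> bval (Equal (Var ''ok'') (Lit 0)) s2"
        then have p': "covers k (?D (a - 1)) (arr s2 ''C'')" "reg s2 ''R'' = ?D (a - 1)"
          using p by (auto simp: attempted_def)
        have "I (set_reg ''st'' (arr s' ''half'' (2 ^ i)) s2)"
          unfolding I_def using hi(4) p' i hi' r2 a(2) by (intro exI[of _ a]) (cases i, auto simp: a_def)
        then show "triple Skip s2 1 (\<lambda>s3. I (set_reg ''st'' (arr s' ''half'' (2 ^ i)) s3))" by (intro triple_Skip) auto
      qed simp
      then show "triple ?rest s2 3 ?Q"
      proof (rule triple_Seq_framed[where ?T2.0 = 1])
        fix s3 assume f3: "framed ?if s2 s3" and I3: "I (set_reg ''st'' (arr s' ''half'' (2 ^ i)) s3)"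
        have r3: "reg s3 ''st'' = 2 ^ i" "arr s3 ''half'' = arr s' ''half''"
          using f3 r2 by (simp_all add: agree_off_reg agree_off_arr)
        have "arr s' ''half'' (2 ^ i) \<le> B" using boundedD(2)[OF bd, of "''half''" "2 ^ i"] r2 by simp
        then show "triple (Assign ''st'' (Cell ''half'' (Var ''st''))) s3 1 ?Q"
          using r3 I3 \<Phi>' by (intro triple_Assign) auto
      qed simp
    qed simp
    then have "triple ?P s' (attempt_time + 4) ?Q"
      using a a1 pB by (intro triple_Assign_Seq) (auto simp: add.commute[of attempt_time 3])
    then show "\<exists>T. triple ?P s' T (\<lambda>s''. I s'' \<and> T + 1 + \<Phi> s'' \<le> \<Phi> s')" by blast
  next
    fix s' assume "I s'" and t: "\<not> bval (Less (Lit 0) (Var ''st'')) s'"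
    then show "optimal s'" unfolding I_def optimal_def by (auto intro!: exI[of _ "reg s' ''lo''"])
  qed
qed

lemma mod_optimize: "mod_regs (optimize_prog k l) \<subseteq> {''a'', ''lo'', ''st'', ''inf''} \<union> attempt_regs"
  "mod_arrs (optimize_prog k l) \<subseteq> attempt_arrs"
  using mod_attempt[of k l] mod_bisect by (auto simp: optimize_prog_def)

lemma triple_optimize:
  assumes d: "dist_ok s" and i: "reg s ''inf'' = 0" and C: "\<forall>i<k. arr s ''C'' i < n"
  shows "triple (optimize_prog k l) s ((L + 1) * (attempt_time + 5)) (\<lambda>s'. (\<forall>i<k. arr s' ''C'' i < n) \<and>
    (reg s' ''inf'' = 0 \<and> optimal s' \<or> reg s' ''inf'' = 1 \<and> \<not> (\<exists>c. covers k (n - 1) c)))" (is "triple _ _ _ ?Q")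
  unfolding optimize_prog_def
proof (rule triple_Assign_Seq)
  let ?s1 = "set_reg ''a'' (aval (Var ''p'') s) s"
  have pB: "2 ^ L \<le> B" using L_less by (intro small_le_B(1)) simp
  have p: "reg s ''p'' = 2 ^ L" using d by (simp add: dist_ok_def)
  show "aval (Var ''p'') s \<le> B" using p pB by simp
  have d1: "dist_ok ?s1" using d by (simp add: dist_ok_def)
  let ?tail = "Seq (Assign ''lo'' (Lit 0)) (Seq (Assign ''st'' (Cell ''half'' (Var ''p''))) (bisect_prog k l))"
  show "triple (Seq (attempt_prog k l) (If (Equal (Var ''ok'') (Lit 0)) (Assign ''inf'' (Lit 1)) ?tail)) ?s1
    ((L + 1) * (attempt_time + 5) - 1) ?Q"
  proof (rule triple_Seq_framed[OF triple_attempt[OF d1, where a = "2 ^ L"], where ?T2.0 = "L * (attempt_time + 5) + 4"])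
    fix s2 assume f2: "framed (attempt_prog k l) ?s1 s2" and bd: "bounded s2" and at: "attempted (2 ^ L - 1) ?s1 s2"
    have f2': "agree_off attempt_regs attempt_arrs ?s1 s2"
      using f2 by (rule agree_off_mono) (use mod_attempt in auto)
    have d2: "dist_ok s2" by (rule dist_ok_cong[OF d1 f2']) auto
    have i2: "reg s2 ''inf'' = 0" using agree_off_reg[OF f2', of "''inf''"] i by simp
    show "triple (If (Equal (Var ''ok'') (Lit 0)) (Assign ''inf'' (Lit 1)) ?tail) s2 (L * (attempt_time + 5) + 4) ?Q"
    proof (rule triple_If[where T = "L * (attempt_time + 5) + 3"])
      assume "bval (Equal (Var ''ok'') (Lit 0)) s2"
      then have a: "arr s2 ''C'' = arr s ''C''" "\<not> (\<exists>c. covers k (2 ^ L - 1) c)" using at by (auto simp: attempted_def)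
      have "n - 1 \<le> 2 ^ L - 1" using L_ge by (rule diff_le_mono)
      then have "\<not> (\<exists>c. covers k (n - 1) c)" using a(2) covers_mono by blast
      then show "triple (Assign ''inf'' (Lit 1)) s2 (L * (attempt_time + 5) + 3) ?Q"
        using a(1) C B_pos by (intro triple_Assign) auto
    next
      assume "\<not> bval (Equal (Var ''ok'') (Lit 0)) s2"
      then have a: "covers k (2 * (2 ^ L - 1) - (2 ^ L - 1) div (2 * l)) (arr s2 ''C'')"
        "reg s2 ''R'' = 2 * (2 ^ L - 1) - (2 ^ L - 1) div (2 * l)" using at by (auto simp: attempted_def)
      let ?s3 = "set_reg ''st'' (arr s2 ''half'' (2 ^ L)) (set_reg ''lo'' 0 s2)"
      have "triple (bisect_prog k l) ?s3 (L * (attempt_time + 5) + 1) optimal"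
        by (rule triple_bisect) (use d2 a in \<open>auto simp: dist_ok_def\<close>)
      then have "triple (bisect_prog k l) ?s3 (L * (attempt_time + 5) + 1) ?Q"
      proof (rule triple_conseq)
        fix s4 assume f4: "framed (bisect_prog k l) ?s3 s4" and o: "optimal s4"
        have "''inf'' \<notin> mod_regs (bisect_prog k l)" using mod_bisect(1) attempt_names(6) by auto
        then have "reg s4 ''inf'' = 0" using agree_off_reg[OF f4] i2 by simp
        then show "?Q s4" using o by (auto simp: optimal_def covers_def)
      qed simp
      moreover have "reg s2 ''p'' = 2 ^ L" using d2 by (simp add: dist_ok_def)
      ultimately show "triple ?tail s2 (L * (attempt_time + 5) + 3) ?Q"
        using boundedD(2)[OF bd] by (intro triple_Assign_Seq) auto
    qed simp
  qed (use p in auto)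
qed simp

section \<open>Completion to exactly \<open>k\<close> distinct centers\<close>

lemma mod_mark [simp]: "mod_regs (mark_prog e) = {''cnt''}" "mod_arrs (mark_prog e) = {''mark''}"
  by (auto simp: mark_prog_def)

lemma triple_mark:
  assumes "aval e s = x" "x < n" "reg s ''cnt'' = card (chosen (arr s ''mark''))"
  shows "triple (mark_prog e) s 3 (\<lambda>s'. chosen (arr s' ''mark'') = insert x (chosen (arr s ''mark'')) \<and>
    reg s' ''cnt'' = card (chosen (arr s' ''mark'')))"
proof -
  let ?M = "arr s ''mark''"
  have ch: "chosen (?M(x := 1)) = insert x (chosen ?M)" using assms by (auto simp: chosen_def)
  have "card (chosen ?M) \<le> card {..<n}" by (intro card_mono) (auto simp: chosen_def)
  then have cB: "Suc (card (chosen ?M)) \<le> B" by (intro small_le_B(1)) simp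
  show ?thesis unfolding mark_prog_def
  proof (rule triple_If[where T = 2])
    assume "bval (Equal (Cell ''mark'' e) (Lit 0)) s"
    then have "x \<notin> chosen ?M" using assms by (simp add: chosen_def)
    then show "triple (Seq (Store ''mark'' e (Lit 1)) (Assign ''cnt'' (Add (Var ''cnt'') (Lit 1)))) s 2
      (\<lambda>s'. chosen (arr s' ''mark'') = insert x (chosen ?M) \<and> reg s' ''cnt'' = card (chosen (arr s' ''mark'')))"
      using assms ch cB B_pos by (intro triple_Store_Seq triple_Assign) auto
  next
    assume "\<not> bval (Equal (Cell ''mark'' e) (Lit 0)) s"
    then have "x \<in> chosen ?M" using assms by (simp add: chosen_def)
    then have "insert x (chosen ?M) = chosen ?M" by auto
    then show "triple Skip s 2
      (\<lambda>s'. chosen (arr s' ''mark'') = insert x (chosen ?M) \<and> reg s' ''cnt'' = card (chosen (arr s' ''mark'')))"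
      using assms by (intro triple_Skip) auto
  qed simp
qed

lemma triple_distinct:
  assumes n: "reg s ''n'' = n" and mk: "arr s ''mark'' = (\<lambda>_. 0)" and C: "\<forall>i<k. arr s ''C'' i < n"
  shows "triple (distinct_prog k) s (11 * n + 5 * k + 9) (\<lambda>s'. arr s' ''C'' ` {..<k} \<subseteq> {..<n} \<and>
    card (arr s' ''C'' ` {..<k}) = k \<and> arr s ''C'' ` {..<k} \<subseteq> arr s' ''C'' ` {..<k})" (is "triple _ _ _ ?Q")
proof -
  let ?A = "For ''i'' ''k'' (mark_prog (Cell ''C'' (Var ''i'')))"
  let ?B = "For ''v'' ''n'' (If (Less (Var ''cnt'') (Var ''k'')) (mark_prog (Var ''v'')) Skip)"
  let ?body = "If (Less (Lit 0) (Cell ''mark'' (Var ''v'')))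
         (Seq (Store ''C'' (Var ''j'') (Var ''v'')) (Assign ''j'' (Add (Var ''j'') (Lit 1)))) Skip"
  let ?F = "For ''v'' ''n'' ?body"
  let ?K = "arr s ''C'' ` {..<k}"
  have kB: "k \<le> B" using kn by (intro small_le_B(1)) simp
  have A: "triple ?A s1 (5 * k + 2) (\<lambda>s'. chosen (arr s' ''mark'') = ?K \<and> reg s' ''cnt'' = card ?K)"
    if s1: "reg s1 ''k'' = k" "reg s1 ''cnt'' = 0" "arr s1 = arr s" for s1
  proof (rule triple_For[where T = "\<lambda>_. 3" and I = "\<lambda>i s'. chosen (arr s' ''mark'') = arr s ''C'' ` {..<i} \<and>
      reg s' ''cnt'' = card (arr s ''C'' ` {..<i})"])
    fix i s' assume i: "i < k" "reg s' ''i'' = i" "framed ?A s1 s'"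
      and I: "chosen (arr s' ''mark'') = arr s ''C'' ` {..<i} \<and> reg s' ''cnt'' = card (arr s ''C'' ` {..<i})"
    have c': "arr s' ''C'' = arr s ''C''" using i(3) s1 by (simp add: agree_off_arr)
    show "triple (mark_prog (Cell ''C'' (Var ''i''))) s' 3
      (\<lambda>s''. chosen (arr (set_reg ''i'' (Suc i) s'') ''mark'') = arr s ''C'' ` {..<Suc i} \<and>
        reg (set_reg ''i'' (Suc i) s'') ''cnt'' = card (arr s ''C'' ` {..<Suc i}))"
      by (rule triple_conseq[OF triple_mark[where x = "arr s ''C'' i"]]) (use i I C c' in \<open>auto simp: lessThan_Suc\<close>)
  qed (use s1 mk in \<open>auto simp: chosen_def\<close>)
  have B: "triple ?B s1 (6 * n + 2) (\<lambda>s'. ?K \<subseteq> chosen (arr s' ''mark'') \<and> card (chosen (arr s' ''mark'')) = k)"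
    if s1: "reg s1 ''n'' = n" "reg s1 ''k'' = k" "chosen (arr s1 ''mark'') = ?K" "reg s1 ''cnt'' = card ?K" for s1
  proof (rule triple_For[where T = "\<lambda>_. 4" and I = "\<lambda>i s'. ?K \<subseteq> chosen (arr s' ''mark'') \<and>
      reg s' ''cnt'' = card (chosen (arr s' ''mark'')) \<and> reg s' ''cnt'' \<le> k \<and>
      (reg s' ''cnt'' < k \<longrightarrow> {..<i} \<subseteq> chosen (arr s' ''mark''))"])
    fix i s' assume i: "i < n" "reg s' ''v'' = i" "framed ?B s1 s'"
      and I: "?K \<subseteq> chosen (arr s' ''mark'') \<and> reg s' ''cnt'' = card (chosen (arr s' ''mark'')) \<and> reg s' ''cnt'' \<le> k \<and>
        (reg s' ''cnt'' < k \<longrightarrow> {..<i} \<subseteq> chosen (arr s' ''mark''))"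
    have k': "reg s' ''k'' = k" using i(3) s1 by (simp add: agree_off_reg)
    let ?R = "\<lambda>s''. ?K \<subseteq> chosen (arr (set_reg ''v'' (Suc i) s'') ''mark'') \<and>
      reg (set_reg ''v'' (Suc i) s'') ''cnt'' = card (chosen (arr (set_reg ''v'' (Suc i) s'') ''mark'')) \<and>
      reg (set_reg ''v'' (Suc i) s'') ''cnt'' \<le> k \<and>
      (reg (set_reg ''v'' (Suc i) s'') ''cnt'' < k \<longrightarrow> {..<Suc i} \<subseteq> chosen (arr (set_reg ''v'' (Suc i) s'') ''mark''))"
    show "triple (If (Less (Var ''cnt'') (Var ''k'')) (mark_prog (Var ''v'')) Skip) s' 4 ?R"
    proof (rule triple_If[where T = 3])
      assume lt: "bval (Less (Var ''cnt'') (Var ''k'')) s'"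
      show "triple (mark_prog (Var ''v'')) s' 3 ?R"
        by (rule triple_conseq[OF triple_mark[where x = i]])
           (use i I k' lt in \<open>auto simp: lessThan_Suc card_insert_if\<close>)
    next
      assume "\<not> bval (Less (Var ''cnt'') (Var ''k'')) s'"
      then show "triple Skip s' 3 ?R" using I k' by (intro triple_Skip) auto
    qed simp
  next
    fix s' assume I: "?K \<subseteq> chosen (arr s' ''mark'') \<and> reg s' ''cnt'' = card (chosen (arr s' ''mark'')) \<and> reg s' ''cnt'' \<le> k \<and>
        (reg s' ''cnt'' < k \<longrightarrow> {..<n} \<subseteq> chosen (arr s' ''mark''))"
    \<comment> \<open>With fewer than \<open>k\<close> marks no vertex was passed over, so all
      \<open>n \<ge> k\<close> vertices would be marked.\<close>
    have "\<not> reg s' ''cnt'' < k"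
    proof
      assume lt: "reg s' ''cnt'' < k"
      then have "card {..<n} \<le> card (chosen (arr s' ''mark''))" using I by (intro card_mono) auto
      then show False using I lt kn by simp
    qed
    then show "?K \<subseteq> chosen (arr s' ''mark'') \<and> card (chosen (arr s' ''mark'')) = k" using I by simp
  qed (use s1 card_image_le[of "{..<k}" "arr s ''C''"] in auto)
  \<comment> \<open>The output overwrites \<open>C\<close>, which is safe because the centers
    survive as marks.\<close>
  have F: "triple ?F s1 (5 * n + 2) ?Q"
    if s1: "reg s1 ''n'' = n" "reg s1 ''j'' = 0" "?K \<subseteq> M" "card M = k" "M = chosen (arr s1 ''mark'')" for s1 M
  proof (rule triple_For[where T = "\<lambda>_. 3" and I = "\<lambda>i s'. reg s' ''j'' = card (M \<inter> {..<i}) \<and>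
      arr s' ''C'' ` {..<card (M \<inter> {..<i})} = M \<inter> {..<i}"])
    fix i s' assume i: "i < n" "reg s' ''v'' = i" "framed ?F s1 s'"
      and I: "reg s' ''j'' = card (M \<inter> {..<i}) \<and> arr s' ''C'' ` {..<card (M \<inter> {..<i})} = M \<inter> {..<i}"
    have mem: "bval (Less (Lit 0) (Cell ''mark'' (Var ''v''))) s' \<longleftrightarrow> i \<in> M"
      using i s1(5) by (simp add: agree_off_arr chosen_def)
    have fin: "finite (M \<inter> {..<i})" by simp
    have "card (M \<inter> {..<i}) \<le> card {..<i}" by (intro card_mono) auto
    then have jB: "Suc (card (M \<inter> {..<i})) \<le> B" "i \<le> B" using i(1) by (auto intro!: small_le_B(1))
    show "triple ?body s' 3 (\<lambda>s''. reg (set_reg ''v'' (Suc i) s'') ''j'' = card (M \<inter> {..<Suc i}) \<and>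
      arr (set_reg ''v'' (Suc i) s'') ''C'' ` {..<card (M \<inter> {..<Suc i})} = M \<inter> {..<Suc i})"
    proof (rule triple_If[where T = 2])
      assume "bval (Less (Lit 0) (Cell ''mark'' (Var ''v''))) s'"
      then have eq: "M \<inter> {..<Suc i} = insert i (M \<inter> {..<i})" using mem by auto
      have cd: "card (M \<inter> {..<Suc i}) = Suc (card (M \<inter> {..<i}))" unfolding eq using fin by simp
      have "((arr s' ''C'')(card (M \<inter> {..<i}) := i)) ` {..<Suc (card (M \<inter> {..<i}))} =
          insert i (arr s' ''C'' ` {..<card (M \<inter> {..<i})})" by (auto simp: lessThan_Suc)
      then have im: "((arr s' ''C'')(card (M \<inter> {..<i}) := i)) ` {..<Suc (card (M \<inter> {..<i}))} = M \<inter> {..<Suc i}"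
        using I eq by simp
      show "triple (Seq (Store ''C'' (Var ''j'') (Var ''v'')) (Assign ''j'' (Add (Var ''j'') (Lit 1)))) s' 2
        (\<lambda>s''. reg (set_reg ''v'' (Suc i) s'') ''j'' = card (M \<inter> {..<Suc i}) \<and>
          arr (set_reg ''v'' (Suc i) s'') ''C'' ` {..<card (M \<inter> {..<Suc i})} = M \<inter> {..<Suc i})"
        unfolding cd using i(2) I jB im by (intro triple_Store_Seq triple_Assign) auto
    next
      assume "\<not> bval (Less (Lit 0) (Cell ''mark'' (Var ''v''))) s'"
      then have "M \<inter> {..<Suc i} = M \<inter> {..<i}" using mem by (auto simp: less_Suc_eq)
      then show "triple Skip s' 2 (\<lambda>s''. reg (set_reg ''v'' (Suc i) s'') ''j'' = card (M \<inter> {..<Suc i}) \<and>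
          arr (set_reg ''v'' (Suc i) s'') ''C'' ` {..<card (M \<inter> {..<Suc i})} = M \<inter> {..<Suc i})"
        using I by (intro triple_Skip) auto
    qed simp
  next
    fix s' :: state assume "reg s' ''j'' = card (M \<inter> {..<n}) \<and> arr s' ''C'' ` {..<card (M \<inter> {..<n})} = M \<inter> {..<n}"
    moreover have "M \<inter> {..<n} = M" "M \<subseteq> {..<n}" using s1(5) by (auto simp: chosen_def)
    ultimately show "?Q s'" using s1(3,4) by auto
  qed (use s1 in auto)
  have BF: "triple (Seq ?B (Seq (Assign ''j'' (Lit 0)) ?F)) s2 (6 * n + 2 + (5 * n + 3)) ?Q"
    if s2: "reg s2 ''n'' = n" "reg s2 ''k'' = k" "chosen (arr s2 ''mark'') = ?K" "reg s2 ''cnt'' = card ?K" for s2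
  proof (rule triple_Seq_framed[OF B[OF s2], where ?T2.0 = "5 * n + 3"])
    fix s3 assume f3: "framed ?B s2 s3" and p3: "?K \<subseteq> chosen (arr s3 ''mark'') \<and> card (chosen (arr s3 ''mark'')) = k"
    have r3: "reg s3 ''n'' = n" using f3 s2(1) by (simp add: agree_off_reg)
    have "triple ?F (set_reg ''j'' 0 s3) (5 * n + 2) ?Q"
      by (rule F[where M = "chosen (arr s3 ''mark'')"]) (use r3 p3 in auto)
    then show "triple (Seq (Assign ''j'' (Lit 0)) ?F) s3 (5 * n + 3) ?Q"
      by (intro triple_Assign_Seq) auto
  qed simp
  have "triple (Seq ?A (Seq ?B (Seq (Assign ''j'' (Lit 0)) ?F))) (set_reg ''cnt'' 0 (set_reg ''k'' k s))
    (7 + (11 * n + 5 * k)) ?Q" (is "triple _ ?s1 _ _")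
  proof (rule triple_Seq_framed[OF A, where ?T2.0 = "6 * n + 2 + (5 * n + 3)"])
    fix s2 assume f2: "framed ?A ?s1 s2" and p2: "chosen (arr s2 ''mark'') = ?K \<and> reg s2 ''cnt'' = card ?K"
    have "reg s2 ''n'' = n" "reg s2 ''k'' = k" using f2 n by (simp_all add: agree_off_reg)
    then show "triple (Seq ?B (Seq (Assign ''j'' (Lit 0)) ?F)) s2 (6 * n + 2 + (5 * n + 3)) ?Q"
      using p2 by (intro BF) auto
  qed simp_all
  then show ?thesis unfolding distinct_prog_def using kB by (intro triple_Assign_Seq) simp_all
qed

definition total_time :: nat where
  "total_time = 14 + 12 * n + 10 * m + n * (8 * n + 14 * m + 9) + (L + 1) * (attempt_time + 5) + (11 * n + 5 * k + 9)"

lemma bounded_init: "bounded (init_state n es \<omega>)"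
proof -
  have "n \<le> B" by (intro small_le_B(1)) simp
  moreover have "length es \<le> B" using m_le by (intro small_le_B(2)) (simp add: m_def)
  moreover have "fst (es ! i) \<le> B" "snd (es ! i) \<le> B" if "i < length es" for i
    using es_nth[of i] that \<open>n \<le> B\<close> by (auto simp: m_def)
  ultimately show ?thesis by (auto simp: bounded_def init_state_def)
qed

lemma triple_k_center:
  "triple (k_center_prog k l) (init_state n es \<omega>) total_time
    (\<lambda>s. k_center_approx (2 - 1 / (2 * real l)) (1 - 1 / (2 * real l)) {..<n} E k (output_centers k s) (output_radius s))"
  (is "triple _ ?s _ ?Q")
  unfolding k_center_prog_def total_time_def
proof (rule triple_Seq_framed[OF triple_distances, where ?T2.0 = "(L + 1) * (attempt_time + 5) + (11 * n + 5 * k + 9)"])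
  fix s1 assume f1: "framed distances_prog ?s s1" and d1: "dist_ok s1"
  have r1: "reg s1 ''inf'' = 0" "arr s1 ''C'' = (\<lambda>_. 0)" "arr s1 ''mark'' = (\<lambda>_. 0)"
    using f1 by (simp_all add: agree_off_reg agree_off_arr init_state_def)
  show "triple (Seq (optimize_prog k l) (distinct_prog k)) s1 ((L + 1) * (attempt_time + 5) + (11 * n + 5 * k + 9)) ?Q"
  proof (rule triple_Seq_framed[OF triple_optimize[OF d1 r1(1)]])
    show "\<forall>i<k. arr s1 ''C'' i < n" using r1 n_pos by simp
    fix s2 assume f2: "framed (optimize_prog k l) s1 s2" and p2: "(\<forall>i<k. arr s2 ''C'' i < n) \<and>
      (reg s2 ''inf'' = 0 \<and> optimal s2 \<or> reg s2 ''inf'' = 1 \<and> \<not> (\<exists>c. covers k (n - 1) c))"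
    have f2': "agree_off ({''a'', ''lo'', ''st'', ''inf''} \<union> attempt_regs) attempt_arrs s1 s2"
      using f2 by (rule agree_off_mono) (rule mod_optimize)+
    have d2: "dist_ok s2" by (rule dist_ok_cong[OF d1 f2']) auto
    have mk: "arr s2 ''mark'' = (\<lambda>_. 0)" using agree_off_arr[OF f2', of "''mark''"] r1 by simp
    have n2: "reg s2 ''n'' = n" using d2 by (simp add: dist_ok_def)
    have C2: "\<forall>i<k. arr s2 ''C'' i < n" using p2 by simp
    show "triple (distinct_prog k) s2 (11 * n + 5 * k + 9) ?Q"
    proof (rule triple_conseq[OF triple_distinct[OF n2 mk C2]])
      fix s3 assume f3: "framed (distinct_prog k) s2 s3"
        and p3: "arr s3 ''C'' ` {..<k} \<subseteq> {..<n} \<and> card (arr s3 ''C'' ` {..<k}) = k \<and> arr s2 ''C'' ` {..<k} \<subseteq> arr s3 ''C'' ` {..<k}"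
      have r3: "reg s3 ''inf'' = reg s2 ''inf''" "reg s3 ''R'' = reg s2 ''R''"
        using f3 by (simp_all add: agree_off_reg distinct_prog_def)
      have k1: "1 \<le> k" using l by simp
      let ?C = "arr s3 ''C'' ` {..<k}"
      have C3: "?C \<subseteq> {..<n}" "card ?C = k" and sub: "arr s2 ''C'' ` {..<k} \<subseteq> ?C" using p3 by auto
      show "?Q s3"
      proof (cases "reg s2 ''inf'' = 0")
        case True
        then have "optimal s2" using p2 by simp
        then obtain R where R: "covers k (2 * R - R div (2 * l)) (arr s2 ''C'')" "reg s2 ''R'' = 2 * R - R div (2 * l)"
          "R = 0 \<or> \<not> (\<exists>c. covers k (R - 1) c)" unfolding optimal_def by blast
        have cov: "\<forall>v<n. \<exists>c\<in>?C. near (2 * R - R div (2 * l)) v c"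
        proof (intro allI impI)
          fix v assume "v < n"
          then obtain i where "i < k" "near (2 * R - R div (2 * l)) v (arr s2 ''C'' i)"
            using R(1) unfolding covers_def by blast
          moreover have "arr s2 ''C'' i \<in> ?C" using sub \<open>i < k\<close> by blast
          ultimately show "\<exists>c\<in>?C. near (2 * R - R div (2 * l)) v c" by blast
        qed
        have "output_radius s3 = enat (2 * R - R div (2 * l))" using r3 True R(2) by (simp add: output_radius_def)
        then show ?thesis unfolding output_centers_def
          using k_center_approx_finite[OF l(1) k1 C3 cov R(3)] by simp
      next
        case False
        then have "\<not> (\<exists>c. covers k (n - 1) c)" using p2 by simp
        moreover have "output_radius s3 = \<infinity>" using r3 False by (simp add: output_radius_def)
        ultimately show ?thesis unfolding output_centers_def
          using k_center_approx_infinite[OF l(1) k1 C3] by simp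
      qed
    qed simp
  qed simp
qed (auto simp: init_state_def m_def)

end

section \<open>Running time\<close>

lemma enum_time_le:
  assumes "1 \<le> M"
  shows "enum_time t M q \<le> (q + 1) * t * M ^ q"
proof (induction q)
  case (Suc q)
  have "enum_time t M (Suc q) \<le> t * 1 + M * ((q + 1) * t * M ^ q)" using Suc by simp
  also have "\<dots> \<le> t * M ^ Suc q + M * ((q + 1) * t * M ^ q)"
    using assms by (intro add_mono mult_le_mono order_refl one_le_power)
  also have "\<dots> = (Suc q + 1) * t * M ^ Suc q" by (simp add: algebra_simps)
  finally show ?case .
qed simp

text \<open>The recurrence of \<open>search_time\<close>, with \<open>c\<close> for a leaf, 4 for
  the rounding of the ball size and powers of 5 for the sample size.\<close>

fun search_const :: "real \<Rightarrow> nat \<Rightarrow> real" where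
  "search_const c 0 = c"
| "search_const c (Suc q) = 2 * c + 4 * search_const c q + (real q + 2) * c * 5 ^ Suc q"

lemma search_const_nonneg: "0 \<le> c \<Longrightarrow> 0 \<le> search_const c q"
  by (induction q) auto

text \<open>\<open>ball_exp\<close> is \<open>1 - \<sigma>\<close>, where \<open>n powr \<sigma>\<close> is the size of the sample used while \<open>q\<close> centers
  are missing; \<open>search_exp k l q\<close> solves \<open>search_exp (q + 1) = (1 - \<sigma>) + search_exp q = (q + 1) * \<sigma>\<close>,
  which balances the two branches of the search.\<close>

definition ball_exp :: "nat \<Rightarrow> nat \<Rightarrow> nat \<Rightarrow> real" where
  "ball_exp k l r = real (size_num k l r) / real (size_den k l r)"

definition search_exp :: "nat \<Rightarrow> nat \<Rightarrow> nat \<Rightarrow> real" where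
  "search_exp k l q = (let r = real (q - (k - l)) in real q - r + r * (r + 1) / (2 * (real q + 1)))"

lemma ball_exp_eq:
  assumes "k - l < q" and r: "r = q - (k - l)"
  shows "ball_exp k l r = real r * (2 * real q + 1 - real r) / (2 * real q * (real q + 1))"
proof -
  have q: "k - l + r = q" using assms by auto
  have "r \<le> 2 * q + 1" using r by simp
  then have "real (r * (2 * q + 1 - r)) = real r * (2 * real q + 1 - real r)"
    by (simp only: of_nat_mult of_nat_diff of_nat_add of_nat_numeral of_nat_1)
  moreover have "real (2 * q * (q + 1)) = 2 * real q * (real q + 1)"
    by (simp only: of_nat_mult of_nat_add of_nat_numeral of_nat_1)
  ultimately show ?thesis unfolding ball_exp_def size_num_def size_den_def q by simp
qed

lemma search_exp_nonneg: "0 \<le> search_exp k l q"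
proof -
  have "real (q - (k - l)) \<le> real q" by simp
  then show ?thesis by (simp add: search_exp_def Let_def)
qed

text \<open>At positive level both costs agree exactly. At level 0 the ball exponent is 0 and the
  first relation is only \<open>q \<le> q + 1\<close>, whence the inequality.\<close>

lemma search_exp_Suc:
  "ball_exp k l (Suc q - (k - l)) + search_exp k l q \<le> search_exp k l (Suc q)"
  "real (Suc q) * (1 - ball_exp k l (Suc q - (k - l))) = search_exp k l (Suc q)"
proof -
  define r where "r = Suc q - (k - l)"
  have "ball_exp k l r + search_exp k l q \<le> search_exp k l (Suc q) \<and>
    real (Suc q) * (1 - ball_exp k l r) = search_exp k l (Suc q)"
  proof (cases "k - l < Suc q")
    case False
    then have "r = 0" "q - (k - l) = 0" by (auto simp: r_def)
    then show ?thesis using False by (simp add: search_exp_def Let_def ball_exp_def size_num_def)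
  next
    case True
    obtain r' where r': "r = Suc r'" "q - (k - l) = r'" using True by (cases r) (auto simp: r_def)
    define x where "x = real r'"
    define y where "y = real q"
    have y: "0 \<le> y" by (simp add: y_def)
    have b: "ball_exp k l r = (x + 1) * (2 * y + 2 - x) / (2 * (y + 1) * (y + 2))"
      using ball_exp_eq[OF True r_def] by (simp add: r' x_def y_def algebra_simps)
    have s: "search_exp k l q = y - x + x * (x + 1) / (2 * (y + 1))"
      by (simp add: search_exp_def Let_def r' x_def y_def)
    have S: "search_exp k l (Suc q) = y - x + (x + 1) * (x + 2) / (2 * (y + 2))"
      using r' by (simp add: search_exp_def Let_def r_def[symmetric] x_def y_def algebra_simps)
    have "ball_exp k l r + search_exp k l q = search_exp k l (Suc q)"
      unfolding b s S using y by (simp add: divide_simps) (simp add: algebra_simps)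
    moreover have "real (Suc q) * (1 - ball_exp k l r) = search_exp k l (Suc q)"
    proof -
      have "(y + 1) * (1 - (x + 1) * (2 * y + 2 - x) / (2 * (y + 1) * (y + 2))) = y - x + (x + 1) * (x + 2) / (2 * (y + 2))"
        using y by (simp add: divide_simps) (simp add: algebra_simps)
      then show ?thesis unfolding b S by (simp add: y_def add.commute)
    qed
    ultimately show ?thesis by simp
  qed
  then show "ball_exp k l (Suc q - (k - l)) + search_exp k l q \<le> search_exp k l (Suc q)"
    "real (Suc q) * (1 - ball_exp k l (Suc q - (k - l))) = search_exp k l (Suc q)" by (auto simp: r_def)
qed

section \<open>Real bounds for the counted times\<close>

context instance_machine begin

definition lg :: real where "lg = 1 + log 2 (real n)"

lemma lg_ge: "1 \<le> lg"
  using n_pos by (simp add: lg_def)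

lemma L_le_lg: "real L \<le> lg"
proof -
  have "real (2 ^ L) < real (2 * n)" using L_less by (rule of_nat_less_iff[THEN iffD2])
  then have "2 powr real L < 2 * real n" by (simp add: powr_realpow)
  then have "real L < log 2 (2 * real n)" using n_pos by (subst less_log_iff) auto
  also have "\<dots> = lg" using n_pos by (simp add: lg_def log_mult)
  finally show ?thesis by simp
qed

lemma ball_exp_bounds: "r \<le> l \<Longrightarrow> 0 \<le> ball_exp k l r \<and> ball_exp k l r \<le> 1"
  using size_num_le[of r] by (auto simp: ball_exp_def divide_le_eq_1)

text \<open>Two roundings, of \<open>n\<close> up to \<open>2 ^ L < 2 * n\<close> and of the
  exponent up to an integer, cost a factor of at most 2 each; hence 4.\<close>

lemma ball_size_bounds:
  assumes r: "r \<le> l"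
  shows "real n powr ball_exp k l r \<le> real (ball_size r)" "real (ball_size r) \<le> 4 * real n powr ball_exp k l r"
proof -
  define e where "e = size_num k l r"
  define d where "d = size_den k l r"
  define z where "z = size_exp e d"
  define \<tau> where "\<tau> = ball_exp k l r"
  have \<tau>: "\<tau> = real e / real d" "0 \<le> \<tau>" "\<tau> \<le> 1"
    using ball_exp_bounds[OF r] by (auto simp: \<tau>_def ball_exp_def e_def d_def)
  have ed: "e \<le> d" using size_num_le[OF r] by (simp add: e_def d_def)
  have N: "real (ball_size r) = 2 powr real z" by (simp add: ball_size_def z_def e_def d_def powr_realpow)
  have np: "real n > 0" using n_pos by simp
  have lo: "\<tau> * real L \<le> real z"
  \<comment> \<open>For \<open>d = 0\<close> the quotient, and with it the exponent, is 0 by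
    convention.\<close>
  proof (cases "d = 0")
    case False
    have "e * L \<le> d * z" unfolding z_def by (rule size_exp_ge[OF ed])
    then have "real (e * L) \<le> real (d * z)" by (rule of_nat_mono)
    then show ?thesis using False by (simp add: \<tau> field_simps)
  qed (simp add: \<tau>)
  have hi: "real z \<le> \<tau> * real L + 1"
  proof (cases z)
    case 0
    then show ?thesis using \<tau> by simp
  next
    case (Suc i)
    then have "d * i < e * L" using less_size_exp[of i e d] by (simp add: z_def)
    then have "real (d * i) < real (e * L)" by (rule of_nat_less_iff[THEN iffD2])
    moreover have "d \<noteq> 0" using \<open>d * i < e * L\<close> ed by (cases d) auto
    ultimately show ?thesis using Suc by (simp add: \<tau> field_simps)
  qed
  have "real n \<le> real (2 ^ L)" using L_ge by (rule of_nat_mono)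
  then have "real n \<le> 2 powr real L" by (simp add: powr_realpow)
  then have "real n powr \<tau> \<le> (2 powr real L) powr \<tau>" using np \<tau> by (intro powr_mono2) auto
  also have "\<dots> = 2 powr (\<tau> * real L)" by (simp add: powr_powr mult.commute)
  also have "\<dots> \<le> 2 powr real z" using lo by simp
  finally show "real n powr ball_exp k l r \<le> real (ball_size r)" by (simp add: N \<tau>_def)
  have "real (2 ^ L) \<le> real (2 * n)" using L_less by (intro of_nat_mono) simp
  then have L2: "2 powr real L \<le> 2 * real n" by (simp add: powr_realpow)
  have "2 powr real z \<le> 2 powr (\<tau> * real L + 1)" using hi by simp
  also have "\<dots> = 2 * (2 powr real L) powr \<tau>" by (simp add: powr_add powr_powr mult.commute)
  also have "\<dots> \<le> 2 * (2 * real n) powr \<tau>" using L2 \<tau> by (intro mult_left_mono powr_mono2) auto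
  also have "\<dots> = 2 * (2 powr \<tau> * real n powr \<tau>)" using np by (simp add: powr_mult)
  also have "\<dots> \<le> 2 * (2 powr 1 * real n powr \<tau>)" using \<tau> by (intro mult_left_mono mult_right_mono powr_mono) auto
  finally show "real (ball_size r) \<le> 4 * real n powr ball_exp k l r" by (simp add: N \<tau>_def)
qed

text \<open>From \<open>L \<le> lg\<close> and \<open>1 \<le> lg\<close> follows
  \<open>2 * (L + 1) \<le> 4 * lg\<close>, and the additional vertex 0 brings the factor to
  5.\<close>

lemma sample_size_le:
  assumes r: "r \<le> l"
  shows "real (sample_size r) \<le> 5 * lg * real n powr (1 - ball_exp k l r)"
proof -
  let ?\<tau> = "ball_exp k l r"
  have np: "real n \<ge> 1" using n_pos by simp
  have p: "0 < real n powr ?\<tau>" using np by simp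
  have "real (2 * n * (L + 1) div ball_size r) \<le> real (2 * n * (L + 1)) / real (ball_size r)"
    by (rule of_nat_div_le_of_nat)
  also have "\<dots> \<le> real (2 * n * (L + 1)) / (real n powr ?\<tau>)"
    using ball_size_bounds(1)[OF r] p by (intro divide_left_mono mult_pos_pos) (auto simp: ball_size_def)
  also have "\<dots> = 2 * (real L + 1) * (real n powr 1 / real n powr ?\<tau>)"
    using np by (simp add: algebra_simps add_divide_distrib)
  also have "\<dots> = 2 * (real L + 1) * real n powr (1 - ?\<tau>)" by (simp add: powr_diff)
  also have "\<dots> \<le> 2 * (lg + lg) * real n powr (1 - ?\<tau>)"
    using L_le_lg lg_ge by (intro mult_right_mono mult_left_mono add_mono) auto
  finally have 1: "real (2 * n * (L + 1) div ball_size r) \<le> 4 * lg * real n powr (1 - ?\<tau>)" by simp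
  have "1 * 1 \<le> lg * real n powr (1 - ?\<tau>)"
    using lg_ge np ball_exp_bounds[OF r] by (intro mult_mono ge_one_powr_ge_zero) auto
  then show ?thesis using 1 by (simp add: sample_size_def)
qed

lemma leaf_time_le: "real (4 * n + k + 7) \<le> (real k + 11) * real n"
proof -
  have "1 \<le> real n" using n_pos by simp
  moreover from this have "real k * 1 \<le> real k * real n" by (intro mult_left_mono) auto
  ultimately show ?thesis by (simp add: distrib_right)
qed

text \<open>A sample size carries one logarithm, so enumerating \<open>q\<close> vertices gives
  \<open>lg ^ q\<close>; ball sizes carry none. The powers of \<open>n\<close> are compared by
  \<open>search_exp_Suc\<close>, and a leaf contributes the extra factor \<open>n\<close>.\<close>

lemma search_time_le:
  assumes "q \<le> k"
  shows "real (search_time (4 * n + k + 7) ball_size sample_size k l q) \<le>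
    search_const (real k + 11) q * lg ^ q * real n powr (1 + search_exp k l q)"
  using assms
proof (induction q)
  case 0
  show ?case using leaf_time_le n_pos by (simp add: search_exp_def)
next
  case (Suc q)
  define t where "t = 4 * n + k + 7"
  define c where "c = real k + 11"
  define r where "r = l - (k - Suc q)"
  define \<phi> where "\<phi> = search_exp k l (Suc q)"
  define X where "X = lg ^ Suc q * real n powr (1 + \<phi>)"
  have np: "real n \<ge> 1" using n_pos by simp
  have rl: "r \<le> l" by (simp add: r_def)
  have r_eq: "Suc q - (k - l) = r" using Suc.prems l by (simp add: r_def)
  have c0: "0 \<le> c" by (simp add: c_def)
  have t: "real t \<le> c * real n" unfolding t_def c_def by (rule leaf_time_le)
  have lgp: "1 \<le> lg ^ i" for i using lg_ge by (rule one_le_power)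
  have \<phi>0: "0 \<le> \<phi>" by (simp add: \<phi>_def search_exp_nonneg)
  have nX: "real n \<le> X"
  proof -
    have "1 * real n powr 1 \<le> lg ^ Suc q * real n powr (1 + \<phi>)"
      using lgp[of "Suc q"] np \<phi>0 by (intro mult_mono powr_mono) auto
    then show ?thesis using np by (simp add: X_def)
  qed
  have T1: "2 * real t \<le> 2 * c * X"
  proof -
    have "real t \<le> c * X" using t mult_left_mono[OF nX c0] by linarith
    then show ?thesis by simp
  qed
  have IH: "real (search_time t ball_size sample_size k l q) \<le> search_const c q * lg ^ q * real n powr (1 + search_exp k l q)"
    using Suc by (simp add: t_def c_def)
  have T2: "real (ball_size r) * real (search_time t ball_size sample_size k l q) \<le> 4 * search_const c q * X"
  proof -
    have "real (ball_size r) * real (search_time t ball_size sample_size k l q) \<le>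
      (4 * real n powr ball_exp k l r) * (search_const c q * lg ^ q * real n powr (1 + search_exp k l q))"
      using ball_size_bounds(2)[OF rl] IH by (intro mult_mono) auto
    also have "\<dots> = 4 * search_const c q * (lg ^ q * real n powr (ball_exp k l r + (1 + search_exp k l q)))"
      by (simp add: powr_add)
    also have "\<dots> \<le> 4 * search_const c q * X" unfolding X_def
    proof (intro mult_left_mono mult_mono)
      show "lg ^ q \<le> lg ^ Suc q" using lg_ge by (intro power_increasing) auto
      show "real n powr (ball_exp k l r + (1 + search_exp k l q)) \<le> real n powr (1 + \<phi>)"
        using search_exp_Suc(1)[of k l q] np by (intro powr_mono) (auto simp: r_eq \<phi>_def)
    qed (use lg_ge search_const_nonneg[OF c0] in auto)
    finally show ?thesis .
  qed
  have T3: "real (enum_time t (sample_size r) (Suc q)) \<le> (real q + 2) * c * 5 ^ Suc q * X"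
  proof -
    have "enum_time t (sample_size r) (Suc q) \<le> (Suc q + 1) * t * sample_size r ^ Suc q"
      by (rule enum_time_le) (simp add: sample_size_def)
    then have "real (enum_time t (sample_size r) (Suc q)) \<le> real ((Suc q + 1) * t * sample_size r ^ Suc q)"
      by (rule of_nat_mono)
    also have "\<dots> = (real q + 2) * real t * real (sample_size r) ^ Suc q" by (simp add: algebra_simps)
    also have "\<dots> \<le> (real q + 2) * (c * real n) * (5 * lg * real n powr (1 - ball_exp k l r)) ^ Suc q"
      using t sample_size_le[OF rl] c0 by (intro mult_mono power_mono) auto
    also have "(5 * lg * real n powr (1 - ball_exp k l r)) ^ Suc q =
        5 ^ Suc q * lg ^ Suc q * real n powr (real (Suc q) * (1 - ball_exp k l r))"
      using np by (simp only: power_mult_distrib powr_power)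
    also have "real (Suc q) * (1 - ball_exp k l r) = \<phi>" using search_exp_Suc(2)[of q k l] by (simp add: r_eq \<phi>_def)
    also have "(real q + 2) * (c * real n) * (5 ^ Suc q * lg ^ Suc q * real n powr \<phi>) =
        (real q + 2) * c * 5 ^ Suc q * (lg ^ Suc q * (real n powr 1 * real n powr \<phi>))" using np by simp
    also have "\<dots> = (real q + 2) * c * 5 ^ Suc q * X" by (simp only: X_def powr_add)
    finally show ?thesis .
  qed
  have "real (search_time t ball_size sample_size k l (Suc q)) =
      2 * real t + real (ball_size r) * real (search_time t ball_size sample_size k l q) + real (enum_time t (sample_size r) (Suc q))"
    by (simp add: r_def)
  also have "\<dots> \<le> 2 * c * X + 4 * search_const c q * X + (real q + 2) * c * 5 ^ Suc q * X"
    using T1 T2 T3 by linarith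
  also have "\<dots> = search_const c (Suc q) * X" by (simp add: algebra_simps)
  finally show ?case by (simp only: t_def c_def X_def \<phi>_def mult.assoc)
qed

definition bound :: real where
  "bound = real m * real n + real n powr (1 + search_exp k l k)"

definition attempt_const :: real where
  "attempt_const = 23 + 138 * (real l + 1) + search_const (real k + 11) k"

text \<open>The assumption \<open>m \<ge> n - 1\<close> absorbs the quadratic preprocessing:
  \<open>n * n \<le> m * n + n\<close>, and the last \<open>n\<close> is below the second summand of
  \<open>bound\<close>.\<close>

lemma bound_ge:
  "real n * real n \<le> bound" "real n \<le> bound" "1 \<le> bound" "real m * real n \<le> bound" "real m \<le> bound"
  "real n powr (1 + search_exp k l k) \<le> bound"
proof -
  have np: "real n \<ge> 1" using n_pos by simp
  have p: "real n powr 1 \<le> real n powr (1 + search_exp k l k)"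
    using np search_exp_nonneg by (intro powr_mono) auto
  have "n * n \<le> (m + 1) * n" using n_le m_card by (intro mult_le_mono1) simp
  then have "real (n * n) \<le> real ((m + 1) * n)" by (rule of_nat_mono)
  then show nn: "real n * real n \<le> bound" using p np by (simp add: bound_def algebra_simps)
  have "real n * 1 \<le> real n * real n" using np by (intro mult_left_mono) auto
  then show nb: "real n \<le> bound" using nn by linarith
  then show "1 \<le> bound" using np by linarith
  show mn: "real m * real n \<le> bound" by (simp add: bound_def)
  have "real m * 1 \<le> real m * real n" using np by (intro mult_left_mono) auto
  then show "real m \<le> bound" using mn by linarith
  show "real n powr (1 + search_exp k l k) \<le> bound" by (simp add: bound_def)
qed

text \<open>Bisection repeats the search \<open>L + 1\<close> times, which adds a logarithm. The
  constant 92 is the sum of the coefficients in \<open>total_time\<close> outside the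
  bisection.\<close>

lemma total_time_le: "real total_time \<le> (92 + 2 * attempt_const) * lg ^ (k + 2) * bound"
proof -
  have lgp: "1 \<le> lg ^ i" for i using lg_ge by (rule one_le_power)
  let ?n = "real n"
  have s: "real sampling_time \<le> 138 * lg * bound"
  proof -
    have "real sampling_time = (real L + 2) * (8 * (?n * ?n) + 22 * ?n + 16)" by (simp add: sampling_time_def algebra_simps)
    \<comment> \<open>\<open>46 = 8 + 22 + 16\<close>, as \<open>n * n\<close>, \<open>n\<close> and
      1 are all at most \<open>bound\<close>.\<close>
    also have "\<dots> \<le> (3 * lg) * (46 * bound)"
      using L_le_lg lg_ge bound_ge by (intro mult_mono) auto
    finally show ?thesis by simp
  qed
  have st: "real (search_time (4 * n + k + 7) ball_size sample_size k l k) \<le> search_const (real k + 11) k * lg ^ k * bound"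
  proof -
    have "search_const (real k + 11) k * lg ^ k * real n powr (1 + search_exp k l k) \<le> search_const (real k + 11) k * lg ^ k * bound"
      using bound_ge search_const_nonneg[of "real k + 11" k] lg_ge by (intro mult_left_mono) auto
    then show ?thesis using search_time_le[of k] by linarith
  qed
  have at: "real attempt_time + 5 \<le> attempt_const * (lg ^ (k + 1) * bound)"
  proof -
    let ?X = "lg ^ (k + 1) * bound"
    have b0: "0 \<le> bound" using bound_ge by linarith
    have X1: "bound \<le> ?X" using mult_right_mono[OF lgp[of "k + 1"] b0] by simp
    have "lg ^ 1 \<le> lg ^ (k + 1)" "lg ^ k \<le> lg ^ (k + 1)" using lg_ge by (intro power_increasing; simp)+
    then have X2: "lg * bound \<le> ?X" "lg ^ k * bound \<le> ?X" using b0 by (auto intro: mult_right_mono)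
    have "real attempt_time + 5 = 12 * ?n + 11 + (real l + 1) * real sampling_time +
        real (search_time (4 * n + k + 7) ball_size sample_size k l k)" by (simp add: attempt_time_def algebra_simps)
    also have "\<dots> \<le> 12 * bound + 11 * bound + (real l + 1) * (138 * lg * bound) + search_const (real k + 11) k * lg ^ k * bound"
      using s st bound_ge by (intro add_mono mult_left_mono) auto
    also have "\<dots> \<le> 23 * ?X + (real l + 1) * (138 * ?X) + search_const (real k + 11) k * ?X"
    proof -
      have "(real l + 1) * (138 * lg * bound) \<le> (real l + 1) * (138 * ?X)" using X2(1) by (intro mult_left_mono) auto
      moreover have "search_const (real k + 11) k * lg ^ k * bound \<le> search_const (real k + 11) k * ?X"
        using X2(2) search_const_nonneg[of "real k + 11" k] by (simp only: mult.assoc) (intro mult_left_mono, auto)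
      ultimately show ?thesis using X1 by linarith
    qed
    also have "\<dots> = attempt_const * ?X" by (simp add: attempt_const_def algebra_simps)
    finally show ?thesis .
  qed
  let ?Y = "lg ^ (k + 2) * bound"
  have b0: "0 \<le> bound" using bound_ge by linarith
  have Y1: "bound \<le> ?Y" using mult_right_mono[OF lgp[of "k + 2"] b0] by simp
  have kn': "real k \<le> ?n" using kn by simp
  have "(real L + 1) * (real attempt_time + 5) \<le> (2 * lg) * (attempt_const * (lg ^ (k + 1) * bound))"
    using L_le_lg lg_ge at by (intro mult_mono) auto
  also have "\<dots> = 2 * attempt_const * ?Y" by (simp add: algebra_simps)
  finally have A: "(real L + 1) * (real attempt_time + 5) \<le> 2 * attempt_const * ?Y" .
  have "real total_time = 14 + 12 * ?n + 10 * real m + (8 * (?n * ?n) + 14 * (real m * ?n) + 9 * ?n) +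
      (real L + 1) * (real attempt_time + 5) + (11 * ?n + 5 * real k + 9)"
    by (simp add: total_time_def algebra_simps)
  also have "\<dots> \<le> 92 * bound + 2 * attempt_const * ?Y" using A bound_ge kn' by linarith
  also have "\<dots> \<le> 92 * ?Y + 2 * attempt_const * ?Y" using Y1 by linarith
  also have "\<dots> = (92 + 2 * attempt_const) * lg ^ (k + 2) * bound" by (simp add: algebra_simps)
  finally show ?thesis .
qed

text \<open>\<open>B\<close> is quadratic in \<open>n\<close>, so \<open>Z * B\<close> has
  logarithmic length: the logarithmic cost criterion adds one more factor \<open>lg\<close> to the
  time.\<close>

lemma tick_le:
  assumes B: "B \<le> c * (n * n)" and c: "1 \<le> c" and Z: "1 \<le> Z"
  shows "real tick \<le> (1 + real Z * (3 + log 2 (real (Z * c)))) * lg"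
proof -
  have np: "real n \<ge> 1" using n_pos by simp
  have zb: "1 \<le> Z * B" using B_pos Z by simp
  then have zbr: "0 < real (Z * B)" by (simp only: of_nat_0_less_iff)
  have zc: "1 \<le> real (Z * c)" using c Z by (metis of_nat_1 of_nat_mono mult_le_mono nat_mult_1)
  have "Z * B \<le> Z * c * (n * n)" using mult_le_mono2[OF B, of Z] by (simp add: mult.assoc)
  then have le: "real (Z * B) \<le> real (Z * c) * (real n * real n)" by (metis of_nat_mono of_nat_mult)
  then have "log 2 (real (Z * B)) \<le> log 2 (real (Z * c) * (real n * real n))"
    using zbr order_less_le_trans[OF zbr le] by (subst log_le_cancel_iff) simp_all
  also have "\<dots> = log 2 (real (Z * c)) + (log 2 (real n) + log 2 (real n))"
    using np zc by (subst log_mult_pos) (auto simp: log_mult_pos)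
  finally have "real (num_len (Z * B)) \<le> 1 + (log 2 (real (Z * c)) + (log 2 (real n) + log 2 (real n)))"
    using num_len_le_log[OF zb] by linarith
  also have "\<dots> \<le> (3 + log 2 (real (Z * c))) * lg"
  proof -
    have "0 \<le> log 2 (real (Z * c))" "0 \<le> log 2 (real n)" using zc np by auto
    then have "log 2 (real (Z * c)) * 1 \<le> log 2 (real (Z * c)) * lg" using lg_ge by (intro mult_left_mono) auto
    moreover have "1 + (log 2 (real n) + log 2 (real n)) \<le> 3 * lg" using \<open>0 \<le> log 2 (real n)\<close> by (simp add: lg_def)
    ultimately show ?thesis by (simp add: algebra_simps)
  qed
  finally have nl: "real (num_len (Z * B)) \<le> (3 + log 2 (real (Z * c))) * lg" .
  have "real tick = 1 + real Z * real (num_len (Z * B))" by (simp add: tick_def)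
  also have "\<dots> \<le> lg + real Z * ((3 + log 2 (real (Z * c))) * lg)"
    using nl lg_ge by (intro add_mono mult_left_mono) auto
  also have "\<dots> = (1 + real Z * (3 + log 2 (real (Z * c)))) * lg" by (simp add: algebra_simps)
  finally show ?thesis .
qed

end

section \<open>The main theorem\<close>

lemma combinatorial_times_exp [simp]: "combinatorial_aexp e \<Longrightarrow> combinatorial_aexp (times_exp c e)"
  by (induction c) auto

lemma combinatorial_gap_exp [simp]: "combinatorial_aexp (gap_exp r)"
  by (simp add: gap_exp_def)

lemma combinatorial_all_test [simp]: "(\<And>i. combinatorial_bexp (f i)) \<Longrightarrow> combinatorial_bexp (all_test f j)"
  by (induction j) auto

lemma combinatorial_near_test [simp]:
  "combinatorial_aexp y \<Longrightarrow> combinatorial_aexp g \<Longrightarrow> combinatorial_bexp (near_test x y g)"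
  by (simp add: near_test_def)

lemma combinatorial_For [simp]: "combinatorial (For x y P) \<longleftrightarrow> combinatorial P"
  by (simp add: For_def)

lemma combinatorial_distances [simp]: "combinatorial distances_prog"
  by (simp add: distances_prog_def powers_prog_def rows_prog_def adjacency_prog_def arc_prog_def bfs_prog_def
      queue_prog_def scan_prog_def)

lemma combinatorial_samples [simp]: "combinatorial (samples_prog k l i)"
  by (induction i) (auto simp: sample_prog_def size_prog_def heavy_prog_def count_prog_def pass_prog_def clear_prog_def
      unhit_test_def)

lemma combinatorial_copy [simp]: "combinatorial (copy_prog i)"
  by (induction i) auto

lemma combinatorial_leaf [simp]: "combinatorial (leaf_prog k)"
  by (simp add: leaf_prog_def)

lemma combinatorial_enum [simp]: "combinatorial (enum_prog k r q)"
  by (induction q) (auto simp: branch_prog_def)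

lemma combinatorial_search [simp]: "combinatorial (search_prog k l q)"
  by (induction q) (auto simp: branch_prog_def pivot_prog_def uncovered_test_def)

lemma combinatorial_k_center: "combinatorial (k_center_prog k l)"
  by (simp add: k_center_prog_def optimize_prog_def bisect_prog_def attempt_prog_def radius_prog_def
      distinct_prog_def mark_prog_def)

text \<open>\<open>Z\<close> and \<open>c\<close> depend on the program alone, hence only on
  \<open>k\<close> and \<open>l\<close>, so that \<open>K\<close> is uniform; \<open>B\<close>
  depends on \<open>n\<close> and is fixed per instance.\<close>

lemma k_center_exec:
  assumes l: "1 \<le> l" "l \<le> k"
  shows "\<exists>K. \<forall>n E es. k_center_instance k n E es \<longrightarrow> (\<forall>\<omega>. \<exists>t s'.
    exec (k_center_prog k l) (init_state n es \<omega>) t s' \<and>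
    real t \<le> K * (real (card E) * real n + real n powr (1 + search_exp k l k)) * (1 + log 2 (real n)) ^ (k + 3) \<and>
    k_center_approx (2 - 1 / (2 * real l)) (1 - 1 / (2 * real l)) {..<n} E k (output_centers k s') (output_radius s'))"
proof -
  let ?P = "k_center_prog k l"
  define Z where "Z = csize ?P + 1"
  define c where "c = 400 * (k + 1)\<^sup>2 + clit ?P"
  define K1 where "K1 = 92 + 2 * (23 + 138 * (real l + 1) + search_const (real k + 11) k)"
  define K2 where "K2 = 1 + real Z * (3 + log 2 (real (Z * c)))"
  have "\<exists>t s'. exec ?P (init_state n es \<omega>) t s' \<and>
      real t \<le> (K1 * K2) * (real (card E) * real n + real n powr (1 + search_exp k l k)) * (1 + log 2 (real n)) ^ (k + 3) \<and>
      k_center_approx (2 - 1 / (2 * real l)) (1 - 1 / (2 * real l)) {..<n} E k (output_centers k s') (output_radius s')"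
    if inst: "k_center_instance k n E es" for n E es \<omega>
  proof -
    \<comment> \<open>The summand \<open>clit ?P\<close> makes room for the literals of the
      program.\<close>
    define B where "B = 100 * (k + 1)\<^sup>2 * (n + 1)\<^sup>2 + clit ?P"
    interpret instance_machine B Z n E k l es
    proof
      show "1 \<le> B" by (simp add: B_def Suc_le_eq)
      show "simple_graph {..<n} E" "k \<le> n" "edge_list_of es E" "n \<le> card E + 1"
        using inst by (auto simp: k_center_instance_def)
      show "1 \<le> l" "l \<le> k" by (rule l)+
      show "100 * (k + 1)\<^sup>2 * (n + 1)\<^sup>2 \<le> B" by (simp add: B_def)
    qed
    have "admissible ?P" unfolding admissible_def using combinatorial_k_center by (simp add: Z_def B_def)
    then obtain t s' where e: "exec ?P (init_state n es \<omega>) t s'" "t \<le> total_time * tick"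
      "k_center_approx (2 - 1 / (2 * real l)) (1 - 1 / (2 * real l)) {..<n} E k (output_centers k s') (output_radius s')"
      using triple_k_center[of \<omega>] bounded_init[of \<omega>] unfolding triple_def by blast
    have "B \<le> c * (n * n)"
    proof -
      have "(n + 1)\<^sup>2 \<le> (2 * n)\<^sup>2" using n_pos by (intro power_mono) auto
      then have "100 * (k + 1)\<^sup>2 * (n + 1)\<^sup>2 \<le> 100 * (k + 1)\<^sup>2 * (2 * n)\<^sup>2" by (rule mult_le_mono2)
      also have "\<dots> = 400 * (k + 1)\<^sup>2 * (n * n)" by (simp add: power2_eq_square)
      finally have "100 * (k + 1)\<^sup>2 * (n + 1)\<^sup>2 \<le> 400 * (k + 1)\<^sup>2 * (n * n)" .
      moreover have "clit ?P * 1 \<le> clit ?P * (n * n)" using n_pos by (intro mult_le_mono2) simp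
      ultimately show ?thesis unfolding B_def c_def add_mult_distrib by linarith
    qed
    then have tk: "real tick \<le> K2 * lg" unfolding K2_def by (rule tick_le) (auto simp: c_def Z_def Suc_le_eq)
    have tt: "real total_time \<le> K1 * lg ^ (k + 2) * bound"
      using total_time_le by (simp add: K1_def attempt_const_def)
    have "real t \<le> real (total_time * tick)" using e(2) by (rule of_nat_mono)
    also have "\<dots> = real total_time * real tick" by simp
    also have "\<dots> \<le> (K1 * lg ^ (k + 2) * bound) * (K2 * lg)"
      by (rule mult_mono[OF tt tk]) (use tt in \<open>auto intro: order_trans[OF of_nat_0_le_iff]\<close>)
    also have "\<dots> = (K1 * K2) * bound * lg ^ (k + 3)" by (simp add: algebra_simps power_add eval_nat_numeral)
    finally show ?thesis using e unfolding bound_def lg_def m_card by blast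
  qed
  then show ?thesis by blast
qed

theorem mainTheorem12:
  fixes k l :: nat
  assumes "1 \<le> l" and "l \<le> k"
  shows "\<exists>P. combinatorial P \<and>
    runs_in_soft_O P k (\<lambda>n m. real m * real n +
      real n powr (real k - real l + real l * (real l + 1) / (2 * (real k + 1)) + 1)) \<and>
    approximates_k_center_whp P k (2 - 1 / (2 * real l)) (1 - 1 / (2 * real l))"
proof -
  let ?P = "k_center_prog k l"
  let ?good = "\<lambda>n E s'. k_center_approx (2 - 1 / (2 * real l)) (1 - 1 / (2 * real l)) {..<n} E k (output_centers k s') (output_radius s')"
  have ex: "1 + search_exp k l k = real k - real l + real l * (real l + 1) / (2 * (real k + 1)) + 1"
    using assms by (simp add: search_exp_def Let_def)
  obtain K where K: "\<And>n E es \<omega>. k_center_instance k n E es \<Longrightarrow> \<exists>t s'.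
    exec ?P (init_state n es \<omega>) t s' \<and>
    real t \<le> K * (real (card E) * real n + real n powr (1 + search_exp k l k)) * (1 + log 2 (real n)) ^ (k + 3) \<and> ?good n E s'"
    using k_center_exec[OF assms] by blast
  have "runs_in_soft_O ?P k (\<lambda>n m. real m * real n +
      real n powr (real k - real l + real l * (real l + 1) / (2 * (real k + 1)) + 1))"
    unfolding runs_in_soft_O_def ex[symmetric] using K by blast
  moreover have "approximates_k_center_whp ?P k (2 - 1 / (2 * real l)) (1 - 1 / (2 * real l))"
    unfolding approximates_k_center_whp_def
  proof (intro exI[of _ 1] conjI allI impI)
    fix n E es assume inst: "k_center_instance k n E es"
    interpret prob_space coin_tape
      unfolding coin_tape_def by (rule prob_space.prob_space_stream_space) (rule prob_space_measure_pmf)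
    \<comment> \<open>The output is correct for every tape, so the event is the whole space and has
      probability 1.\<close>
    have "{\<omega> \<in> space coin_tape. \<exists>t s'. exec ?P (init_state n es \<omega>) t s' \<and> ?good n E s'} = space coin_tape"
      using K[OF inst] by blast
    then show "\<P>(\<omega> in coin_tape. \<exists>t s'. exec ?P (init_state n es \<omega>) t s' \<and> ?good n E s') \<ge> 1 - 1 / real n powr 1"
      using prob_space by simp
  qed simp
  ultimately show ?thesis using combinatorial_k_center by blast
qed

end
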